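(* Let $\lambda$ be a partition with at most $n$ parts. A row bound set $\mathcal{S}_\lambda(\beta)$ for $\beta\in U_\lambda(n)$ equals some Demazure set $\mathcal{D}_\lambda(\pi)$ ($\pi$ a $\lambda$-permutation) if and only if $\Delta_\lambda(\beta)$ is a gapless $\lambda$-tuple. Therefore every flag bound set $\mathcal{S}_\lambda(\varphi)$, $\varphi\in UF_\lambda(n)$, equals some Demazure set, and a row bound set equals some Demazure set if and only if it equals some flag bound set. A Demazure set $\mathcal{D}_\lambda(\pi)$ equals some row bound set if and only if $\pi$ is $\lambda$-312-avoiding. Specifically: (i) Let $\beta\in U_\lambda(n)$. If $\beta\in UGC_\lambda(n)$, set $\pi:=\Pi_\lambda[\Delta_\lambda(\beta)]$. Then $\mathcal{S}_\lambda(\beta)=\mathcal{D}_\lambda(\pi)$, $\pi$ is the unique $\lambda$-permutation for which this holds, and $\pi\in S_n^{\lambda\text{-}312}$. (ii) Let $\pi\in S_n^\lambda$. If $\pi\in S_n^{\lambda\text{-}312}$, set $\gamma:=\Psi_\lambda(\pi)$. Then $\mathcal{D}_\lambda(\pi)=\mathcal{S}_\lambda(\gamma)$, and $\mathcal{D}_\lambda(\pi)=\mathcal{S}_\lambda(\beta)$ for some $\beta\in U_\lambda(n)$ implies $\Delta_\lambda(\beta)=\gamma$. Here $\gamma\in UG_\lambda(n)$ and so $\beta\in UGC_\lambda(n)$. (iii) If $\beta\in U_\lambda(n)$ and $\pi\in S_n^\lambda$ satisfy $\mathcal{S}_\lambda(\beta)=\mathcal{D}_\lambda(\pi)$, then $Q_\lambda(\beta)=Y_\lambda(\pi)$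 and $\Delta_\lambda(\beta)=\Psi_\lambda(\pi)$; moreover $\beta\in UGC_\lambda(n)$ and $\pi\in S_n^{\lambda\text{-}312}$. (iv) The collection of sets $\mathcal{S}_\lambda(\varphi)$ for $\varphi\in UF_\lambda(n)$ equals the collection of sets $\mathcal{D}_\lambda(\pi)$ for $\pi\in S_n^{\lambda\text{-}312}$. Both are bijectively indexed by $\gamma\in UG_\lambda(n)$ via $\gamma\mapsto\mathcal{S}_\lambda(\Phi_\lambda(\gamma))$ and $\gamma\mapsto\mathcal{D}_\lambda(\Pi_\lambda(\gamma))$ respectively, and these two indexings agree: $\mathcal{S}_\lambda(\Phi_\lambda(\gamma))=\mathcal{D}_\lambda(\Pi_\lambda(\gamma))$, with $\Phi_\lambda(\gamma)$ an R-floor flag and $\Pi_\lambda(\gamma)\in S_n^{\lambda\text{-}312}$.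
   Context: Fix $n\ge1$; $[m]=\{1,\dots,m\}$, $(a,b]=\{a+1,\dots,b\}$; for finite $Q\subset\mathbb{Z}$, $\mathrm{rank}^d(Q)$ is its $d$-th largest element. Partition $\lambda=(\lambda_1\ge\cdots\ge\lambda_n\ge0)$; shape boxes $(j,i)$, $1\le j\le\lambda_1$, $1\le i\le\zeta_j=\#\{i:\lambda_i\ge j\}$. Let $R=R_\lambda\subseteq[n-1]$ be the set of column lengths less than $n$, $R=\{q_1<\cdots<q_r\}$, $q_0=0$, $q_{r+1}=n$, $p_h=q_h-q_{h-1}$; the $h$-th carrel is $(q_{h-1},q_h]$. The prefix/subscript "$\lambda$" means "$R_\lambda$". A $\lambda$-tuple is $\nu=(\nu_1,\dots,\nu_n)$ with $\nu_i\in[n]$, ordered entrywise; upper if $\nu_i\ge i$ for all $i$ ($U_\lambda(n)$); $UF_\lambda(n)$ = upper weakly increasing tuples (upper flags); $UI_\lambda(n)$ = upper tuples strictly increasing on each carrel. A $\lambda$-permutation is a permutation $\pi$ of $[n]$ strictly increasing on each carrel ($S_n^\lambda$); it is $\lambda$-312-containing if there exist $h\in[r-1]$, $a\le q_h<b\le q_{h+1}<c\le n$ with $\pi_b<\pi_c<\pi_a$, otherwise $\lambda$-312-avoiding ($S_n^{\lambda\text{-}312}$). Rank tuple: with $B_h=\{\pi_1,\dots,\pi_{q_h}\}$, $\Psi_\lambda(\pi)_i=\mathrm{rank}^{q_h-i+1}(B_h)$ for $i\in(q_{h-1},q_h]$. Gapless $\lambda$-tuple: $\gamma\in UI_\lambda(n)$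 such that for each $h\in[r]$ with $\gamma_{q_h}>\gamma_{q_h+1}$, $s=\gamma_{q_h}-\gamma_{q_h+1}+1\le p_{h+1}$ and $\gamma_{q_h+t}=\gamma_{q_h}-s+t$ for $t=1,\dots,s$; $UG_\lambda(n)$ their set. $\Pi_\lambda(\gamma)=\pi$ for $\gamma\in UG_\lambda(n)$: $\pi_i=\gamma_i$ on $(0,q_1]$; for $h\in[r]$, $s=\gamma_{q_h}-\gamma_{q_h+1}+1$ if $\gamma_{q_h}>\gamma_{q_h+1}$ else $s=0$; $\pi_i=\gamma_i$ on $(q_h+s,q_{h+1}]$ and $\pi_i=\mathrm{rank}^{q_h+s-i+1}([\gamma_{q_h}]\setminus\{\pi_1,\dots,\pi_{q_h}\})$ on $(q_h,q_h+s]$. Critical indices of $\upsilon\in U_\lambda(n)$: in carrel $h$, $x_1=q_h$ and recursively, while possible, $x_u$ = largest $x\in(q_{h-1},x_{u-1})$ with $\upsilon_{x_{u-1}}-\upsilon_x>x_{u-1}-x$. Core $\Delta_\lambda(\upsilon)=\delta$: $\delta_x=\upsilon_x$ at critical $x$, and $\delta_i=\upsilon_x-(x-i)$ for non-critical $i$, $x$ the smallest critical index $>i$. $UGC_\lambda(n)=\{\upsilon\in U_\lambda(n):\Delta_\lambda(\upsilon)\in UG_\lambda(n)\}$. Floor map: for $\gamma\in UG_\lambda(n)$, $\Phi_\lambda(\gamma)_i=\max\{\gamma_{q_h},\gamma_i\}$ if $h\in[r]$ and $q_h<i<x$ with $x$ the smallest critical index of $\gamma$ in $(q_h,q_{h+1}]$,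 and $\Phi_\lambda(\gamma)_i=\gamma_i$ otherwise. Tableaux: fillings $T$ of the shape with $T_j(i)\in[n]$ strictly increasing down columns, weakly along rows; $\mathcal{T}_\lambda$, ordered entrywise. Row bound set $\mathcal{S}_\lambda(\beta)=\{T\in\mathcal{T}_\lambda:T_j(i)\le\beta_i \ \forall (j,i)\}$ (flag bound set if $\beta$ is an upper flag); $Q_\lambda(\beta)$ = entrywise maximum of $\mathcal{S}_\lambda(\beta)$. $Y(Q)$: column with entries $Q$ increasing downward; $\lambda$-key $Y_\lambda(\pi)$: columns left to right are $\lambda_n$ copies of $Y([n])$, then for $h=r,\dots,1$, $\lambda_{q_h}-\lambda_{q_{h+1}}$ copies of $Y(B_h)$. Scanning tableau $S(T)$: EWIS of $x_1,x_2,\dots$ is $x_{i_1},x_{i_2},\dots$, $i_1=1$, $i_u$ smallest index $>i_{u-1}$ with $x_{i_u}\ge x_{i_{u-1}}$; column $j$ of $S(T)$: with columns $j,\dots,\lambda_1$ of $T$ unmarked, repeat $\zeta_j$ times: read the values of the lowest unmarked boxes of columns still having unmarked boxes left to right, take the EWIS, mark its boxes, put its last value in the lowest empty box of column $j$. Demazure set $\mathcal{D}_\lambda(\pi)=\{T:S(T)\le Y_\lambda(\pi)\}$.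
   Formalization: In the definition of Π_λ, s=γ_{q_h}-γ_{q_h+1}+1 is used when γ_{q_h} ≥ γ_{q_h+1} (so s=1 at equality), not only when γ_{q_h} > γ_{q_h+1}; otherwise for n=2, λ=(1,0), γ=(2,2) one gets π=(2,2), which is not a permutation. *)

theory Defs
  imports "HOL-Combinatorics.Permutations" "HOL-Library.FuncSet"
begin

text \<open>
  Conventions.  All indices are 1-based.  Tuples indexed by \<^term>\<open>{1..n}\<close> and tableaux indexed by
  boxes are extensional functions, so that equality of functions is entrywise equality.
  Permutations of \<^term>\<open>{1..n}\<close> are functions that permute \<^term>\<open>{1..n}\<close> in the library sense
  (the identity elsewhere).  A partition is a function \<open>lam\<close> of which only the values
  \<open>lam 1, \<dots>, lam n\<close> are used.  Notions depending on the partition only through its set \<open>R\<close> of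
  column lengths less than \<open>n\<close> take \<open>n\<close> and \<open>R\<close> as parameters.
\<close>

definition rank_desc :: "nat \<Rightarrow> nat set \<Rightarrow> nat" where
  "rank_desc d Q = rev (sorted_list_of_set Q) ! (d - 1)"


section \<open>Partitions, shapes and carrels\<close>

definition is_partition :: "nat \<Rightarrow> (nat \<Rightarrow> nat) \<Rightarrow> bool" where
  "is_partition n lam \<longleftrightarrow> antimono_on {1..n} lam"

definition col_len :: "nat \<Rightarrow> (nat \<Rightarrow> nat) \<Rightarrow> nat \<Rightarrow> nat" where
  "col_len n lam j = card {i \<in> {1..n}. j \<le> lam i}"

type_synonym box = "nat \<times> nat"

text \<open>A box \<open>(j, i)\<close> lies in column \<open>j\<close> and row \<open>i\<close>.\<close>

definition shape :: "nat \<Rightarrow> (nat \<Rightarrow> nat) \<Rightarrow> box set" where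
  "shape n lam = {(j, i). 1 \<le> j \<and> j \<le> lam 1 \<and> 1 \<le> i \<and> i \<le> col_len n lam j}"

definition short_col_lens :: "nat \<Rightarrow> (nat \<Rightarrow> nat) \<Rightarrow> nat set" where
  "short_col_lens n lam = {c. c < n \<and> (\<exists>j\<in>{1..lam 1}. c = col_len n lam j)}"

text \<open>\<open>carrel_end n R h\<close> is \<open>q\<^sub>h\<close>, for \<open>0 \<le> h \<le> r + 1\<close> with \<open>r = card R\<close>.\<close>

definition carrel_end :: "nat \<Rightarrow> nat set \<Rightarrow> nat \<Rightarrow> nat" where
  "carrel_end n R h =
     (if h = 0 then 0 else if h \<le> card R then sorted_list_of_set R ! (h - 1) else n)"

definition carrel :: "nat \<Rightarrow> nat set \<Rightarrow> nat \<Rightarrow> nat set" where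
  "carrel n R h = {carrel_end n R (h - 1) <.. carrel_end n R h}"

definition carrel_size :: "nat \<Rightarrow> nat set \<Rightarrow> nat \<Rightarrow> nat" where
  "carrel_size n R h = carrel_end n R h - carrel_end n R (h - 1)"

definition carrel_index :: "nat \<Rightarrow> nat set \<Rightarrow> nat \<Rightarrow> nat" where
  "carrel_index n R i = (THE h. h \<in> {1..card R + 1} \<and> i \<in> carrel n R h)"


section \<open>Tuples\<close>

type_synonym tuple = "nat \<Rightarrow> nat"

definition upper_tuples :: "nat \<Rightarrow> tuple set" where
  "upper_tuples n = {v \<in> {1..n} \<rightarrow>\<^sub>E {1..n}. \<forall>i\<in>{1..n}. i \<le> v i}"

definition upper_flags :: "nat \<Rightarrow> tuple set" where
  "upper_flags n = {v \<in> upper_tuples n. mono_on {1..n} v}"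

definition upper_increasing :: "nat \<Rightarrow> nat set \<Rightarrow> tuple set" where
  "upper_increasing n R =
     {v \<in> upper_tuples n. \<forall>h\<in>{1..card R + 1}. strict_mono_on (carrel n R h) v}"

text \<open>With \<open>s = \<gamma>(q\<^sub>h) - \<gamma>(q\<^sub>h + 1) + 1\<close> no natural number subtraction below is truncated.\<close>

definition gapless_tuples :: "nat \<Rightarrow> nat set \<Rightarrow> tuple set" where
  "gapless_tuples n R =
     {g \<in> upper_increasing n R.
        \<forall>h\<in>{1..card R}. let q = carrel_end n R h; s = g q - g (q + 1) + 1 in
          g q > g (q + 1) \<longrightarrow>
            s \<le> carrel_size n R (h + 1) \<and> (\<forall>t\<in>{1..s}. g (q + t) = g q - s + t)}"

text \<open>
  The critical indices of a carrel: its last index, and after a critical index \<open>x\<close> the largest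
  \<open>y < x\<close> of the carrel with \<open>v x - v y > x - y\<close>, if there is one.
\<close>

inductive_set critical :: "nat \<Rightarrow> nat set \<Rightarrow> tuple \<Rightarrow> nat set"
  for n :: nat and R :: "nat set" and v :: tuple where
  last: "h \<in> {1..card R + 1} \<Longrightarrow> carrel_end n R h \<in> critical n R v"
| step: "\<lbrakk>x \<in> critical n R v; h \<in> {1..card R + 1}; x \<in> carrel n R h; y \<in> carrel n R h; y < x;
          int (v x) - int (v y) > int x - int y;
          \<forall>z. y < z \<and> z < x \<longrightarrow> \<not> int (v x) - int (v z) > int x - int z\<rbrakk>
         \<Longrightarrow> y \<in> critical n R v"

definition core :: "nat \<Rightarrow> nat set \<Rightarrow> tuple \<Rightarrow> tuple" where
  "core n R v = restrict
     (\<lambda>i. if i \<in> critical n R v then v i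
          else let x = (LEAST x. x \<in> critical n R v \<and> i < x) in v x - (x - i)) {1..n}"

definition gapless_core_tuples :: "nat \<Rightarrow> nat set \<Rightarrow> tuple set" where
  "gapless_core_tuples n R = {v \<in> upper_tuples n. core n R v \<in> gapless_tuples n R}"

definition floor_map :: "nat \<Rightarrow> nat set \<Rightarrow> tuple \<Rightarrow> tuple" where
  "floor_map n R g = restrict
     (\<lambda>i. let h = carrel_index n R i - 1; q = carrel_end n R h;
              x = (LEAST x. x \<in> critical n R g \<and> x \<in> carrel n R (h + 1))
          in if h \<in> {1..card R} \<and> q < i \<and> i < x then max (g q) (g i) else g i) {1..n}"

text \<open>
  An upper flag is an \<open>R\<close>-floor flag if every nontrivial plateau (maximal constant run of length at
  least two) starts at some \<open>q\<^sub>h\<close> with \<open>1 \<le> h \<le> r\<close>.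
\<close>

definition floor_flags :: "nat \<Rightarrow> nat set \<Rightarrow> tuple set" where
  "floor_flags n R =
     {f \<in> upper_flags n.
        \<forall>i. 1 \<le> i \<and> i < n \<and> f i = f (i + 1) \<and> (i = 1 \<or> f (i - 1) \<noteq> f i)
          \<longrightarrow> (\<exists>h\<in>{1..card R}. i = carrel_end n R h)}"


section \<open>Permutations\<close>

definition R_perms :: "nat \<Rightarrow> nat set \<Rightarrow> tuple set" where
  "R_perms n R =
     {p. p permutes {1..n} \<and> (\<forall>h\<in>{1..card R + 1}. strict_mono_on (carrel n R h) p)}"

definition contains_312 :: "nat \<Rightarrow> nat set \<Rightarrow> tuple \<Rightarrow> bool" where
  "contains_312 n R p \<longleftrightarrow>
     (\<exists>h\<in>{1..card R - 1}. \<exists>a b c.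
        1 \<le> a \<and> a \<le> carrel_end n R h \<and> carrel_end n R h < b \<and> b \<le> carrel_end n R (h + 1) \<and>
        carrel_end n R (h + 1) < c \<and> c \<le> n \<and> p b < p c \<and> p c < p a)"

definition R_312_avoiding :: "nat \<Rightarrow> nat set \<Rightarrow> tuple set" where
  "R_312_avoiding n R = {p \<in> R_perms n R. \<not> contains_312 n R p}"

definition init_set :: "nat \<Rightarrow> nat set \<Rightarrow> tuple \<Rightarrow> nat \<Rightarrow> nat set" where
  "init_set n R p h = p ` {1..carrel_end n R h}"

definition rank_tuple :: "nat \<Rightarrow> nat set \<Rightarrow> tuple \<Rightarrow> tuple" where
  "rank_tuple n R p = restrict
     (\<lambda>i. let h = carrel_index n R i
          in rank_desc (carrel_end n R h - i + 1) (init_set n R p h)) {1..n}"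

text \<open>
  The case \<open>\<gamma>(q\<^sub>h) = \<gamma>(q\<^sub>h + 1)\<close> must give \<open>s = 1\<close>: with \<open>s = 0\<close> the value \<open>\<gamma>(q\<^sub>h)\<close> would be
  repeated (for \<open>n = 2\<close>, \<open>R = {1}\<close>, the gapless tuple \<open>(2, 2)\<close> belongs to the permutation
  \<open>(2, 1)\<close>).  The value \<open>s = 0\<close> for \<open>h = 0\<close> makes the first carrel a copy of \<open>\<gamma>\<close>.
\<close>

definition overlap :: "nat \<Rightarrow> nat set \<Rightarrow> tuple \<Rightarrow> nat \<Rightarrow> nat" where
  "overlap n R g h =
     (let q = carrel_end n R h in if h \<ge> 1 \<and> g q \<ge> g (q + 1) then g q - g (q + 1) + 1 else 0)"

text \<open>\<open>perm_upto n R g h\<close> is correct on the first \<open>h\<close> carrels and the identity elsewhere.\<close>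

primrec perm_upto :: "nat \<Rightarrow> nat set \<Rightarrow> tuple \<Rightarrow> nat \<Rightarrow> tuple" where
  "perm_upto n R g 0 = (\<lambda>i. i)"
| "perm_upto n R g (Suc h) =
     (\<lambda>i. let q = carrel_end n R h; s = overlap n R g h in
        if i \<notin> carrel n R (Suc h) then perm_upto n R g h i
        else if q + s < i then g i
        else rank_desc (q + s - i + 1) ({1..g q} - perm_upto n R g h ` {1..q}))"

definition gapless_perm :: "nat \<Rightarrow> nat set \<Rightarrow> tuple \<Rightarrow> tuple" where
  "gapless_perm n R g = perm_upto n R g (card R + 1)"


section \<open>Tableaux\<close>

type_synonym tableau = "box \<Rightarrow> nat"

definition tableaux :: "nat \<Rightarrow> (nat \<Rightarrow> nat) \<Rightarrow> tableau set" where
  "tableaux n lam =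
     {T \<in> shape n lam \<rightarrow>\<^sub>E {1..n}.
        (\<forall>j i. (j, i) \<in> shape n lam \<and> (j, i + 1) \<in> shape n lam \<longrightarrow> T (j, i) < T (j, i + 1)) \<and>
        (\<forall>j i. (j, i) \<in> shape n lam \<and> (j + 1, i) \<in> shape n lam \<longrightarrow> T (j, i) \<le> T (j + 1, i))}"

definition tab_le :: "nat \<Rightarrow> (nat \<Rightarrow> nat) \<Rightarrow> tableau \<Rightarrow> tableau \<Rightarrow> bool" where
  "tab_le n lam T T' \<longleftrightarrow> (\<forall>b\<in>shape n lam. T b \<le> T' b)"

definition row_bound_set :: "nat \<Rightarrow> (nat \<Rightarrow> nat) \<Rightarrow> tuple \<Rightarrow> tableau set" where
  "row_bound_set n lam \<beta> = {T \<in> tableaux n lam. \<forall>(j, i)\<in>shape n lam. T (j, i) \<le> \<beta> i}"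

definition row_bound_max :: "nat \<Rightarrow> (nat \<Rightarrow> nat) \<Rightarrow> tuple \<Rightarrow> tableau" where
  "row_bound_max n lam \<beta> = restrict (\<lambda>b. Max ((\<lambda>T. T b) ` row_bound_set n lam \<beta>)) (shape n lam)"

definition key_columns :: "nat \<Rightarrow> (nat \<Rightarrow> nat) \<Rightarrow> tuple \<Rightarrow> nat set list" where
  "key_columns n lam p =
     (let R = short_col_lens n lam in
      replicate (lam n) {1..n} @
      concat (map (\<lambda>h. replicate (lam (carrel_end n R h) - lam (carrel_end n R (h + 1)))
                                 (init_set n R p h))
                  (rev [1..<card R + 1])))"

definition key_tableau :: "nat \<Rightarrow> (nat \<Rightarrow> nat) \<Rightarrow> tuple \<Rightarrow> tableau" where
  "key_tableau n lam p = restrict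
     (\<lambda>(j, i). sorted_list_of_set (key_columns n lam p ! (j - 1)) ! (i - 1)) (shape n lam)"

text \<open>
  Earliest weakly increasing subsequence of a list of boxes, with respect to their values \<open>f\<close>.
\<close>

function ewis :: "('a \<Rightarrow> nat) \<Rightarrow> 'a list \<Rightarrow> 'a list" where
  "ewis f [] = []"
| "ewis f (x # xs) = x # ewis f (dropWhile (\<lambda>y. f y < f x) xs)"
  by pat_completeness auto
termination
  by (relation "measure (\<lambda>(f, xs). length xs)") (auto simp: le_imp_less_Suc length_dropWhile_le)

text \<open>
  Lowest boxes (largest row index) of the nonempty columns \<open>j, \<dots>, lam 1\<close> of a set \<open>U\<close> of unmarked
  boxes, from left to right.
\<close>

definition lowest_boxes :: "(nat \<Rightarrow> nat) \<Rightarrow> nat \<Rightarrow> box set \<Rightarrow> box list" where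
  "lowest_boxes lam j U =
     map (\<lambda>k. (k, Max {i. (k, i) \<in> U})) (filter (\<lambda>k. \<exists>i. (k, i) \<in> U) [j..<lam 1 + 1])"

definition scan_path :: "(nat \<Rightarrow> nat) \<Rightarrow> tableau \<Rightarrow> nat \<Rightarrow> box set \<Rightarrow> box list" where
  "scan_path lam T j U = ewis T (lowest_boxes lam j U)"

text \<open>Boxes still unmarked after \<open>m\<close> rounds of the scan for column \<open>j\<close>.\<close>

primrec unmarked :: "nat \<Rightarrow> (nat \<Rightarrow> nat) \<Rightarrow> tableau \<Rightarrow> nat \<Rightarrow> nat \<Rightarrow> box set" where
  "unmarked n lam T j 0 = {(k, i) \<in> shape n lam. j \<le> k}"
| "unmarked n lam T j (Suc m) =
     unmarked n lam T j m - set (scan_path lam T j (unmarked n lam T j m))"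

text \<open>Column \<open>j\<close> is filled from the bottom, so row \<open>i\<close> is filled after \<open>col_len n lam j - i\<close> rounds.\<close>

definition scanning_tableau :: "nat \<Rightarrow> (nat \<Rightarrow> nat) \<Rightarrow> tableau \<Rightarrow> tableau" where
  "scanning_tableau n lam T = restrict
     (\<lambda>(j, i). T (last (scan_path lam T j (unmarked n lam T j (col_len n lam j - i)))))
     (shape n lam)"

definition demazure_set :: "nat \<Rightarrow> (nat \<Rightarrow> nat) \<Rightarrow> tuple \<Rightarrow> tableau set" where
  "demazure_set n lam p =
     {T \<in> tableaux n lam. tab_le n lam (scanning_tableau n lam T) (key_tableau n lam p)}"

end

theory Submission
  imports Defs
begin

text \<open>
  The last value of an earliest weakly increasing subsequence is the maximum of the sequence, and
  during a scan the unmarked boxes keep a partition shape.  Hence the entry of the scanning tableau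
  in row \<open>i\<close> is a value of the tableau in some row at most \<open>i\<close>, so row bounds given by a flag are
  inherited by the scanning tableau.  The set of tableaux obeying the row bounds \<open>\<beta>\<close> depends only on
  the core of \<open>\<beta>\<close>, whose entries are suffix minima of \<open>\<beta>(z) - (z - i)\<close> over a carrel; a gapless
  tuple is the core of a flag.  For a 312-avoiding \<open>\<pi>\<close> the key is the largest tableau obeying the row
  bounds given by the rank tuple, so the Demazure set is everything below the key.  If \<open>\<pi>\<close> contains a
  312-pattern, some tableau below the key is not in the Demazure set, which therefore is no row
  bound set.
\<close>

section \<open>Order statistics of finite sets\<close>

text \<open>The rank tuple of a 312-avoiding permutation may drop from one carrel to the next, while
  a scan moves entries between rows, so its bounds cannot be carried through a scan directly. Hence
  a detour: the bounds are relaxed to a flag with the same core, carried through the scan, and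
  tightened again by strict increase down each column. The opposite direction rests on order. Row
  bound sets are closed downwards and the key is the maximum of its Demazure set, so the two can
  agree only if every tableau below the key survives scanning. Uniqueness has the same source: the
  key returns the initial sets of the permutation. The pattern condition is used as a condition on
  two consecutive initial sets, and columns are compared by how many entries they have up to a given
  value, because such counts are additive under insertion while sorted positions shift. The last
  carrel needs separate care: the shape may have no column of length \<open>n\<close>, and then the
  tableaux do not see the bounds there, but all upper tuples have the same core on it.\<close>

definition nth_least :: "nat set \<Rightarrow> nat \<Rightarrow> nat" where
  "nth_least B i = sorted_list_of_set B ! (i - 1)"

definition count_le :: "nat set \<Rightarrow> nat \<Rightarrow> nat" where
  "count_le B x = card {y \<in> B. y \<le> x}"

lemma nth_least_mem:
  assumes "finite B" "1 \<le> i" "i \<le> card B"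
  shows "nth_least B i \<in> B"
proof -
  have "sorted_list_of_set B ! (i - 1) \<in> set (sorted_list_of_set B)"
    using assms by (intro nth_mem) auto
  then show ?thesis using assms by (simp add: nth_least_def)
qed

lemma nth_least_less:
  assumes "1 \<le> i" "i < i'" "i' \<le> card B"
  shows "nth_least B i < nth_least B i'"
  unfolding nth_least_def
  by (rule sorted_wrt_nth_less[OF strict_sorted_list_of_set]) (use assms in auto)

lemma nth_least_le:
  assumes "1 \<le> i" "i \<le> i'" "i' \<le> card B"
  shows "nth_least B i \<le> nth_least B i'"
  using nth_least_less[of i i' B] assms by (cases "i = i'") auto

lemma nth_least_obtain:
  assumes "finite B" "x \<in> B"
  obtains i where "1 \<le> i" "i \<le> card B" "x = nth_least B i"
proof -
  have "x \<in> set (sorted_list_of_set B)" using assms by simp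
  then obtain k where "k < length (sorted_list_of_set B)" "x = sorted_list_of_set B ! k"
    by (metis in_set_conv_nth)
  then show thesis by (intro that[of "Suc k"]) (auto simp: nth_least_def)
qed

lemma count_le_nth_least:
  assumes "finite B" "1 \<le> i" "i \<le> card B"
  shows "count_le B (nth_least B i) = i"
proof -
  have "{y \<in> B. y \<le> nth_least B i} = nth_least B ` {1..i}"
  proof (intro equalityI subsetI)
    fix y assume y: "y \<in> {y \<in> B. y \<le> nth_least B i}"
    then obtain k where k: "1 \<le> k" "k \<le> card B" "y = nth_least B k"
      using nth_least_obtain[OF assms(1), of y] by blast
    then have "k \<le> i" using nth_least_less[of i k B] assms y by (cases "k \<le> i") auto
    then show "y \<in> nth_least B ` {1..i}" using k by auto
  next
    fix y assume "y \<in> nth_least B ` {1..i}"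
    then show "y \<in> {y \<in> B. y \<le> nth_least B i}"
      using nth_least_le[of _ i B] nth_least_mem[OF assms(1)] assms by fastforce
  qed
  moreover have "inj_on (nth_least B) {1..i}"
    by (rule strict_mono_on_imp_inj_on)
       (use nth_least_less assms in \<open>auto intro!: strict_mono_onI\<close>)
  ultimately show ?thesis by (simp add: count_le_def card_image)
qed

lemma count_le_mono: "finite B \<Longrightarrow> x \<le> y \<Longrightarrow> count_le B x \<le> count_le B y"
  unfolding count_le_def by (intro card_mono) auto

lemma count_le_subset: "finite B \<Longrightarrow> A \<subseteq> B \<Longrightarrow> count_le A x \<le> count_le B x"
  unfolding count_le_def by (intro card_mono) auto

lemma count_le_less:
  assumes "finite B" "y \<in> B" "x < y"
  shows "count_le B x < count_le B y"
proof -
  have "y \<in> {z \<in> B. z \<le> y} - {z \<in> B. z \<le> x}" using assms by auto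
  moreover have "{z \<in> B. z \<le> x} \<subseteq> {z \<in> B. z \<le> y}" using assms by auto
  ultimately have "{z \<in> B. z \<le> x} \<subset> {z \<in> B. z \<le> y}" by blast
  then show ?thesis unfolding count_le_def using assms by (intro psubset_card_mono) auto
qed

lemma count_le_card: "finite B \<Longrightarrow> count_le B x \<le> card B"
  unfolding count_le_def by (intro card_mono) auto

text \<open>Galois connection between positions and counts. It turns comparisons of sorted columns
  into comparisons of counting functions.\<close>

lemma nth_least_le_iff:
  assumes "finite B" "1 \<le> i" "i \<le> card B"
  shows "nth_least B i \<le> x \<longleftrightarrow> i \<le> count_le B x"
  using count_le_mono[OF assms(1), of "nth_least B i" x]
    count_le_less[OF assms(1) nth_least_mem[OF assms], of x] count_le_nth_least[OF assms]
  by (cases "nth_least B i \<le> x") auto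

lemma nth_least_eqI:
  assumes "finite B" "x \<in> B" "count_le B x = i"
  shows "nth_least B i = x"
proof -
  obtain k where "1 \<le> k" "k \<le> card B" "x = nth_least B k"
    using nth_least_obtain[OF assms(1,2)] .
  then show ?thesis using count_le_nth_least[OF assms(1)] assms(3) by auto
qed

text \<open>One evaluation of the counts suffices, at the larger entry itself: there
  \<open>B\<close> has \<open>i\<close> elements, so \<open>A\<close> has at least
  \<open>i\<close>.\<close>

lemma nth_least_mono_count:
  assumes "finite A" "finite B" "1 \<le> i" "i \<le> card A" "i \<le> card B"
    and "count_le B (nth_least B i) \<le> count_le A (nth_least B i)"
  shows "nth_least A i \<le> nth_least B i"
  using assms count_le_nth_least[of B i] nth_least_le_iff[of A i] by auto

lemma nth_least_subset:
  assumes "finite B" "A \<subseteq> B" "1 \<le> i" "i \<le> card A"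
  shows "nth_least B i \<le> nth_least A i"
  using assms count_le_subset[OF assms(1,2)] card_mono[OF assms(1,2)]
  by (intro nth_least_mono_count) (auto intro: finite_subset)

text \<open>Over the integers strict increase means slope at least one. A bound on row
  \<open>z\<close> thus bounds row \<open>i\<close> by \<open>z - i\<close> less, which is where the
  terms \<open>v z - (z - i)\<close> of a core come from.\<close>

lemma strict_mono_on_gap:
  fixes v :: "nat \<Rightarrow> nat"
  assumes "strict_mono_on S v" "{i..z} \<subseteq> S" "i \<le> z"
  shows "v i + (z - i) \<le> v z"
  using assms(3,2)
proof (induction z rule: dec_induct)
  case (step m)
  then have "v m < v (Suc m)" by (intro strict_mono_onD[OF assms(1)]) auto
  moreover have "v i + (m - i) \<le> v m" using step by (simp add: subset_iff)
  ultimately show ?case using step.hyps by linarith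
qed simp

lemma strict_mono_on_nth_least: "strict_mono_on {1..card B} (nth_least B)"
  using nth_least_less by (auto intro!: strict_mono_onI)

lemma nth_least_gap:
  assumes "1 \<le> i" "i \<le> z" "z \<le> card B"
  shows "nth_least B i + (z - i) \<le> nth_least B z"
  by (rule strict_mono_on_gap[OF strict_mono_on_nth_least]) (use assms in auto)

lemma nth_least_ge:
  assumes "finite B" "0 \<notin> B" "1 \<le> i" "i \<le> card B"
  shows "i \<le> nth_least B i"
proof -
  have "nth_least B 1 \<in> B" using assms by (intro nth_least_mem) auto
  then have "1 \<le> nth_least B 1" using assms(2) by (cases "nth_least B 1") auto
  then show ?thesis using nth_least_gap[of 1 i B] assms by auto
qed

lemma nth_least_image: "finite B \<Longrightarrow> nth_least B ` {1..card B} = B"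
proof (intro equalityI subsetI)
  fix x assume "finite B" "x \<in> B"
  then show "x \<in> nth_least B ` {1..card B}" by (metis nth_least_obtain atLeastAtMost_iff imageI)
qed (auto intro: nth_least_mem)

lemma rank_desc_eq_nth_least:
  assumes "1 \<le> d" "d \<le> card Q"
  shows "rank_desc d Q = nth_least Q (card Q - d + 1)"
  using assms by (simp add: rank_desc_def nth_least_def rev_nth)


section \<open>Carrels\<close>

locale carrels =
  fixes n :: nat and R :: "nat set"
  assumes n_pos: "1 \<le> n" and R_sub: "R \<subseteq> {1..<n}"
begin

abbreviation q :: "nat \<Rightarrow> nat" where "q \<equiv> carrel_end n R"
abbreviation r :: nat where "r \<equiv> card R"

lemma finite_R: "finite R"
  using R_sub finite_subset by blast

lemma q_0 [simp]: "q 0 = 0"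
  and q_last [simp]: "q (Suc r) = n"
  by (simp_all add: carrel_end_def)

lemma q_nth_least: "1 \<le> h \<Longrightarrow> h \<le> r \<Longrightarrow> q h = nth_least R h"
  by (simp add: carrel_end_def nth_least_def)

lemma q_in_R: "1 \<le> h \<Longrightarrow> h \<le> r \<Longrightarrow> q h \<in> R"
  using nth_least_mem[OF finite_R] by (simp add: q_nth_least)

lemma R_obtain_q:
  assumes "x \<in> R" obtains h where "1 \<le> h" "h \<le> r" "x = q h"
proof -
  obtain h where "1 \<le> h" "h \<le> r" "x = nth_least R h"
    using nth_least_obtain[OF finite_R assms] .
  then show thesis using that[of h] by (simp add: q_nth_least)
qed

lemma q_less: assumes "h < h'" "h' \<le> Suc r" shows "q h < q h'"
proof -
  have "q h' \<in> {1..<n}" if "1 \<le> h'" "h' \<le> r" for h' using q_in_R[OF that] R_sub by auto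
  then have *: "1 \<le> q k" "q k < n" if "1 \<le> k" "k \<le> r" for k using that by auto
  show ?thesis
  proof (cases "h = 0")
    case True
    then show ?thesis using *[of h'] assms n_pos by (cases "h' = Suc r") auto
  next
    case False
    then show ?thesis using *[of h] assms nth_least_less[of h h' R]
      by (cases "h' = Suc r") (auto simp: q_nth_least)
  qed
qed

lemma q_le: "h \<le> h' \<Longrightarrow> h' \<le> Suc r \<Longrightarrow> q h \<le> q h'"
  using q_less[of h h'] by (cases "h = h'") auto

lemma q_le_n: "h \<le> Suc r \<Longrightarrow> q h \<le> n"
  using q_le[of h "Suc r"] by simp

lemma carrel_Suc: "carrel n R (Suc h) = {q h<..q (Suc h)}"
  by (simp add: carrel_def)

lemma carrel_obtain:
  assumes "1 \<le> i" "i \<le> n"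
  obtains h where "h \<le> r" "q h < i" "i \<le> q (Suc h)"
proof -
  define h where "h = (LEAST h. i \<le> q h)"
  have ex: "i \<le> q (Suc r)" using assms by simp
  have le: "i \<le> q h" "h \<le> Suc r"
    unfolding h_def
    by (rule LeastI[of "\<lambda>h. i \<le> q h", OF ex], rule Least_le[of "\<lambda>h. i \<le> q h", OF ex])
  then have "h \<noteq> 0" using assms by (intro notI) simp
  then obtain k where k: "h = Suc k" using not0_implies_Suc by blast
  then have "\<not> i \<le> q k" unfolding h_def by (intro not_less_Least) simp
  then show thesis using that[of k] le k by simp
qed

lemma carrel_unique:
  assumes "h \<le> r" "q h < i" "i \<le> q (Suc h)" "h' \<le> r" "q h' < i" "i \<le> q (Suc h')"
  shows "h' = h"
  using q_le[of "Suc h" h'] q_le[of "Suc h'" h] assms by (cases h h' rule: linorder_cases) auto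

lemma carrel_index_eq:
  assumes "h \<le> r" "q h < i" "i \<le> q (Suc h)"
  shows "carrel_index n R i = Suc h"
  unfolding carrel_index_def
proof (rule the_equality)
  fix k assume k: "k \<in> {1..r + 1} \<and> i \<in> carrel n R k"
  then obtain m where "k = Suc m" by (cases k) auto
  then show "k = Suc h" using carrel_unique[OF assms, of m] k by (auto simp: carrel_Suc)
qed (use assms in \<open>auto simp: carrel_Suc\<close>)

text \<open>From here on a carrel is indexed by its left end, from 0 to \<open>r\<close>, which
  avoids the subtraction in \<open>carrel\<close>.\<close>

lemma ball_carrels: "(\<forall>h\<in>{1..r + 1}. P (carrel n R h)) \<longleftrightarrow> (\<forall>h\<le>r. P {q h<..q (Suc h)})"
proof -
  have "{1..r + 1} = Suc ` {..r}" by (simp add: image_Suc_atMost)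
  then show ?thesis by (auto simp: carrel_Suc)
qed

end

context carrels
begin

section \<open>Cores\<close>

text \<open>In additive form: a critical index has a strictly smaller value of
  \<open>v x - x\<close> than all later indices of its carrel. The recursion steps to the largest
  index where this value drops, so it has not dropped in between.\<close>

lemma critical_imp_less:
  assumes "x \<in> critical n R v" "h \<le> r" "q h < x" "x \<le> q (Suc h)" "x < z" "z \<le> q (Suc h)"
  shows "v x + z < v z + x"
  using assms
proof (induction arbitrary: z rule: critical.induct)
  case (last k)
  have "k = Suc h"
    using q_le[of k h] q_less[of "Suc h" k] last.hyps last.prems
    by (cases "k \<le> h"; cases "Suc h < k") auto
  then show ?case using last.prems by simp
next
  case (step x k y)
  obtain m where m: "k = Suc m" "m \<le> r" using step.hyps(2) by (cases k) auto
  then have "m = h" using carrel_unique[of h y m] step.hyps(4) step.prems by (auto simp: carrel_Suc)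
  then have x: "q h < x" "x \<le> q (Suc h)" using step.hyps(3) m by (auto simp: carrel_Suc)
  have yx: "v y + x < v x + y" using step.hyps(5,6) by linarith
  consider "z < x" | "z = x" | "x < z" by linarith
  then show ?case
  proof cases
    case 1
    then have "v x + z \<le> v z + x" using step.hyps(7) step.prems by force
    then show ?thesis using yx by linarith
  next
    case 3
    then have "v x + z < v z + x" using step.IH[of z] step.prems x by auto
    then show ?thesis using yx by linarith
  qed (use yx in auto)
qed

text \<open>The recursion moves to the largest candidate, hence not past the candidate
  \<open>y\<close>.\<close>

lemma critical_before:
  assumes "x \<in> critical n R v" "h \<le> r" "q h < y" "y < x" "x \<le> q (Suc h)" "v y + x < v x + y"
  obtains y' where "y' \<in> critical n R v" "y \<le> y'" "y' < x"
proof -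
  define S where "S = {z. y \<le> z \<and> z < x \<and> v z + x < v x + z}"
  define y' where "y' = Max S"
  have S: "finite S" "y \<in> S" using assms unfolding S_def by auto
  then have mem: "y' \<in> S" unfolding y'_def by (intro Max_in) auto
  have max: "z \<le> y'" if "z \<in> S" for z using that S(1) unfolding y'_def by simp
  have "y' \<in> critical n R v"
  proof (rule critical.step[OF assms(1), where h = "Suc h"])
    show "\<forall>z. y' < z \<and> z < x \<longrightarrow> \<not> int x - int z < int (v x) - int (v z)"
    proof (intro allI impI notI)
      fix z assume z: "y' < z \<and> z < x" and lt: "int x - int z < int (v x) - int (v z)"
      from lt have "v z + x < v x + z" by linarith
      then have "z \<in> S" using z mem unfolding S_def by auto
      then show False using max z by force
    qed
    have "v y' + x < v x + y'" using mem unfolding S_def by auto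
    then show "int x - int y' < int (v x) - int (v y')" by linarith
  qed (use assms mem in \<open>auto simp: carrel_Suc S_def\<close>)
  then show thesis using that mem unfolding S_def by blast
qed

lemma carrel_end_critical: "h \<le> r \<Longrightarrow> q (Suc h) \<in> critical n R v"
  by (intro critical.last) auto

text \<open>The next critical index minimises \<open>v z - z\<close> on the rest of the carrel: a
  smaller value behind it contradicts \<open>critical_imp_less\<close>, and one before it would put
  another critical index in between.\<close>

lemma core_at_critical:
  assumes "h \<le> r" "q h < i" "i \<le> x" "x \<le> q (Suc h)" "x \<in> critical n R v"
    and least: "\<And>y. y \<in> critical n R v \<Longrightarrow> i \<le> y \<Longrightarrow> x \<le> y"
  shows "core n R v i = v x - (x - i)"
    and "\<And>z. i \<le> z \<Longrightarrow> z \<le> q (Suc h) \<Longrightarrow> v x + z \<le> v z + x"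
proof -
  have "i \<in> {1..n}" using assms(1-4) q_le_n[of "Suc h"] by auto
  moreover have "(LEAST x. x \<in> critical n R v \<and> i < x) = x" if "i \<notin> critical n R v"
    using that assms by (intro Least_equality) (auto intro: le_neq_implies_less)
  moreover have "x = i" if "i \<in> critical n R v" using least[OF that] assms by simp
  ultimately show "core n R v i = v x - (x - i)" by (auto simp: core_def Let_def)
  fix z assume z: "i \<le> z" "z \<le> q (Suc h)"
  show "v x + z \<le> v z + x"
  proof (rule ccontr)
    assume "\<not> ?thesis"
    then have *: "v z + x < v x + z" by simp
    then have "z < x" using critical_imp_less[OF assms(5,1) _ assms(4), of z] z assms
      by (cases z x rule: linorder_cases) auto
    then obtain y where "y \<in> critical n R v" "z \<le> y" "y < x"
      using critical_before[OF assms(5,1), of z] * z assms by auto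
    then show False using least[of y] z by auto
  qed
qed

lemma critical_obtain:
  assumes "h \<le> r" "i \<le> q (Suc h)"
  obtains x where "i \<le> x" "x \<le> q (Suc h)" "x \<in> critical n R v"
    "\<And>y. y \<in> critical n R v \<Longrightarrow> i \<le> y \<Longrightarrow> x \<le> y"
proof -
  define P where "P x \<longleftrightarrow> i \<le> x \<and> x \<in> critical n R v" for x
  have P: "P (q (Suc h))" using assms carrel_end_critical unfolding P_def by auto
  show thesis
  proof (rule that[of "LEAST x. P x"])
    show "(LEAST x. P x) \<le> q (Suc h)" by (rule Least_le[of P, OF P])
  qed (use LeastI[of P, OF P] Least_le[of P] in \<open>auto simp: P_def\<close>)
qed

text \<open>Replaces the recursion by an attained minimum over the rest of the carrel. Apart from
  the floor map, later arguments about cores need only this form.\<close>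

lemma core_cases:
  assumes "v \<in> upper_tuples n" "h \<le> r" "q h < i" "i \<le> q (Suc h)"
  obtains x where "i \<le> x" "x \<le> q (Suc h)" "core n R v i + (x - i) = v x"
    "\<And>z. i \<le> z \<Longrightarrow> z \<le> q (Suc h) \<Longrightarrow> core n R v i + (z - i) \<le> v z"
proof -
  obtain x where x: "i \<le> x" "x \<le> q (Suc h)" "x \<in> critical n R v"
    "\<And>y. y \<in> critical n R v \<Longrightarrow> i \<le> y \<Longrightarrow> x \<le> y"
    using critical_obtain[OF assms(2,4), where v = v] by blast
  note core = core_at_critical[OF assms(2,3) x]
  \<comment> \<open>Upperness keeps the natural subtraction \<open>v x - (x - i)\<close> from being
    truncated.\<close>
  have "x \<le> v x" using assms(1,3) x q_le_n[of "Suc h"] assms(2) by (auto simp: upper_tuples_def)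
  then have eq: "core n R v i + (x - i) = v x" using core(1) by linarith
  show thesis
  proof (rule that[OF x(1,2) eq])
    fix z assume "i \<le> z" "z \<le> q (Suc h)"
    then show "core n R v i + (z - i) \<le> v z" using core(2)[of z] eq x by linarith
  qed
qed

lemma core_gap:
  assumes "v \<in> upper_tuples n" "h \<le> r" "q h < i" "i \<le> z" "z \<le> q (Suc h)"
  shows "core n R v i + (z - i) \<le> v z"
  using core_cases[OF assms(1-3)] assms(4,5) by (metis le_trans)

lemma le_coreI:
  assumes "v \<in> upper_tuples n" "h \<le> r" "q h < i" "i \<le> q (Suc h)"
    and "\<And>z. i \<le> z \<Longrightarrow> z \<le> q (Suc h) \<Longrightarrow> w + (z - i) \<le> v z"
  shows "w \<le> core n R v i"
proof -
  obtain x where "i \<le> x" "x \<le> q (Suc h)" "core n R v i + (x - i) = v x"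
    using core_cases[OF assms(1-4)] .
  then show ?thesis using assms(5)[of x] by simp
qed

lemma core_le:
  assumes "v \<in> upper_tuples n" "1 \<le> i" "i \<le> n"
  shows "core n R v i \<le> v i"
proof -
  obtain h where "h \<le> r" "q h < i" "i \<le> q (Suc h)" using carrel_obtain[OF assms(2,3)] .
  then show ?thesis using core_gap[OF assms(1), of h i i] by simp
qed

lemma core_carrel_end:
  assumes "v \<in> upper_tuples n" "h \<le> r"
  shows "core n R v (q (Suc h)) = v (q (Suc h))"
  by (rule core_cases[OF assms, of "q (Suc h)"]) (use q_less[of h "Suc h"] assms in auto)

lemma upper_increasing_iff:
  "g \<in> upper_increasing n R \<longleftrightarrow>
     g \<in> upper_tuples n \<and> (\<forall>h\<le>r. strict_mono_on {q h<..q (Suc h)} g)"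
  unfolding upper_increasing_def using ball_carrels[of "\<lambda>C. strict_mono_on C g"] by simp

lemma upper_increasing_gap:
  assumes "g \<in> upper_increasing n R" "h \<le> r" "q h < i" "i \<le> z" "z \<le> q (Suc h)"
  shows "g i + (z - i) \<le> g z"
  using assms by (intro strict_mono_on_gap[of "{q h<..q (Suc h)}"]) (auto simp: upper_increasing_iff)

lemma core_upper_increasing:
  assumes v: "v \<in> upper_tuples n"
  shows "core n R v \<in> upper_increasing n R"
  unfolding upper_increasing_iff
proof (intro conjI allI impI)
  have "core n R v i \<in> {1..n} \<and> i \<le> core n R v i" if i: "i \<in> {1..n}" for i
  proof -
    obtain h where h: "h \<le> r" "q h < i" "i \<le> q (Suc h)" using carrel_obtain[of i] i by auto
    have "z \<le> v z" if "i \<le> z" "z \<le> q (Suc h)" for z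
      using v i that q_le_n[of "Suc h"] h(1) by (auto simp: upper_tuples_def)
    then have "i \<le> core n R v i" using le_coreI[OF v h, of i] by simp
    moreover have "v i \<le> n" using v i by (auto simp: upper_tuples_def)
    ultimately show ?thesis using core_le[OF v, of i] i by auto
  qed
  then show "core n R v \<in> upper_tuples n" by (auto simp: upper_tuples_def core_def)
next
  fix h assume h: "h \<le> r"
  show "strict_mono_on {q h<..q (Suc h)} (core n R v)"
  proof (rule strict_mono_onI)
    fix i i' assume i: "i \<in> {q h<..q (Suc h)}" "i' \<in> {q h<..q (Suc h)}" "i < i'"
    obtain x where "i' \<le> x" "x \<le> q (Suc h)" "core n R v i' + (x - i') = v x"
      using core_cases[OF v h, of i'] i by auto
    then show "core n R v i < core n R v i'" using core_gap[OF v h, of i x] i by simp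
  qed
qed

lemma upper_tuples_eqI:
  assumes "v \<in> upper_tuples n" "w \<in> upper_tuples n" "\<And>i. 1 \<le> i \<Longrightarrow> i \<le> n \<Longrightarrow> v i = w i"
  shows "v = w"
  using assms unfolding upper_tuples_def by (intro PiE_ext[of v "{1..n}" _ w]) auto

lemma core_upper: "v \<in> upper_tuples n \<Longrightarrow> core n R v \<in> upper_tuples n"
  using core_upper_increasing upper_increasing_iff by blast

text \<open>A tuple of slope at least one below \<open>v\<close> lies below the core. It is the core
  once the line of slope one from each of its points meets \<open>v\<close> inside the
  carrel.\<close>

lemma core_eqI:
  assumes "v \<in> upper_tuples n" "g \<in> upper_increasing n R"
    and ge: "\<And>i. 1 \<le> i \<Longrightarrow> i \<le> n \<Longrightarrow> g i \<le> v i"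
    and le: "\<And>h i. h \<le> r \<Longrightarrow> q h < i \<Longrightarrow> i \<le> q (Suc h) \<Longrightarrow>
      \<exists>x. i \<le> x \<and> x \<le> q (Suc h) \<and> v x \<le> g i + (x - i)"
  shows "core n R v = g"
proof (rule upper_tuples_eqI)
  fix i assume i: "1 \<le> i" "i \<le> n"
  then obtain h where h: "h \<le> r" "q h < i" "i \<le> q (Suc h)" using carrel_obtain by blast
  obtain x where x: "i \<le> x" "x \<le> q (Suc h)" "v x \<le> g i + (x - i)" using le[OF h] by blast
  have "g i \<le> core n R v i"
  proof (rule le_coreI[OF assms(1) h])
    fix z assume z: "i \<le> z" "z \<le> q (Suc h)"
    then have "g z \<le> v z" using ge i q_le_n[of "Suc h"] h(1) by simp
    then show "g i + (z - i) \<le> v z"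
      using upper_increasing_gap[OF assms(2) h(1,2) z] by simp
  qed
  moreover have "core n R v i + (x - i) \<le> v x" using core_gap[OF assms(1) h(1,2) x(1,2)] .
  ultimately show "core n R v i = g i" using x by simp
qed (use assms core_upper upper_increasing_iff in auto)

lemma core_upper_increasing_id:
  assumes "g \<in> upper_increasing n R" shows "core n R g = g"
  by (rule core_eqI) (use assms upper_increasing_iff in auto)


section \<open>Gapless tuples and flags\<close>

lemma gaplessI:
  assumes "g \<in> upper_increasing n R"
    and "\<And>h s. 1 \<le> h \<Longrightarrow> h \<le> r \<Longrightarrow> g (q h + 1) < g (q h) \<Longrightarrow> g (q h) + 1 = g (q h + 1) + s \<Longrightarrow>
           q h + s \<le> q (Suc h) \<and> (\<forall>t\<in>{1..s}. g (q h + t) + s = g (q h) + t)"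
  shows "g \<in> gapless_tuples n R"
  unfolding gapless_tuples_def
proof (intro CollectI conjI ballI assms(1))
  fix h assume h: "h \<in> {1..r}"
  define s where "s = g (q h) - g (q h + 1) + 1"
  have "s \<le> carrel_size n R (h + 1) \<and> (\<forall>t\<in>{1..s}. g (q h + t) = g (q h) - s + t)"
    if lt: "g (q h + 1) < g (q h)"
  proof -
    have "g (q h) + 1 = g (q h + 1) + s" using lt by (simp add: s_def)
    then have *: "q h + s \<le> q (Suc h) \<and> (\<forall>t\<in>{1..s}. g (q h + t) + s = g (q h) + t)"
      using assms(2)[of h s] h lt by simp
    have "q h + 1 \<le> n" using q_less[of h "Suc h"] q_le_n[of "Suc h"] h by simp
    then have "1 \<le> g (q h + 1)" using assms(1) by (auto simp: upper_increasing_def upper_tuples_def)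
    then have "s \<le> g (q h)" using lt unfolding s_def by linarith
    then show ?thesis using * by (auto simp: carrel_size_def)
  qed
  then show "let q' = q h; s = g q' - g (q' + 1) + 1 in g (q' + 1) < g q' \<longrightarrow>
      s \<le> carrel_size n R (h + 1) \<and> (\<forall>t\<in>{1..s}. g (q' + t) = g q' - s + t)"
    by (simp add: s_def Let_def)
qed

lemma gapless_upper_increasing: "g \<in> gapless_tuples n R \<Longrightarrow> g \<in> upper_increasing n R"
  by (simp add: gapless_tuples_def)

lemma gapless_upper: "g \<in> gapless_tuples n R \<Longrightarrow> g \<in> upper_tuples n"
  by (simp add: gapless_tuples_def upper_increasing_def)

text \<open>The weak inequality admits equal values at the boundary, where \<open>s = 1\<close> and
  the claims are immediate. The inverse construction needs this case, since \<open>overlap\<close>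
  is 1 there.\<close>

lemma gaplessD:
  assumes g: "g \<in> gapless_tuples n R" and h: "1 \<le> h" "h \<le> r"
    and le: "g (q h + 1) \<le> g (q h)" and s: "g (q h) + 1 = g (q h + 1) + s"
  shows "q h + s \<le> q (Suc h)" and "\<And>t. 1 \<le> t \<Longrightarrow> t \<le> s \<Longrightarrow> g (q h + t) + s = g (q h) + t"
proof -
  have q: "q h < q (Suc h)" "q (Suc h) \<le> n" using q_less[of h "Suc h"] q_le_n[of "Suc h"] h by auto
  have "q h + s \<le> q (Suc h) \<and> (\<forall>t\<in>{1..s}. g (q h + t) + s = g (q h) + t)"
  proof (cases "g (q h + 1) < g (q h)")
    case True
    have seq: "s = g (q h) - g (q h + 1) + 1" using s le by simp
    have "s \<le> carrel_size n R (h + 1) \<and> (\<forall>t\<in>{1..s}. g (q h + t) = g (q h) - s + t)"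
      using g h True unfolding gapless_tuples_def Let_def seq by auto
    moreover have "1 \<le> g (q h + 1)"
      using gapless_upper[OF g] q by (auto simp: upper_tuples_def)
    then have "s \<le> g (q h)" using s by simp
    ultimately show ?thesis using q by (auto simp: carrel_size_def)
  next
    case False
    then have "s = 1" using le s by simp
    then show ?thesis using q s by auto
  qed
  then show "q h + s \<le> q (Suc h)" "\<And>t. 1 \<le> t \<Longrightarrow> t \<le> s \<Longrightarrow> g (q h + t) + s = g (q h) + t"
    by auto
qed

text \<open>From \<open>q h + 1\<close> the core follows a line of slope one up to the index
  \<open>x\<close> where its minimum is attained, ending at \<open>f x\<close>. For a flag
  \<open>f x \<ge> f (q h)\<close>, so the line is long enough to climb back to the value at
  \<open>q h\<close>, as gaplessness asks.\<close>

lemma core_flag_gapless: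
  assumes f: "f \<in> upper_flags n"
  shows "core n R f \<in> gapless_tuples n R"
proof (rule gaplessI)
  have v: "f \<in> upper_tuples n" and mono: "mono_on {1..n} f"
    using f by (auto simp: upper_flags_def)
  show ui: "core n R f \<in> upper_increasing n R" by (rule core_upper_increasing[OF v])
  fix h s
  let ?g = "core n R f"
  assume h: "1 \<le> h" "h \<le> r" and "?g (q h + 1) < ?g (q h)" and s: "?g (q h) + 1 = ?g (q h + 1) + s"
  obtain k where k: "h = Suc k" using h by (cases h) auto
  have top: "?g (q h) = f (q h)" using core_carrel_end[OF v, of k] h k by simp
  have q: "0 < q h" "q h < q (Suc h)" "q (Suc h) \<le> n"
    using q_less[of 0 h] q_less[of h "Suc h"] q_le_n[of "Suc h"] h by auto
  obtain x where x: "q h + 1 \<le> x" "x \<le> q (Suc h)" "?g (q h + 1) + (x - (q h + 1)) = f x"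
    using core_cases[OF v h(2), of "q h + 1"] q by auto
  have "f (q h) \<le> f x" using mono x q by (intro mono_onD[OF mono]) auto
  then have sx: "q h + s \<le> x" using x s top by linarith
  have "?g (q h + t) + s = ?g (q h) + t" if t: "t \<in> {1..s}" for t
  proof -
    have "?g (q h + t) + (x - (q h + t)) \<le> f x"
      using core_gap[OF v h(2), of "q h + t" x] t sx x by auto
    moreover have "?g (q h + 1) + (q h + t - (q h + 1)) \<le> ?g (q h + t)"
      using upper_increasing_gap[OF ui h(2), of "q h + 1" "q h + t"] t sx x by auto
    moreover have "q h + t \<le> x" "1 \<le> t" using t sx by auto
    ultimately show ?thesis using x(1,3) s by linarith
  qed
  then show "q h + s \<le> q (Suc h) \<and> (\<forall>t\<in>{1..s}. ?g (q h + t) + s = ?g (q h) + t)"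
    using sx x by auto
qed

section \<open>Floor flags of gapless tuples\<close>

lemma floor_map_cases:
  assumes g: "g \<in> gapless_tuples n R" and h: "h \<le> r"
  obtains x where "q h < x" "x \<le> q (Suc h)"
    "\<And>i. q h < i \<Longrightarrow> i \<le> x \<Longrightarrow> g i + (x - i) = g x"
    "1 \<le> h \<Longrightarrow> g (q h) \<le> g x"
    "\<And>i. q h < i \<Longrightarrow> i \<le> q (Suc h) \<Longrightarrow>
       floor_map n R g i = (if 1 \<le> h \<and> i \<le> x then max (g (q h)) (g i) else g i)"
proof -
  note ui = gapless_upper_increasing[OF g] and up = gapless_upper[OF g]
  have q: "q h < q (Suc h)" "q (Suc h) \<le> n" using q_less[of h "Suc h"] q_le_n[of "Suc h"] h by auto
  obtain x where x: "q h + 1 \<le> x" "x \<le> q (Suc h)" "x \<in> critical n R g"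
    "\<And>y. y \<in> critical n R g \<Longrightarrow> q h + 1 \<le> y \<Longrightarrow> x \<le> y"
    using critical_obtain[OF h, of "q h + 1"] q by auto
  have least: "(LEAST x. x \<in> critical n R g \<and> x \<in> carrel n R (h + 1)) = x"
    using x by (intro Least_equality) (auto simp: carrel_Suc)
  \<comment> \<open>\<open>g\<close> is its own core, so up to its first critical index in the
    carrel it follows the line of slope one that ends there.\<close>
  have lin: "g i + (x - i) = g x" if "q h < i" "i \<le> x" for i
  proof -
    have "core n R g i = g x - (x - i)"
      using that x by (intro core_at_critical(1)[OF h]) auto
    moreover have "x \<le> g x" using up x q by (auto simp: upper_tuples_def)
    ultimately show ?thesis using core_upper_increasing_id[OF ui] that by simp
  qed
  have ge: "g (q h) \<le> g x" if h1: "1 \<le> h"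
  proof (cases "g (q h + 1) \<le> g (q h)")
    case True
    obtain s where s: "g (q h) + 1 = g (q h + 1) + s"
      using le_Suc_ex[of "g (q h + 1)" "g (q h) + 1"] True by auto
    then have s1: "1 \<le> s" using True by simp
    note gd = gaplessD[OF g h1 h True s]
    have gs: "g (q h + s) = g (q h)" using gd(2)[of s] s1 by simp
    \<comment> \<open>On the run of length \<open>s\<close> the value \<open>g i - i\<close> is
      constant, so a critical index before its end would violate the strict inequality of
      \<open>critical_imp_less\<close>.\<close>
    have "q h + s \<le> x"
    proof (rule ccontr)
      assume xs: "\<not> q h + s \<le> x"
      then have "g x + (q h + s) < g (q h + s) + x"
        using critical_imp_less[OF x(3) h, of "q h + s"] x gd(1) by auto
      moreover have "g x + s = g (q h) + (x - q h)"
        using gd(2)[of "x - q h"] x xs by auto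
      ultimately show False using gs x by linarith
    qed
    then show ?thesis using upper_increasing_gap[OF ui h, of "q h + s" x] s1 x gs by auto
  next
    case False
    then show ?thesis using upper_increasing_gap[OF ui h, of "q h + 1" x] x by auto
  qed
  show thesis
  proof (rule that[of x])
    fix i assume i: "q h < i" "i \<le> q (Suc h)"
    \<comment> \<open>The definition raises only indices below \<open>x\<close>; at \<open>x\<close>
      itself the maximum is \<open>g x\<close> by \<open>ge\<close>, so the closed interval gives
      the same values.\<close>
    have "floor_map n R g i = (if 1 \<le> h \<and> i < x then max (g (q h)) (g i) else g i)"
      using i h q least by (simp add: floor_map_def carrel_index_eq[OF h i])
    then show "floor_map n R g i = (if 1 \<le> h \<and> i \<le> x then max (g (q h)) (g i) else g i)"
      using ge by auto
  qed (use x lin ge in auto)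
qed

lemma floor_map_carrel_end:
  assumes g: "g \<in> gapless_tuples n R" and "h \<le> r"
  shows "floor_map n R g (q (Suc h)) = g (q (Suc h))"
  by (rule floor_map_cases[OF assms])
     (use q_less[of h "Suc h"] assms in \<open>auto simp: max_def split: if_splits\<close>)

lemma floor_map_ge:
  assumes g: "g \<in> gapless_tuples n R" and i: "1 \<le> i" "i \<le> n"
  shows "g i \<le> floor_map n R g i"
proof -
  obtain h where h: "h \<le> r" "q h < i" "i \<le> q (Suc h)" using carrel_obtain[OF i] .
  show ?thesis by (rule floor_map_cases[OF g h(1)]) (use h in auto)
qed

lemma floor_map_upper:
  assumes g: "g \<in> gapless_tuples n R"
  shows "floor_map n R g \<in> upper_tuples n"
proof -
  have gn: "g i \<in> {1..n}" "i \<le> g i" if "i \<in> {1..n}" for i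
    using gapless_upper[OF g] that by (auto simp: upper_tuples_def)
  have "floor_map n R g i \<in> {1..n} \<and> i \<le> floor_map n R g i" if i: "i \<in> {1..n}" for i
  proof -
    obtain h where h: "h \<le> r" "q h < i" "i \<le> q (Suc h)" using carrel_obtain i by auto
    have "g (q h) \<le> n" if "1 \<le> h"
      using gn(1)[of "q h"] q_less[of 0 h] q_le_n[of h] h(1) that by auto
    then have "floor_map n R g i \<le> n"
      by (rule_tac floor_map_cases[OF g h(1)]) (use h gn(1)[OF i] in auto)
    moreover have "i \<le> floor_map n R g i" using floor_map_ge[OF g, of i] gn(2)[OF i] i by auto
    ultimately show ?thesis using i by auto
  qed
  then show ?thesis by (auto simp: upper_tuples_def floor_map_def)
qed

text \<open>Entries are raised only before \<open>x\<close>, and the entry at \<open>x\<close> is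
  unchanged. The line of slope one down from \<open>x\<close> already forces the old values, so the
  core does not notice the change.\<close>

lemma core_floor_map:
  assumes g: "g \<in> gapless_tuples n R"
  shows "core n R (floor_map n R g) = g"
proof (rule core_eqI[OF floor_map_upper[OF g] gapless_upper_increasing[OF g] floor_map_ge[OF g]])
  fix h i assume h: "h \<le> r" "q h < i" "i \<le> q (Suc h)"
  obtain x where x: "q h < x" "x \<le> q (Suc h)"
    "\<And>i. q h < i \<Longrightarrow> i \<le> x \<Longrightarrow> g i + (x - i) = g x"
    "1 \<le> h \<Longrightarrow> g (q h) \<le> g x"
    "\<And>i. q h < i \<Longrightarrow> i \<le> q (Suc h) \<Longrightarrow>
       floor_map n R g i = (if 1 \<le> h \<and> i \<le> x then max (g (q h)) (g i) else g i)"
    using floor_map_cases[OF g h(1)] by blast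
  show "\<exists>x. i \<le> x \<and> x \<le> q (Suc h) \<and> floor_map n R g x \<le> g i + (x - i)"
  proof (cases "i \<le> x")
    case True
    then show ?thesis using x(2) x(3)[of i] x(4) x(5)[of x] x(1) h
      by (intro exI[of _ x]) (auto simp: max_def)
  next
    case False
    then show ?thesis using x(5)[of i] h by (intro exI[of _ i]) auto
  qed
qed

text \<open>Across a carrel boundary the floor itself gives the inequality; where the raised stretch
  ends it is \<open>g (q h) \<le> g x\<close>.\<close>

lemma floor_map_le_Suc:
  assumes g: "g \<in> gapless_tuples n R" and i: "1 \<le> i" "i < n"
  shows "floor_map n R g i \<le> floor_map n R g (i + 1)"
proof -
  obtain h where h: "h \<le> r" "q h < i" "i \<le> q (Suc h)" using carrel_obtain[of i] i by auto
  show ?thesis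
  proof (cases "i = q (Suc h)")
    case True
    then have "h \<noteq> r" using i by auto
    then have h': "Suc h \<le> r" "i + 1 \<le> q (Suc (Suc h))"
      using h(1) q_less[of "Suc h" "Suc (Suc h)"] True by auto
    show ?thesis
      by (rule floor_map_cases[OF g h'(1)]) (use floor_map_carrel_end[OF g h(1)] True h' in auto)
  next
    case False
    then have i1: "i + 1 \<le> q (Suc h)" using h by simp
    have "g i < g (i + 1)"
      using upper_increasing_gap[OF gapless_upper_increasing[OF g] h(1,2) _ i1] by simp
    then show ?thesis
      by (rule_tac floor_map_cases[OF g h(1)]) (use h i1 in \<open>auto simp: max_def not_le Suc_le_eq\<close>)
  qed
qed

lemma floor_map_mono:
  assumes g: "g \<in> gapless_tuples n R" and "1 \<le> i" "i \<le> k" "k \<le> n"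
  shows "floor_map n R g i \<le> floor_map n R g k"
  using assms(3,4)
proof (induction k rule: dec_induct)
  case (step m)
  then show ?case using floor_map_le_Suc[OF g, of m] assms(2) by auto
qed simp

lemma floor_map_flag:
  assumes g: "g \<in> gapless_tuples n R"
  shows "floor_map n R g \<in> upper_flags n"
  using floor_map_upper[OF g] floor_map_mono[OF g]
  by (auto simp: upper_flags_def intro!: mono_onI)

text \<open>\<open>g\<close> increases strictly inside a carrel, so equal neighbours there both lie
  on the floor \<open>g (q h)\<close>. By monotonicity the plateau then reaches back to
  \<open>q h\<close> and does not start inside.\<close>

lemma floor_map_floor_flag:
  assumes g: "g \<in> gapless_tuples n R"
  shows "floor_map n R g \<in> floor_flags n R"
  unfolding floor_flags_def
proof (intro CollectI conjI allI impI floor_map_flag[OF g])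
  let ?f = "floor_map n R g"
  fix i assume *: "1 \<le> i \<and> i < n \<and> ?f i = ?f (i + 1) \<and> (i = 1 \<or> ?f (i - 1) \<noteq> ?f i)"
  then obtain h where h: "h \<le> r" "q h < i" "i \<le> q (Suc h)" using carrel_obtain[of i] by auto
  show "\<exists>h\<in>{1..r}. i = q h"
  proof (cases "i = q (Suc h)")
    case True
    then have "h \<noteq> r" using * by auto
    then show ?thesis using True h(1) by (intro bexI[of _ "Suc h"]) auto
  next
    case False
    then have i1: "i + 1 \<le> q (Suc h)" using h by simp
    have "g i < g (i + 1)"
      using upper_increasing_gap[OF gapless_upper_increasing[OF g] h(1,2) _ i1] by simp
    then have "1 \<le> h \<and> ?f i = g (q h)"
      by (rule_tac floor_map_cases[OF g h(1)])
         (use h i1 * in \<open>auto simp: max_def not_le Suc_le_eq split: if_splits\<close>)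
    then have h1: "1 \<le> h" and fi: "?f i = g (q h)" by auto
    then obtain k where k: "h = Suc k" by (cases h) auto
    have qh: "1 \<le> q h" using q_less[of 0 h] h1 h(1) by simp
    have "?f (q h) = g (q h)" using floor_map_carrel_end[OF g, of k] k h(1) by simp
    moreover have "q h \<le> i - 1" "i - 1 \<le> n" "1 \<le> i - 1" using * h qh by auto
    ultimately have "?f (i - 1) = ?f i"
      using floor_map_mono[OF g, of "q h" "i - 1"] floor_map_mono[OF g, of "i - 1" i] fi * qh by auto
    then show ?thesis using * h qh by auto
  qed
qed

end

section \<open>Extending a set by one carrel\<close>

lemma count_le_insert:
  assumes "finite C" "c \<notin> C"
  shows "count_le (insert c C) x = count_le C x + (if c \<le> x then 1 else 0)"
proof -
  have "{y \<in> insert c C. y \<le> x} = (if c \<le> x then insert c {y \<in> C. y \<le> x} else {y \<in> C. y \<le> x})"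
    by auto
  then show ?thesis using assms by (simp add: count_le_def)
qed

lemma count_le_interval:
  assumes "finite B" "x \<le> y" "{x<..y} \<subseteq> B"
  shows "count_le B y = count_le B x + (y - x)"
proof -
  have "{z \<in> B. z \<le> y} = {z \<in> B. z \<le> x} \<union> {x<..y}" using assms by auto
  then show ?thesis
    unfolding count_le_def using assms(1) by (simp add: card_Un_disjoint disjoint_iff)
qed

lemma new_element_below:
  assumes finB: "finite B" and less: "count_le B x < count_le B' x"
  obtains b where "b \<in> B' - B" "b \<le> x"
proof -
  have "\<not> {y \<in> B'. y \<le> x} \<subseteq> {y \<in> B. y \<le> x}"
  proof
    assume sub: "{y \<in> B'. y \<le> x} \<subseteq> {y \<in> B. y \<le> x}"
    have "count_le B' x \<le> count_le B x"
      using card_mono[OF _ sub] finB by (simp add: count_le_def)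
    then show False using less by simp
  qed
  then show thesis using that by auto
qed

text \<open>The condition satisfied by consecutive initial sets of a 312-avoiding permutation: nothing
  that enters later lies between a newly entered value and a larger old one.\<close>

definition fills_gaps :: "nat set \<Rightarrow> nat set \<Rightarrow> bool" where
  "fills_gaps B B' \<longleftrightarrow> (\<forall>a\<in>B. \<forall>b\<in>B' - B. \<forall>c. b < c \<and> c < a \<longrightarrow> c \<in> B')"

lemma fills_gapsD: "fills_gaps B B' \<Longrightarrow> a \<in> B \<Longrightarrow> b \<in> B' - B \<Longrightarrow> b < c \<Longrightarrow> c < a \<Longrightarrow> c \<in> B'"
  unfolding fills_gaps_def by blast

text \<open>If row \<open>i\<close> drops to \<open>x\<close>, some new value
  \<open>b \<le> x\<close> has entered. Any \<open>c\<close> between \<open>x\<close> and the entry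
  of row \<open>card B + 1\<close> still has an old value above it, by counting, and so belongs to
  \<open>B'\<close>. Rows \<open>i\<close> to \<open>card B + 1\<close> are therefore consecutive
  integers.\<close>

lemma fills_gaps_dichotomy:
  assumes fin: "finite B'" and sub: "B \<subseteq> B'" and card: "card B < card B'" and fg: "fills_gaps B B'"
    and i: "1 \<le> i" "i \<le> card B"
  shows "nth_least B i \<le> nth_least B' i \<or>
         nth_least B' (card B + 1) \<le> nth_least B' i + (card B + 1 - i)"
proof (cases "nth_least B i \<le> nth_least B' i")
  case False
  have finB: "finite B" using fin sub finite_subset by blast
  let ?x = "nth_least B' i" and ?y = "nth_least B' (card B + 1)"
  have cx: "count_le B' ?x = i" using fin i card by (intro count_le_nth_least) auto
  have cy: "count_le B' ?y = card B + 1" using fin card by (intro count_le_nth_least) auto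
  have "count_le B ?x < count_le B' ?x"
    using False nth_least_le_iff[OF finB i, of ?x] cx by auto
  then obtain b where b: "b \<in> B' - B" "b \<le> ?x" using new_element_below[OF finB] by blast
  have "c \<in> B'" if c: "?x < c" "c \<le> ?y" for c
  proof (cases "c = ?y")
    case True
    then show ?thesis using nth_least_mem[OF fin, of "card B + 1"] card by simp
  next
    case False
    then have "\<not> card B + 1 \<le> count_le B' c"
      using nth_least_le_iff[OF fin, of "card B + 1" c] card c by simp
    moreover have "count_le B c < count_le B' c"
      unfolding count_le_def using fin sub b c by (intro psubset_card_mono) auto
    ultimately have "count_le B c < card B" by simp
    then have "\<not> B \<subseteq> {y \<in> B. y \<le> c}"
      using card_mono[of "{y \<in> B. y \<le> c}" B] finB by (auto simp: count_le_def)
    then obtain a where a: "a \<in> B" "c < a" by (auto simp: subset_iff not_le)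
    show ?thesis using fills_gapsD[OF fg a(1) b(1), of c] a b c by auto
  qed
  then have "{?x<..?y} \<subseteq> B'" by auto
  moreover have "?x \<le> ?y" using nth_least_le[of i "card B + 1" B'] i card by auto
  ultimately have "count_le B' ?y = count_le B' ?x + (?y - ?x)" by (intro count_le_interval[OF fin])
  then show ?thesis using cx cy by auto
qed simp

text \<open>The set-level form of gaplessness. Up to its entry in row \<open>card B + 1\<close> the
  set \<open>B'\<close> has more values than \<open>B\<close> has at all, so a new value lies there,
  and everything from that entry to the old maximum is filled.\<close>

lemma fills_gaps_run:
  assumes fin: "finite B'" and sub: "B \<subseteq> B'" and card: "card B < card B'" and fg: "fills_gaps B B'"
    and ne: "1 \<le> card B" and lt: "nth_least B' (card B + 1) < nth_least B (card B)"
    and s: "nth_least B (card B) + 1 = nth_least B' (card B + 1) + s"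
  shows "card B + s \<le> card B'"
    and "1 \<le> t \<Longrightarrow> t \<le> s \<Longrightarrow> nth_least B' (card B + t) + s = nth_least B (card B) + t"
proof -
  have finB: "finite B" using fin sub finite_subset by blast
  let ?m = "nth_least B' (card B + 1)" and ?M = "nth_least B (card B)"
  have cm: "count_le B' ?m = card B + 1" using fin card by (intro count_le_nth_least) auto
  have M: "?M \<in> B" using finB ne by (intro nth_least_mem) auto
  have "count_le B ?m < count_le B' ?m"
    using count_le_card[OF finB, of ?m] cm by simp
  then obtain b where b: "b \<in> B' - B" "b \<le> ?m" using new_element_below[OF finB] by blast
  have run: "{?m<..?M} \<subseteq> B'"
  proof
    fix c assume c: "c \<in> {?m<..?M}"
    show "c \<in> B'"
      using fills_gapsD[OF fg M b(1), of c] b c M sub by (cases "c = ?M") auto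
  qed
  have count: "count_le B' (?m + k) = card B + 1 + k" if "k < s" for k
    using count_le_interval[OF fin, of ?m "?m + k"] run s that cm by (auto simp: subset_iff)
  show "card B + s \<le> card B'"
    using count[of "s - 1"] count_le_card[OF fin, of "?m + (s - 1)"] s lt by auto
  show "nth_least B' (card B + t) + s = ?M + t" if t: "1 \<le> t" "t \<le> s"
  proof -
    have "?m + (t - 1) \<in> B'"
    proof (cases "t = 1")
      case False
      then have "?m + (t - 1) \<in> {?m<..?M}" using t s by auto
      then show ?thesis using run by blast
    qed (use nth_least_mem[OF fin, of "card B + 1"] card in auto)
    then have "nth_least B' (card B + t) = ?m + (t - 1)"
      using count[of "t - 1"] t by (intro nth_least_eqI[OF fin]) auto
    then show ?thesis using s t by simp
  qed
qed

text \<open>One carrel of the inverse construction: the new values are the \<open>s\<close> largest values below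
  \<open>M\<close> not used so far, followed by values of \<open>g\<close> above \<open>M\<close>.\<close>

lemma carrel_extension:
  fixes A C :: "nat set" and f g :: "nat \<Rightarrow> nat" and M a b s :: nat
  defines "C \<equiv> {1..M} - A"
  defines "A' \<equiv> A \<union> f ` {a<..b}"
  assumes A: "A \<subseteq> {1..M}" "card A = a" and asM: "a + s \<le> M" and ab: "a < b" "a + s \<le> b"
    and mono: "strict_mono_on {a + s<..b} g" and big: "\<And>i. a + s < i \<Longrightarrow> i \<le> b \<Longrightarrow> M < g i"
    and run: "\<And>t. 1 \<le> t \<Longrightarrow> t \<le> s \<Longrightarrow> g (a + t) + s = M + t"
    and f_hi: "\<And>i. a + s < i \<Longrightarrow> i \<le> b \<Longrightarrow> f i = g i"
    and f_lo: "\<And>i. a < i \<Longrightarrow> i \<le> a + s \<Longrightarrow> f i = nth_least C (M - a - (a + s - i))"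
  shows "strict_mono_on {a<..b} f" and "f ` {a<..b} \<inter> A = {}" and "card A' = b"
    and "A' \<subseteq> {1..g b}" and "fills_gaps A A'"
    and "\<And>i. a < i \<Longrightarrow> i \<le> b \<Longrightarrow> nth_least A' i = g i"
proof -
  have finA: "finite A" using A(1) finite_subset by blast
  have finC: "finite C" unfolding C_def by simp
  have cardC: "card C = M - a" unfolding C_def using A finA by (simp add: card_Diff_subset)
  \<comment> \<open>The \<open>s\<close> largest elements of \<open>C\<close>, described by counts
    so that closure upwards within \<open>C\<close> is evident.\<close>
  define N where "N = {x \<in> C. M - a < count_le C x + s}"
  have lo: "f i \<in> N" if i: "a < i" "i \<le> a + s" for i
  proof -
    have k: "1 \<le> M - a - (a + s - i)" "M - a - (a + s - i) \<le> card C" using i asM cardC by auto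
    show ?thesis unfolding N_def f_lo[OF i]
      using nth_least_mem[OF finC k] count_le_nth_least[OF finC k] i asM by auto
  qed
  have N_C: "N \<subseteq> C" unfolding N_def by auto
  have C_M: "C \<subseteq> {1..M}" unfolding C_def by auto
  show sm: "strict_mono_on {a<..b} f"
  proof (rule strict_mono_onI)
    fix i k assume ik: "i \<in> {a<..b}" "k \<in> {a<..b}" "i < k"
    consider "k \<le> a + s" | "i \<le> a + s" "a + s < k" | "a + s < i" by linarith
    then show "f i < f k"
    proof cases
      case 1
      then show ?thesis using ik asM cardC by (auto simp: f_lo intro!: nth_least_less)
    next
      case 2
      then have "f i \<le> M" using lo[of i] N_C C_M ik by auto
      then show ?thesis using 2 ik big[of k] f_hi[of k] by auto
    next
      case 3
      then show ?thesis using ik strict_mono_onD[OF mono, of i k] by (auto simp: f_hi)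
    qed
  qed
  have f_img: "f i \<in> N \<or> (f i = g i \<and> M < g i)" if "a < i" "i \<le> b" for i
    using that lo[of i] f_hi[of i] big[of i] by (cases "i \<le> a + s") auto
  show disj: "f ` {a<..b} \<inter> A = {}"
    using f_img N_C A(1) unfolding C_def by fastforce
  have inj: "inj_on f {a<..b}" using sm by (rule strict_mono_on_imp_inj_on)
  have finA': "finite A'" unfolding A'_def using finA by simp
  have card_part: "card (A \<union> f ` {a<..k}) = k" if "a \<le> k" "k \<le> b" for k
  proof -
    have "card (A \<union> f ` {a<..k}) = card A + card (f ` {a<..k})"
    proof (rule card_Un_disjoint)
      have "f ` {a<..k} \<subseteq> f ` {a<..b}" using that by auto
      then show "A \<inter> f ` {a<..k} = {}" using disj by blast
    qed (use finA in auto)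
    moreover have "card (f ` {a<..k}) = k - a"
      using inj that by (subst card_image) (auto intro: inj_on_subset)
    ultimately show ?thesis using A that by simp
  qed
  show cardA': "card A' = b" using card_part[of b] ab unfolding A'_def by simp
  have Mgb: "M \<le> g b"
  proof (cases "b = a + s")
    case True
    then show ?thesis using run[of s] ab by simp
  qed (use big[of b] ab in auto)
  have gb: "g i \<le> g b" if "a + s < i" "i \<le> b" for i
    using that strict_mono_onD[OF mono, of i b] by (cases "i = b") auto
  show "A' \<subseteq> {1..g b}"
  proof
    fix x assume "x \<in> A'"
    then consider "x \<in> A" | i where "a < i" "i \<le> b" "x = f i" unfolding A'_def by auto
    then show "x \<in> {1..g b}"
    proof cases
      case 1
      then show ?thesis using A(1) Mgb by auto
    next
      case 2
      show ?thesis
      proof (cases "i \<le> a + s")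
        case True
        then show ?thesis using 2 lo[of i] N_C C_M Mgb by fastforce
      next
        case False
        then show ?thesis using 2 f_hi[of i] big[of i] gb[of i] by auto
      qed
    qed
  qed
  have imgN: "f ` {a<..a + s} = N"
  proof (rule card_subset_eq)
    show "finite N" using finC N_C finite_subset by blast
    show sub: "f ` {a<..a + s} \<subseteq> N" using lo by auto
    have cs: "card (f ` {a<..a + s}) = s"
      using inj ab by (subst card_image) (auto intro: inj_on_subset)
    have "N \<subseteq> nth_least C ` {M - a - s<..M - a}"
    proof
      fix x assume x: "x \<in> N"
      then obtain k where "1 \<le> k" "k \<le> card C" "x = nth_least C k"
        using nth_least_obtain[OF finC, of x] N_C by blast
      then show "x \<in> nth_least C ` {M - a - s<..M - a}"
        using x count_le_nth_least[OF finC, of k] cardC unfolding N_def by auto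
    qed
    then have "card N \<le> card (nth_least C ` {M - a - s<..M - a})" by (intro card_mono) auto
    moreover have "card (nth_least C ` {M - a - s<..M - a}) \<le> s"
      using card_image_le[of "{M - a - s<..M - a}" "nth_least C"] asM by auto
    ultimately have "card N \<le> s" by linarith
    moreover have "card (f ` {a<..a + s}) \<le> card N"
      using sub \<open>finite N\<close> by (intro card_mono)
    ultimately show "card (f ` {a<..a + s}) = card N" using cs by simp
  qed
  have N_A': "N \<subseteq> A'" unfolding A'_def imgN[symmetric] using ab by auto
  show "fills_gaps A A'"
    unfolding fills_gaps_def
  proof (intro ballI allI impI)
    fix x y c assume x: "x \<in> A" and y: "y \<in> A' - A" and c: "y < c \<and> c < x"
    have xM: "x \<le> M" using x A by auto
    \<comment> \<open>A new value below \<open>M\<close> is among the \<open>s\<close> largest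
      available ones, and an available \<open>c\<close> above it is then among them too.\<close>
    then have "y \<in> N" using y c f_img unfolding A'_def by fastforce
    then have "c \<in> A \<or> c \<in> N"
      using c xM count_le_mono[OF finC, of y c] unfolding N_def C_def by auto
    then show "c \<in> A'" using N_A' unfolding A'_def by auto
  qed
  have low: "{y \<in> A'. y \<le> M} = A \<union> f ` {a<..a + s}"
  proof (intro equalityI subsetI)
    fix y assume y: "y \<in> {y \<in> A'. y \<le> M}"
    show "y \<in> A \<union> f ` {a<..a + s}"
    proof (cases "y \<in> A")
      case False
      then obtain k where "a < k" "k \<le> b" "y = f k" using y unfolding A'_def by auto
      then have "y \<in> N" using f_img[of k] y by auto
      then show ?thesis using imgN by auto
    qed simp
  next
    fix y assume y: "y \<in> A \<union> f ` {a<..a + s}"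
    then have "y \<in> A'" using ab unfolding A'_def by auto
    moreover have "y \<le> M" using y A(1) N_C C_M unfolding imgN by auto
    ultimately show "y \<in> {y \<in> A'. y \<le> M}" by simp
  qed
  \<comment> \<open>At most \<open>M - c < s\<close> elements of \<open>C\<close> exceed such a
    \<open>c\<close>, so if \<open>c\<close> is not in \<open>A\<close> it is one of the
    \<open>s\<close> chosen values.\<close>
  have top_run: "{M - s<..M} \<subseteq> A'"
  proof
    fix c assume c: "c \<in> {M - s<..M}"
    show "c \<in> A'"
    proof (cases "c \<in> A")
      case False
      then have cC: "c \<in> C" using c unfolding C_def by auto
      have "{z \<in> C. z \<le> M} \<subseteq> {z \<in> C. z \<le> c} \<union> {c<..M}" by auto
      then have "card {z \<in> C. z \<le> M} \<le> card ({z \<in> C. z \<le> c} \<union> {c<..M})"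
        using finC by (intro card_mono) auto
      also have "\<dots> \<le> count_le C c + (M - c)"
        unfolding count_le_def by (rule order.trans[OF card_Un_le]) simp
      also have "{z \<in> C. z \<le> M} = C" using C_M by auto
      finally have "c \<in> N" unfolding N_def using cC cardC c by auto
      then show ?thesis using N_A' by auto
    qed (auto simp: A'_def)
  qed
  fix i assume i: "a < i" "i \<le> b"
  show "nth_least A' i = g i"
  proof (cases "i \<le> a + s")
    case True
    define t where "t = i - a"
    have t: "i = a + t" "1 \<le> t" "t \<le> s" using True i unfolding t_def by auto
    have gi: "g i + s = M + t" using run t by simp
    \<comment> \<open>Exactly \<open>a + s\<close> values lie up to \<open>M\<close>, and the
      topmost \<open>s\<close> numbers are all present; counting down from \<open>M\<close> gives
      the position of \<open>g i\<close>.\<close>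
    have "count_le A' M = count_le A' (g i) + (M - g i)"
      using top_run gi t by (intro count_le_interval[OF finA']) (auto simp: subset_iff)
    moreover have "count_le A' M = a + s"
      unfolding count_le_def low using card_part[of "a + s"] ab by simp
    ultimately have "count_le A' (g i) = i" using gi t by simp
    moreover have "g i \<in> A'" using top_run gi t asM by (auto simp: subset_iff)
    ultimately show ?thesis by (intro nth_least_eqI[OF finA'])
  next
    case False
    then have i': "a + s < i" by simp
    have "{y \<in> A'. y \<le> g i} = A \<union> f ` {a<..i}"
    proof (intro equalityI subsetI)
      fix y assume y: "y \<in> {y \<in> A'. y \<le> g i}"
      show "y \<in> A \<union> f ` {a<..i}"
      proof (cases "y \<in> A")
        case False
        then obtain k where k: "a < k" "k \<le> b" "y = f k" using y unfolding A'_def by auto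
        then have "k \<le> i" using strict_mono_onD[OF sm, of i k] y i f_hi[OF i' i(2)]
          by (cases "k \<le> i") auto
        then show ?thesis using k by auto
      qed simp
    next
      fix y assume y: "y \<in> A \<union> f ` {a<..i}"
      have "f k \<le> g i" if "a < k" "k \<le> i" for k
        using strict_mono_onD[OF sm, of k i] that i f_hi[OF i' i(2)] by (cases "k = i") auto
      then show "y \<in> {y \<in> A'. y \<le> g i}"
        using y A(1) big[OF i' i(2)] i unfolding A'_def by auto
    qed
    then have "count_le A' (g i) = i"
      unfolding count_le_def using card_part[of i] i by simp
    moreover have "g i \<in> A'"
      using f_hi[OF i' i(2)] imageI[of i "{a<..b}" f] i unfolding A'_def by simp
    ultimately show ?thesis by (intro nth_least_eqI[OF finA'])
  qed
qed

section \<open>Permutations\<close>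

context carrels
begin

abbreviation init :: "tuple \<Rightarrow> nat \<Rightarrow> nat set" where "init \<equiv> init_set n R"

lemma R_perms_iff:
  "p \<in> R_perms n R \<longleftrightarrow> p permutes {1..n} \<and> (\<forall>h\<le>r. strict_mono_on {q h<..q (Suc h)} p)"
  unfolding R_perms_def using ball_carrels[of "\<lambda>C. strict_mono_on C p"] by simp

lemma finite_init [simp]: "finite (init p h)"
  by (simp add: init_set_def)

lemma card_image_permutes:
  assumes "p permutes {1..n}" shows "card (p ` {1..k}) = k"
  using permutes_inj[OF assms] by (simp add: card_image inj_on_subset)

lemma card_init: "p permutes {1..n} \<Longrightarrow> card (init p h) = q h"
  unfolding init_set_def by (rule card_image_permutes)

lemma init_subset:
  assumes "p permutes {1..n}" "h \<le> Suc r" shows "init p h \<subseteq> {1..n}"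
proof -
  have "p ` {1..q h} \<subseteq> p ` {1..n}" using q_le_n[OF assms(2)] by auto
  then show ?thesis using permutes_image[OF assms(1)] by (simp add: init_set_def)
qed

lemma init_mono: "h \<le> h' \<Longrightarrow> h' \<le> Suc r \<Longrightarrow> init p h \<subseteq> init p h'"
  using q_le[of h h'] by (auto simp: init_set_def)

lemma init_last: "p permutes {1..n} \<Longrightarrow> init p (Suc r) = {1..n}"
  by (simp add: init_set_def permutes_image)

lemma rank_tuple_eq:
  assumes p: "p permutes {1..n}" and h: "h \<le> r" "q h < i" "i \<le> q (Suc h)"
  shows "rank_tuple n R p i = nth_least (init p (Suc h)) i"
proof -
  have "i \<in> {1..n}" using h q_le_n[of "Suc h"] by auto
  then show ?thesis using h
    by (simp add: rank_tuple_def carrel_index_eq[OF h] rank_desc_eq_nth_least card_init[OF p])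
qed

lemma rank_tuple_upper_increasing:
  assumes p: "p permutes {1..n}"
  shows "rank_tuple n R p \<in> upper_increasing n R"
  unfolding upper_increasing_iff
proof (intro conjI allI impI)
  have "rank_tuple n R p i \<in> {1..n} \<and> i \<le> rank_tuple n R p i" if i: "i \<in> {1..n}" for i
  proof -
    obtain h where h: "h \<le> r" "q h < i" "i \<le> q (Suc h)" using carrel_obtain i by auto
    have sub: "init p (Suc h) \<subseteq> {1..n}" using init_subset[OF p, of "Suc h"] h by auto
    then have "0 \<notin> init p (Suc h)" by auto
    then show ?thesis
      using sub rank_tuple_eq[OF p h] nth_least_mem[of "init p (Suc h)" i] i h card_init[OF p]
        nth_least_ge[of "init p (Suc h)" i] by (auto simp: subset_iff)
  qed
  then show "rank_tuple n R p \<in> upper_tuples n" by (auto simp: upper_tuples_def rank_tuple_def)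
  fix h assume "h \<le> r"
  then show "strict_mono_on {q h<..q (Suc h)} (rank_tuple n R p)"
    by (auto intro!: strict_mono_onI nth_least_less simp: rank_tuple_eq[OF p] card_init[OF p])
qed

lemma nth_least_init_le_rank_tuple:
  assumes p: "p permutes {1..n}" and h: "h \<le> Suc r" and i: "1 \<le> i" "i \<le> q h"
  shows "nth_least (init p h) i \<le> rank_tuple n R p i"
proof -
  obtain k where k: "k \<le> r" "q k < i" "i \<le> q (Suc k)" using carrel_obtain[of i] i q_le_n[OF h] by auto
  have "Suc k \<le> h" using q_le[of h k] k i by (cases "h \<le> k") auto
  then have "nth_least (init p h) i \<le> nth_least (init p (Suc k)) i"
    using init_mono[of "Suc k" h p] h i k card_init[OF p] by (intro nth_least_subset) auto
  then show ?thesis using rank_tuple_eq[OF p k] by simp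
qed

text \<open>Only the sets of values on initial segments matter, which are the columns of the key.
  The range may include \<open>h = r\<close> because nothing in \<open>{1..n}\<close> lies outside
  the last initial set.\<close>

lemma avoiding_iff:
  "p \<in> R_312_avoiding n R \<longleftrightarrow>
     p \<in> R_perms n R \<and> (\<forall>h. 1 \<le> h \<and> h \<le> r \<longrightarrow> fills_gaps (init p h) (init p (Suc h)))"
proof (cases "p \<in> R_perms n R")
  case True
  then have p: "p permutes {1..n}" by (simp add: R_perms_def)
  note inj = permutes_inj[OF p]
  have init_iff: "p x \<in> init p h \<longleftrightarrow> 1 \<le> x \<and> x \<le> q h" for x h
    using inj by (auto simp: init_set_def inj_image_mem_iff)
  have "contains_312 n R p \<longleftrightarrow> (\<exists>h. 1 \<le> h \<and> h \<le> r \<and> \<not> fills_gaps (init p h) (init p (Suc h)))"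
  proof
    assume "contains_312 n R p"
    then obtain h a b c where h: "1 \<le> h" "h \<le> r - 1" and abc: "1 \<le> a" "a \<le> q h" "q h < b"
      "b \<le> q (Suc h)" "q (Suc h) < c" "c \<le> n" "p b < p c" "p c < p a"
      unfolding contains_312_def by auto
    have "p a \<in> init p h" "p b \<in> init p (Suc h) - init p h" "p c \<notin> init p (Suc h)"
      using abc by (auto simp: init_iff)
    then have "\<not> fills_gaps (init p h) (init p (Suc h))"
      using abc(7,8) unfolding fills_gaps_def by blast
    then show "\<exists>h. 1 \<le> h \<and> h \<le> r \<and> \<not> fills_gaps (init p h) (init p (Suc h))" using h by auto
  next
    assume "\<exists>h. 1 \<le> h \<and> h \<le> r \<and> \<not> fills_gaps (init p h) (init p (Suc h))"
    then obtain h a b c where h: "1 \<le> h" "h \<le> r" and abc: "a \<in> init p h"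
      "b \<in> init p (Suc h) - init p h" "b < c" "c < a" "c \<notin> init p (Suc h)"
      unfolding fills_gaps_def by auto
    have "a \<in> {1..n}" using abc(1) init_subset[OF p, of h] h by auto
    then have cn: "c \<in> {1..n}" using abc by auto
    then obtain c' where c': "c = p c'" "c' \<in> {1..n}" using permutes_image[OF p] by blast
    obtain a' b' where ab': "a = p a'" "b = p b'" using abc(1,2) by (auto simp: init_set_def)
    have *: "1 \<le> a'" "a' \<le> q h" "1 \<le> b'" "b' \<le> q (Suc h)" "q h < b'" "q (Suc h) < c'"
      using abc ab' c' by (auto simp: init_iff)
    have "h \<noteq> r" using * c' by auto
    then have "h \<in> {1..r - 1}" using h by auto
    then show "contains_312 n R p"
      unfolding contains_312_def
      using * c' abc(3,4) ab' by (intro bexI[of _ h] exI[of _ a'] exI[of _ b'] exI[of _ c']) auto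
  qed
  then show ?thesis using True unfolding R_312_avoiding_def by auto
qed (simp add: R_312_avoiding_def)

lemma avoiding_permutes: "p \<in> R_312_avoiding n R \<Longrightarrow> p permutes {1..n}"
  by (simp add: R_312_avoiding_def R_perms_def)

lemma rank_tuple_gapless:
  assumes p: "p \<in> R_312_avoiding n R"
  shows "rank_tuple n R p \<in> gapless_tuples n R"
proof (rule gaplessI)
  note perm = avoiding_permutes[OF p]
  show "rank_tuple n R p \<in> upper_increasing n R" by (rule rank_tuple_upper_increasing[OF perm])
  fix h s
  let ?g = "rank_tuple n R p" and ?B = "init p h" and ?B' = "init p (Suc h)"
  assume h: "1 \<le> h" "h \<le> r" and lt: "?g (q h + 1) < ?g (q h)" and s: "?g (q h) + 1 = ?g (q h + 1) + s"
  obtain k where k: "h = Suc k" using h by (cases h) auto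
  have q: "q k < q h" "0 < q h" "q h < q (Suc h)"
    using q_less[of k h] q_less[of 0 h] q_less[of h "Suc h"] h k by auto
  have top: "?g (q h) = nth_least ?B (q h)" using rank_tuple_eq[OF perm, of k "q h"] k h q by simp
  have g: "?g (q h + t) = nth_least ?B' (q h + t)" if "1 \<le> t" "q h + t \<le> q (Suc h)" for t
    using rank_tuple_eq[OF perm h(2), of "q h + t"] that by simp
  have fg: "fills_gaps ?B ?B'" using p h unfolding avoiding_iff by blast
  note run = fills_gaps_run[OF finite_init init_mono _ fg, unfolded card_init[OF perm]]
  have m: "?g (q h + 1) = nth_least ?B' (q h + 1)" using g[of 1] q by simp
  note lt' = lt[unfolded top m] and s' = s[unfolded top m]
  have "q h + s \<le> q (Suc h)" using run(1)[of s] h q lt' s' by simp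
  moreover have "nth_least ?B' (q h + t) + s = nth_least ?B (q h) + t" if "1 \<le> t" "t \<le> s" for t
    using run(2)[of s t] h q lt' s' that by simp
  ultimately show "q h + s \<le> q (Suc h) \<and> (\<forall>t\<in>{1..s}. ?g (q h + t) + s = ?g (q h) + t)"
    using g top by auto
qed

text \<open>Shows that the key entries are the largest that the rank tuple allows. When a carrel is
  added, either row \<open>i\<close> does not drop and the old \<open>z\<close> still serves, or the
  rows up to \<open>q h + 1\<close> are consecutive and \<open>z = q h + 1\<close> serves.\<close>

lemma rank_tuple_attains_init:
  assumes p: "p \<in> R_312_avoiding n R" and "h \<le> Suc r" "1 \<le> i" "i \<le> q h"
  shows "\<exists>z. i \<le> z \<and> z \<le> q h \<and> rank_tuple n R p z \<le> nth_least (init p h) i + (z - i)"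
  using assms(2-)
proof (induction h)
  case (Suc h)
  note perm = avoiding_permutes[OF p]
  let ?B = "init p h" and ?B' = "init p (Suc h)"
  have q: "q h < q (Suc h)" using q_less[of h "Suc h"] Suc.prems by simp
  show ?case
  proof (cases "q h < i")
    case True
    then show ?thesis using rank_tuple_eq[OF perm, of h i] Suc.prems by (intro exI[of _ i]) auto
  next
    case False
    then have h: "1 \<le> h" using Suc.prems by (cases h) auto
    then have fg: "fills_gaps ?B ?B'" using p Suc.prems unfolding avoiding_iff by auto
    have "nth_least ?B i \<le> nth_least ?B' i \<or> nth_least ?B' (q h + 1) \<le> nth_least ?B' i + (q h + 1 - i)"
      using fills_gaps_dichotomy[OF finite_init init_mono _ fg, of i] Suc.prems False q
      by (simp add: card_init[OF perm])
    then show ?thesis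
    proof
      assume le: "nth_least ?B i \<le> nth_least ?B' i"
      obtain z where "i \<le> z" "z \<le> q h" "rank_tuple n R p z \<le> nth_least ?B i + (z - i)"
        using Suc.IH Suc.prems False by auto
      then show ?thesis using le q by (intro exI[of _ z]) auto
    next
      assume "nth_least ?B' (q h + 1) \<le> nth_least ?B' i + (q h + 1 - i)"
      then show ?thesis
        using rank_tuple_eq[OF perm, of h "q h + 1"] Suc.prems False q
        by (intro exI[of _ "q h + 1"]) auto
    qed
  qed
qed simp

text \<open>Differences of initial sets give the values on each carrel, and increasing order leaves
  one way to list them.\<close>

lemma R_perms_eqI:
  assumes p: "p \<in> R_perms n R" and p': "p' \<in> R_perms n R"
    and eq: "\<And>h. 1 \<le> h \<Longrightarrow> h \<le> r \<Longrightarrow> init p h = init p' h"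
  shows "p = p'"
proof
  fix i
  have perm: "p permutes {1..n}" "p' permutes {1..n}" using p p' by (auto simp: R_perms_def)
  have eq': "init p h = init p' h" if "h \<le> Suc r" for h
    using eq[of h] that init_last[OF perm(1)] init_last[OF perm(2)]
    by (cases "h = 0 \<or> h = Suc r") (auto simp: init_set_def[of _ _ _ 0])
  show "p i = p' i"
  proof (cases "i \<in> {1..n}")
    case True
    then obtain h where h: "h \<le> r" "q h < i" "i \<le> q (Suc h)" using carrel_obtain by auto
    have img: "f ` {q h<..q (Suc h)} = init f (Suc h) - init f h" if "f permutes {1..n}" for f
    proof -
      have "{q h<..q (Suc h)} = {1..q (Suc h)} - {1..q h}" by auto
      then show ?thesis using permutes_inj[OF that] by (simp add: init_set_def image_set_diff)
    qed
    have count: "f i = nth_least (f ` {q h<..q (Suc h)}) (i - q h)"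
      if "strict_mono_on {q h<..q (Suc h)} f" for f :: "nat \<Rightarrow> nat"
    proof (rule nth_least_eqI[symmetric])
      have "{y \<in> f ` {q h<..q (Suc h)}. y \<le> f i} = f ` {q h<..i}"
      proof (intro equalityI subsetI)
        fix y assume "y \<in> {y \<in> f ` {q h<..q (Suc h)}. y \<le> f i}"
        then obtain k where "q h < k" "k \<le> q (Suc h)" "y = f k" "f k \<le> f i" by auto
        then show "y \<in> f ` {q h<..i}"
          using strict_mono_onD[OF that, of i k] h by (cases "k \<le> i") auto
      next
        fix y assume "y \<in> f ` {q h<..i}"
        then obtain k where "q h < k" "k \<le> i" "y = f k" by auto
        then show "y \<in> {y \<in> f ` {q h<..q (Suc h)}. y \<le> f i}"
          using strict_mono_onD[OF that, of k i] h by (cases "k = i") auto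
      qed
      moreover have "inj_on f {q h<..i}"
        using strict_mono_on_imp_inj_on[OF that] h by (auto intro: inj_on_subset)
      ultimately show "count_le (f ` {q h<..q (Suc h)}) (f i) = i - q h"
        by (simp add: count_le_def card_image)
    qed (use h in auto)
    have "p ` {q h<..q (Suc h)} = p' ` {q h<..q (Suc h)}"
      using img[OF perm(1)] img[OF perm(2)] eq'[of h] eq'[of "Suc h"] h by simp
    then show ?thesis using count[of p] count[of p'] p p' h(1) unfolding R_perms_iff by simp
  qed (use perm in \<open>simp add: permutes_not_in\<close>)
qed

section \<open>The permutation of a gapless tuple\<close>

lemma perm_upto_stable:
  assumes "h \<le> k" "k \<le> Suc r" "i \<le> q h"
  shows "perm_upto n R g k i = perm_upto n R g h i"
  using assms(1,2)
proof (induction k rule: dec_induct)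
  case (step m)
  have "i \<le> q m" using q_le[of h m] step assms(3) by auto
  then have "i \<notin> carrel n R (Suc m)" by (simp add: carrel_Suc)
  then show ?case using step by simp
qed simp

lemma gapless_perm_carrel:
  assumes h: "h \<le> r" "q h < i" "i \<le> q (Suc h)"
  shows "gapless_perm n R g i = (if q h + overlap n R g h < i then g i
    else rank_desc (q h + overlap n R g h - i + 1) ({1..g (q h)} - gapless_perm n R g ` {1..q h}))"
proof -
  have "gapless_perm n R g i = perm_upto n R g (Suc h) i"
    using perm_upto_stable[of "Suc h" "Suc r" i g] h by (simp add: gapless_perm_def)
  moreover have "gapless_perm n R g ` {1..q h} = perm_upto n R g h ` {1..q h}"
    using perm_upto_stable[of h "Suc r" _ g] h
    by (intro image_cong) (auto simp: gapless_perm_def simp del: perm_upto.simps)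
  ultimately show ?thesis using h by (simp add: carrel_Suc Let_def)
qed

lemma perm_upto_outside:
  assumes "i \<notin> {1..n}" "h \<le> Suc r"
  shows "perm_upto n R g h i = i"
  using assms(2)
proof (induction h)
  case (Suc h)
  then have "i \<notin> carrel n R (Suc h)" using assms(1) q_le_n[of "Suc h"] by (auto simp: carrel_Suc)
  then show ?case using Suc by simp
qed simp

lemma init_Suc: "h \<le> r \<Longrightarrow> init p (Suc h) = init p h \<union> p ` {q h<..q (Suc h)}"
proof -
  assume "h \<le> r"
  then have "{1..q (Suc h)} = {1..q h} \<union> {q h<..q (Suc h)}" using q_less[of h "Suc h"] by auto
  then show ?thesis by (simp add: init_set_def image_Un)
qed

lemma gapless_perm_step:
  fixes g :: tuple
  defines "p \<equiv> gapless_perm n R g"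
  assumes g: "g \<in> gapless_tuples n R" and h: "h \<le> r"
    and A: "card (init p h) = q h" "1 \<le> h \<Longrightarrow> init p h \<subseteq> {1..g (q h)}"
  shows "strict_mono_on {q h<..q (Suc h)} p" and "card (init p (Suc h)) = q (Suc h)"
    and "init p (Suc h) \<subseteq> {1..g (q (Suc h))}" and "fills_gaps (init p h) (init p (Suc h))"
    and "\<And>i. q h < i \<Longrightarrow> i \<le> q (Suc h) \<Longrightarrow> nth_least (init p (Suc h)) i = g i"
proof -
  note ui = gapless_upper_increasing[OF g] and up = gapless_upper[OF g]
  \<comment> \<open>With \<open>M = 0\<close> and \<open>s = 0\<close> the first carrel is an
    instance of the general step in which all values of \<open>g\<close> lie above
    \<open>M\<close>.\<close>
  define M where "M = (if h = 0 then 0 else g (q h))"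
  define s where "s = overlap n R g h"
  have q: "q h < q (Suc h)" "q (Suc h) \<le> n" using q_less[of h "Suc h"] q_le_n[of "Suc h"] h by auto
  have up': "i \<le> g i" if "1 \<le> i" "i \<le> n" for i using up that by (auto simp: upper_tuples_def)
  have AM: "init p h \<subseteq> {1..M}" using A(2) by (cases "h = 0") (auto simp: M_def init_set_def)
  have sm: "strict_mono_on {q h<..q (Suc h)} g" using ui h by (auto simp: upper_increasing_iff)
  \<comment> \<open>Either \<open>g\<close> starts the carrel at or below \<open>M\<close>, and
    gaplessness supplies the run back to \<open>M\<close>, or the whole carrel lies above
    \<open>M\<close> and \<open>s = 0\<close>.\<close>
  have *: "q h + s \<le> M \<and> q h + s \<le> q (Suc h) \<and> (\<forall>i. q h + s < i \<and> i \<le> q (Suc h) \<longrightarrow> M < g i) \<and>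
    (\<forall>t. 1 \<le> t \<and> t \<le> s \<longrightarrow> g (q h + t) + s = M + t)"
  proof (cases "1 \<le> h \<and> g (q h + 1) \<le> g (q h)")
    case True
    then have M: "M = g (q h)" by (simp add: M_def)
    have s: "g (q h) + 1 = g (q h + 1) + s" using True by (simp add: s_def overlap_def Let_def)
    note gd = gaplessD[OF g _ h _ s]
    have s1: "1 \<le> s" using s True by simp
    have gs: "g (q h + s) = M" using gd(2)[of s] True s1 M by simp
    have "M < g i" if "q h + s < i" "i \<le> q (Suc h)" for i
      using strict_mono_onD[OF sm, of "q h + s" i] that gs s1 by auto
    moreover have "q h + s \<le> M" using s up'[of "q h + 1"] q M by simp
    ultimately show ?thesis using gd True M by auto
  next
    case False
    then have s: "s = 0" by (auto simp: s_def overlap_def Let_def)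
    have "M < g i" if i: "q h < i" "i \<le> q (Suc h)" for i
    proof -
      have "M < g (q h + 1)" using False up'[of "q h + 1"] q by (auto simp: M_def)
      then show ?thesis using upper_increasing_gap[OF ui h, of "q h + 1" i] i by auto
    qed
    moreover have "q h \<le> M" using up'[of "q h"] q_less[of 0 h] h q by (auto simp: M_def)
    ultimately show ?thesis using s q by auto
  qed
  have sub: "strict_mono_on {q h + s<..q (Suc h)} g"
    using sm by (rule monotone_on_subset) auto
  have cardC: "card ({1..M} - init p h) = M - q h"
    using AM A(1) by (simp add: card_Diff_subset)
  have hi: "p i = g i" if "q h + s < i" "i \<le> q (Suc h)" for i
    using gapless_perm_carrel[OF h, of i g] that by (simp add: p_def s_def)
  have lo: "p i = nth_least ({1..M} - init p h) (M - q h - (q h + s - i))"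
    if i: "q h < i" "i \<le> q h + s" for i
  proof -
    have "s = 0" if "h = 0" using that by (simp add: s_def overlap_def)
    then have "h \<noteq> 0" using i by auto
    then have "p i = rank_desc (q h + s - i + 1) ({1..M} - init p h)"
      using gapless_perm_carrel[OF h, of i g] i * by (simp add: p_def s_def M_def init_set_def)
    also have "\<dots> = nth_least ({1..M} - init p h) (M - q h - (q h + s - i + 1) + 1)"
      using i * cardC by (subst rank_desc_eq_nth_least) auto
    also have "M - q h - (q h + s - i + 1) + 1 = M - q h - (q h + s - i)" using i * by auto
    finally show ?thesis .
  qed
  note ext = carrel_extension[OF AM A(1) _ q(1) _ sub _ _ hi lo, folded init_Suc[OF h]]
  show "strict_mono_on {q h<..q (Suc h)} p" by (rule ext(1)) (use * in auto)
  show "card (init p (Suc h)) = q (Suc h)" by (rule ext(3)) (use * in auto)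
  show "init p (Suc h) \<subseteq> {1..g (q (Suc h))}" by (rule ext(4)) (use * in auto)
  show "fills_gaps (init p h) (init p (Suc h))" by (rule ext(5)) (use * in auto)
  show "nth_least (init p (Suc h)) i = g i" if "q h < i" "i \<le> q (Suc h)" for i
    by (rule ext(6)) (use * that in auto)
qed

lemma gapless_perm_init:
  fixes g :: tuple
  defines "p \<equiv> gapless_perm n R g"
  assumes g: "g \<in> gapless_tuples n R" and h: "h \<le> Suc r"
  shows "card (init p h) = q h \<and> (1 \<le> h \<longrightarrow> init p h \<subseteq> {1..g (q h)})"
  using h
proof (induction h)
  case (Suc h)
  then show ?case using gapless_perm_step[OF g, of h, folded p_def] by auto
qed (simp add: init_set_def)

lemma gapless_perm_avoiding:
  assumes g: "g \<in> gapless_tuples n R"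
  shows "gapless_perm n R g \<in> R_312_avoiding n R"
    and "rank_tuple n R (gapless_perm n R g) = g"
proof -
  let ?p = "gapless_perm n R g"
  note I = gapless_perm_init[OF g]
  have step: "card (init ?p h) = q h" "1 \<le> h \<Longrightarrow> init ?p h \<subseteq> {1..g (q h)}" if "h \<le> r" for h
    using I[of h] that by auto
  \<comment> \<open>The last initial set has \<open>n\<close> elements in \<open>{1..g n}\<close>;
    this bound makes it \<open>{1..n}\<close>, so the recursion yields a bijection.\<close>
  have "g n \<le> n" using gapless_upper[OF g] n_pos by (auto simp: upper_tuples_def)
  then have "?p ` {1..n} \<subseteq> {1..n}" "card (?p ` {1..n}) = n"
    using I[of "Suc r"] by (auto simp: init_set_def)
  then have "bij_betw ?p {1..n} {1..n}"
    by (auto simp: bij_betw_def card_subset_eq intro: eq_card_imp_inj_on)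
  then have perm: "?p permutes {1..n}"
    by (rule bij_imp_permutes) (simp add: gapless_perm_def perm_upto_outside del: perm_upto.simps)
  show "?p \<in> R_312_avoiding n R"
    unfolding avoiding_iff R_perms_iff using perm gapless_perm_step(1,4)[OF g _ step] by auto
  show "rank_tuple n R ?p = g"
  proof (rule upper_tuples_eqI)
    show "rank_tuple n R ?p \<in> upper_tuples n"
      using rank_tuple_upper_increasing[OF perm] by (simp add: upper_increasing_iff)
    fix i assume "1 \<le> i" "i \<le> n"
    then obtain h where h: "h \<le> r" "q h < i" "i \<le> q (Suc h)" using carrel_obtain by blast
    then show "rank_tuple n R ?p i = g i"
      using rank_tuple_eq[OF perm h] gapless_perm_step(5)[OF g h(1) step] by auto
  qed (rule gapless_upper[OF g])
qed

end

section \<open>Earliest weakly increasing subsequences\<close>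

lemma set_ewis_subset: "set (ewis f xs) \<subseteq> set xs"
  by (induction f xs rule: ewis.induct) (auto dest: set_dropWhileD)

lemma ewis_eq_Nil_iff [simp]: "ewis f xs = [] \<longleftrightarrow> xs = []"
  by (cases xs) auto

lemma ewis_hd_le: "y \<in> set (ewis f xs) \<Longrightarrow> f (hd xs) \<le> f y"
proof (induction f xs rule: ewis.induct)
  case (2 f x xs)
  define zs where "zs = dropWhile (\<lambda>y. f y < f x) xs"
  show ?case
  proof (cases "y = x")
    case False
    then have y: "y \<in> set (ewis f zs)" using "2.prems" by (simp add: zs_def)
    then have "zs \<noteq> []" by auto
    then have "f x \<le> f (hd zs)" using hd_dropWhile[of "\<lambda>y. f y < f x" xs] by (simp add: zs_def)
    then show ?thesis using "2.IH"[folded zs_def, OF y] by simp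
  qed simp
qed simp

text \<open>An element is skipped only if it is strictly below the current value, and values never
  decrease along the subsequence. The strict part later makes scanned columns strictly
  increasing.\<close>

lemma ewis_last_ge:
  "y \<in> set xs \<Longrightarrow> f y \<le> f (last (ewis f xs)) \<and> (y \<notin> set (ewis f xs) \<longrightarrow> f y < f (last (ewis f xs)))"
proof (induction f xs rule: ewis.induct)
  case (2 f x xs)
  define zs where "zs = dropWhile (\<lambda>y. f y < f x) xs"
  have e: "ewis f (x # xs) = x # ewis f zs" by (simp add: zs_def)
  have x_le: "f x \<le> f (last (x # ewis f zs))"
    using ewis_hd_le[of "last (x # ewis f zs)" f "x # xs"] unfolding e by (simp add: last_in_set)
  have "y = x \<or> (y \<in> set xs \<and> f y < f x) \<or> y \<in> set zs"
    using 2(2) takeWhile_dropWhile_id[of "\<lambda>y. f y < f x" xs] set_takeWhileD[of y "\<lambda>y. f y < f x" xs]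
    unfolding zs_def by (metis Un_iff set_append set_ConsD)
  then consider "y = x" | "f y < f x" | "y \<in> set zs" by blast
  then show ?case
  proof cases
    case 3
    then have "zs \<noteq> []" by auto
    then show ?thesis using 2(1)[folded zs_def, OF 3] unfolding e by simp
  qed (use x_le e in auto)
qed simp

text \<open>Serves to keep the unmarked boxes a partition shape: when a box is marked, a right
  neighbour of the same height is marked with it.\<close>

lemma ewis_adjacent:
  assumes "x \<in> set (ewis f (as @ x # y # bs))" "distinct (as @ x # y # bs)" "f x \<le> f y"
  shows "y \<in> set (ewis f (as @ x # y # bs))"
  using assms
proof (induction "length as" arbitrary: as rule: less_induct)
  case less
  show ?case
  proof (cases as)
    case Nil
    then show ?thesis using less.prems by simp
  next
    case (Cons a as')
    let ?P = "\<lambda>z. f z < f a"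
    have "x \<noteq> a" using less.prems Cons by auto
    then have x: "x \<in> set (ewis f (dropWhile ?P (as' @ x # y # bs)))"
      using less.prems Cons by simp
    then have "x \<in> set (dropWhile ?P (as' @ x # y # bs))" using set_ewis_subset by fast
    moreover have "x \<notin> set (y # bs)" using less.prems by auto
    ultimately have "\<not> ?P x" if "\<forall>z\<in>set as'. ?P z"
      using that set_dropWhileD[of x ?P "y # bs"] dropWhile_append2[of as' ?P "x # y # bs"]
      by (auto split: if_splits)
    \<comment> \<open>As \<open>x\<close> is taken, dropping stops no later than at
      \<open>x\<close>, so the list keeps its form with a shorter prefix.\<close>
    then have d: "dropWhile ?P (as' @ x # y # bs) = dropWhile ?P as' @ x # y # bs"
      by (cases "\<forall>z\<in>set as'. ?P z") (auto simp: dropWhile_append2 dropWhile_append1)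
    have "y \<in> set (ewis f (dropWhile ?P as' @ x # y # bs))"
    proof (rule less.hyps)
      show "length (dropWhile ?P as') < length as"
        using length_dropWhile_le[of ?P as'] Cons by simp
      have "distinct (dropWhile ?P as')" using less.prems Cons by (simp add: distinct_dropWhile)
      then show "distinct (dropWhile ?P as' @ x # y # bs)"
        using less.prems(2) Cons set_dropWhileD[of _ ?P as'] by auto
    qed (use x d less.prems in auto)
    then show ?thesis using Cons d by simp
  qed
qed


section \<open>Shapes and scanning\<close>

locale partition =
  fixes n :: nat and lam :: "nat \<Rightarrow> nat"
  assumes n_ge_1: "1 \<le> n" and part: "is_partition n lam"
begin

abbreviation len :: "nat \<Rightarrow> nat" where "len \<equiv> col_len n lam"

lemma lam_antimono: "1 \<le> i \<Longrightarrow> i \<le> k \<Longrightarrow> k \<le> n \<Longrightarrow> lam k \<le> lam i"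
  using part by (auto simp: is_partition_def monotone_on_def)

lemma le_len_iff:
  assumes "1 \<le> i" "i \<le> n" shows "i \<le> len j \<longleftrightarrow> j \<le> lam i"
proof
  assume "j \<le> lam i"
  then have "{1..i} \<subseteq> {k \<in> {1..n}. j \<le> lam k}"
    using lam_antimono[of _ i] assms by (auto intro: order_trans)
  then show "i \<le> len j"
    unfolding col_len_def using card_mono[of "{k \<in> {1..n}. j \<le> lam k}" "{1..i}"] by simp
next
  assume i: "i \<le> len j"
  show "j \<le> lam i"
  proof (rule ccontr)
    assume "\<not> j \<le> lam i"
    then have "{k \<in> {1..n}. j \<le> lam k} \<subseteq> {1..<i}"
      using lam_antimono[of i] assms by (fastforce simp: not_le)
    then have "len j \<le> i - 1" unfolding col_len_def using card_mono[of "{1..<i}"] by fastforce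
    then show False using i assms by simp
  qed
qed

lemma len_le_n: "len j \<le> n"
  unfolding col_len_def by (rule order.trans[OF card_mono[of "{1..n}"]]) auto

lemma len_antimono: "j \<le> k \<Longrightarrow> len k \<le> len j"
  unfolding col_len_def by (intro card_mono) auto

lemma len_pos: "j \<le> lam 1 \<Longrightarrow> 1 \<le> len j"
  using le_len_iff[of 1 j] n_ge_1 by simp

lemma shape_iff: "(j, i) \<in> shape n lam \<longleftrightarrow> 1 \<le> j \<and> j \<le> lam 1 \<and> 1 \<le> i \<and> i \<le> len j"
  by (simp add: shape_def)

lemma tableau_row:
  assumes "T \<in> tableaux n lam" "1 \<le> j" "j < lam 1" "1 \<le> i" "i \<le> len (j + 1)"
  shows "T (j, i) \<le> T (j + 1, i)"
  using assms len_antimono[of j "j + 1"] by (auto simp: tableaux_def shape_iff)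

lemma tableau_col_strict_mono:
  assumes "T \<in> tableaux n lam" "1 \<le> j" "j \<le> lam 1"
  shows "strict_mono_on {1..len j} (\<lambda>i. T (j, i))"
proof (rule strict_mono_onI)
  fix i k assume ik: "i \<in> {1..len j}" "k \<in> {1..len j}" "i < k"
  then have "Suc i \<le> k" by simp
  then show "T (j, i) < T (j, k)"
    using ik(2)
  proof (induction k rule: dec_induct)
    case base
    then show ?case using assms ik by (auto simp: tableaux_def shape_iff)
  next
    case (step m)
    then have "T (j, m) < T (j, m + 1)" using assms ik by (auto simp: tableaux_def shape_iff)
    then show ?case using step by auto
  qed
qed

lemma tableau_col_less:
  assumes "T \<in> tableaux n lam" "1 \<le> j" "j \<le> lam 1" "1 \<le> i" "i < k" "k \<le> len j"
  shows "T (j, i) < T (j, k)"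
  using strict_mono_onD[OF tableau_col_strict_mono[OF assms(1-3)], of i k] assms by simp

end

text \<open>During the scan of column \<open>j\<close> the unmarked boxes always form a partition shape; this is the
  length of its column \<open>k\<close> after \<open>m\<close> rounds.\<close>

primrec height :: "nat \<Rightarrow> (nat \<Rightarrow> nat) \<Rightarrow> tableau \<Rightarrow> nat \<Rightarrow> nat \<Rightarrow> nat \<Rightarrow> nat" where
  "height n lam T j 0 k = col_len n lam k"
| "height n lam T j (Suc m) k = height n lam T j m k -
     (if (k, height n lam T j m k) \<in> set (scan_path lam T j (unmarked n lam T j m)) then 1 else 0)"

locale scan = partition +
  fixes T :: tableau and j :: nat
  assumes tab: "T \<in> tableaux n lam" and j_ge: "1 \<le> j" and j_le: "j \<le> lam 1"
begin

abbreviation ht :: "nat \<Rightarrow> nat \<Rightarrow> nat" where "ht \<equiv> height n lam T j"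
abbreviation free :: "nat \<Rightarrow> box set" where "free \<equiv> unmarked n lam T j"
abbreviation lowest :: "nat \<Rightarrow> box list" where "lowest m \<equiv> lowest_boxes lam j (free m)"
abbreviation path :: "nat \<Rightarrow> box list" where "path m \<equiv> scan_path lam T j (free m)"

lemma ht_le: "ht m k \<le> len k"
  by (induction m) (auto simp: le_diff_conv)

text \<open>The scan invariant. By its last clause column \<open>j\<close> loses a box in each round
  until it is empty, which matches rounds with rows of the scanned column.\<close>

definition regular :: "nat \<Rightarrow> bool" where
  "regular m \<longleftrightarrow> (\<forall>k i. (k, i) \<in> free m \<longleftrightarrow> j \<le> k \<and> k \<le> lam 1 \<and> 1 \<le> i \<and> i \<le> ht m k) \<and>
     (\<forall>k. j \<le> k \<and> k < lam 1 \<longrightarrow> ht m (k + 1) \<le> ht m k) \<and> ht m j = len j - m"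

lemma regular_lowest:
  assumes "regular m"
  shows "lowest m = map (\<lambda>k. (k, ht m k)) (filter (\<lambda>k. 1 \<le> ht m k) [j..<lam 1 + 1])"
proof -
  have free: "(k, i) \<in> free m \<longleftrightarrow> 1 \<le> i \<and> i \<le> ht m k" if "k \<in> set [j..<lam 1 + 1]" for k i
    using assms that unfolding regular_def by auto
  have "filter (\<lambda>k. \<exists>i. (k, i) \<in> free m) [j..<lam 1 + 1] = filter (\<lambda>k. 1 \<le> ht m k) [j..<lam 1 + 1]"
    by (rule filter_cong[OF refl]) (auto simp: free)
  moreover have "Max {i. (k, i) \<in> free m} = ht m k"
    if "k \<in> set (filter (\<lambda>k. 1 \<le> ht m k) [j..<lam 1 + 1])" for k
  proof -
    have "{i. (k, i) \<in> free m} = {1..ht m k}" using that by (auto simp: free)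
    moreover have "Max {1..ht m k} = ht m k" by (rule Max_eqI) (use that in auto)
    ultimately show ?thesis by simp
  qed
  ultimately show ?thesis unfolding lowest_boxes_def by simp
qed

lemma set_lowest:
  assumes "regular m"
  shows "(k, i) \<in> set (lowest m) \<longleftrightarrow> j \<le> k \<and> k \<le> lam 1 \<and> i = ht m k \<and> 1 \<le> i"
  using regular_lowest[OF assms] by auto

lemma path_subset: "set (path m) \<subseteq> set (lowest m)"
  unfolding scan_path_def by (rule set_ewis_subset)

lemma regular_Suc:
  assumes reg: "regular m" shows "regular (Suc m)"
  unfolding regular_def
proof (intro conjI allI impI)
  fix k i
  have path: "(k, i) \<in> set (path m) \<longleftrightarrow> i = ht m k \<and> (k, ht m k) \<in> set (path m)"
    using path_subset[of m] set_lowest[OF reg, of k i] by auto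
  have pos: "(k, ht m k) \<in> set (path m) \<Longrightarrow> 1 \<le> ht m k"
    using path_subset[of m] set_lowest[OF reg, of k "ht m k"] by auto
  have "(k, i) \<in> free (Suc m) \<longleftrightarrow> (k, i) \<in> free m \<and> (k, i) \<notin> set (path m)" by simp
  then show "(k, i) \<in> free (Suc m) \<longleftrightarrow> j \<le> k \<and> k \<le> lam 1 \<and> 1 \<le> i \<and> i \<le> ht (Suc m) k"
    using reg path pos unfolding regular_def by (cases "(k, ht m k) \<in> set (path m)") auto
next
  fix k assume k: "j \<le> k \<and> k < lam 1"
  then have le: "ht m (k + 1) \<le> ht m k" using reg unfolding regular_def by blast
  \<comment> \<open>Only columns of equal height could break the shape. Their lowest boxes are
    neighbours in one row, so the right entry is at least the left one and is taken too.\<close>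
  have "(k + 1, ht m (k + 1)) \<in> set (path m)"
    if mem: "(k, ht m k) \<in> set (path m)" and eq: "ht m (k + 1) = ht m k"
  proof -
    have pos: "1 \<le> ht m k" using mem path_subset[of m] set_lowest[OF reg, of k "ht m k"] by auto
    have "[j..<lam 1 + 1] = [j..<k] @ k # (k + 1) # [k + 2..<lam 1 + 1]"
      using k upt_add_eq_append[of j k "lam 1 + 1 - k"] by (simp add: upt_conv_Cons del: upt_Suc)
    then have low: "lowest m = map (\<lambda>k. (k, ht m k)) (filter (\<lambda>k. 1 \<le> ht m k) [j..<k])
        @ (k, ht m k) # (k + 1, ht m (k + 1))
        # map (\<lambda>k. (k, ht m k)) (filter (\<lambda>k. 1 \<le> ht m k) [k + 2..<lam 1 + 1])"
      using pos eq by (simp add: regular_lowest[OF reg] del: upt_Suc)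
    have "distinct (lowest m)"
      unfolding regular_lowest[OF reg] by (simp add: distinct_map inj_on_def)
    moreover have "T (k, ht m k) \<le> T (k + 1, ht m (k + 1))"
      using tableau_row[OF tab, of k "ht m k"] k j_ge pos eq ht_le[of m "k + 1"] by simp
    ultimately show ?thesis
      using mem ewis_adjacent[of "(k, ht m k)" T _ "(k + 1, ht m (k + 1))"]
      unfolding scan_path_def low by blast
  qed
  then show "ht (Suc m) (k + 1) \<le> ht (Suc m) k"
    using le by (cases "ht m (k + 1) = ht m k") auto
next
  have j: "ht m j = len j - m" using reg unfolding regular_def by blast
  have "(j, ht m j) \<in> set (path m)" if "1 \<le> ht m j"
  proof -
    have "lowest m = (j, ht m j) # tl (lowest m)"
      using that j_le by (simp add: regular_lowest[OF reg] upt_conv_Cons del: upt_Suc)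
    then have "path m = (j, ht m j) # tl (path m)"
      unfolding scan_path_def by (metis ewis.simps(2) list.sel(3))
    then show ?thesis by (metis list.set_intros(1))
  qed
  then show "ht (Suc m) j = len j - Suc m" using j by (cases "1 \<le> ht m j") auto
qed

lemma regular: "regular m"
proof (induction m)
  case 0
  show ?case unfolding regular_def using j_ge len_antimono by (auto simp: shape_iff)
qed (rule regular_Suc)

lemma ht_j: "ht m j = len j - m"
  using regular unfolding regular_def by blast

lemma ht_antimono:
  assumes "j \<le> k" "k \<le> k'" "k' \<le> lam 1" shows "ht m k' \<le> ht m k"
  using assms(2,3)
proof (induction k' rule: dec_induct)
  case (step l)
  then have "ht m (l + 1) \<le> ht m l" using assms(1) regular[of m] unfolding regular_def by auto
  then show ?case using step by auto
qed simp

lemma lowest_eq_Cons: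
  assumes "m < len j" obtains xs where "lowest m = (j, len j - m) # xs"
proof -
  have "1 \<le> ht m j" using assms by (simp add: ht_j)
  then have "lowest m = (j, ht m j) # tl (lowest m)"
    using j_le by (simp add: regular_lowest[OF regular] upt_conv_Cons del: upt_Suc)
  then show thesis unfolding ht_j by (rule that)
qed

section \<open>Values produced by the rounds of a scan\<close>

definition round_val :: "nat \<Rightarrow> nat" where
  "round_val m = T (last (path m))"

lemma round_val_ge:
  assumes "j \<le> k" "k \<le> lam 1" "1 \<le> ht m k"
  shows "T (k, ht m k) \<le> round_val m"
    and "(k, ht m k) \<notin> set (path m) \<Longrightarrow> T (k, ht m k) < round_val m"
  using ewis_last_ge[of "(k, ht m k)" "lowest m" T] assms set_lowest[OF regular, of k "ht m k" m]
  unfolding round_val_def scan_path_def by auto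

lemma round_val_obtain:
  assumes "m < len j"
  obtains k where "j \<le> k" "k \<le> lam 1" "1 \<le> ht m k" "round_val m = T (k, ht m k)"
proof -
  obtain xs where "lowest m = (j, len j - m) # xs" using lowest_eq_Cons[OF assms] .
  then have "path m \<noteq> []" unfolding scan_path_def by simp
  then have "last (path m) \<in> set (lowest m)" using path_subset[of m] last_in_set[of "path m"] by blast
  moreover obtain k i where "last (path m) = (k, i)" by fastforce
  ultimately show thesis using that[of k] set_lowest[OF regular, of k i m] by (auto simp: round_val_def)
qed

lemma scanning_tableau_eq:
  "1 \<le> i \<Longrightarrow> i \<le> len j \<Longrightarrow> scanning_tableau n lam T (j, i) = round_val (len j - i)"
  using j_ge j_le by (simp add: scanning_tableau_def shape_iff round_val_def)

lemma scanning_tableau_ge: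
  assumes "1 \<le> i" "i \<le> len j" shows "T (j, i) \<le> scanning_tableau n lam T (j, i)"
  using round_val_ge(1)[of j "len j - i"] assms j_le by (simp add: scanning_tableau_eq ht_j)

text \<open>The box giving the next value either lies directly above a box marked in this round, or
  was already available and was passed over; both make its entry strictly smaller.\<close>

lemma round_val_Suc_less:
  assumes "Suc m < len j" shows "round_val (Suc m) < round_val m"
proof -
  obtain k where k: "j \<le> k" "k \<le> lam 1" "1 \<le> ht (Suc m) k" "round_val (Suc m) = T (k, ht (Suc m) k)"
    using round_val_obtain[OF assms] .
  show ?thesis
  proof (cases "(k, ht m k) \<in> set (path m)")
    case True
    then have eq: "ht m k = ht (Suc m) k + 1" using k(3) by simp
    have "ht (Suc m) k + 1 \<le> len k" using ht_le[of m k] unfolding eq .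
    then have "T (k, ht (Suc m) k) < T (k, ht (Suc m) k + 1)"
      using k j_ge by (intro tableau_col_less[OF tab]) auto
    also have "\<dots> \<le> round_val m"
      using round_val_ge(1)[of k m] k(1,2) unfolding eq by simp
    finally show ?thesis unfolding k(4) .
  next
    case False
    then show ?thesis using round_val_ge(2)[of k m] k by simp
  qed
qed

lemma scanning_tableau_strict_mono:
  "strict_mono_on {1..len j} (\<lambda>i. scanning_tableau n lam T (j, i))"
proof (rule strict_mono_onI)
  fix i k assume ik: "i \<in> {1..len j}" "k \<in> {1..len j}" "i < k"
  then have "Suc i \<le> k" by simp
  then show "scanning_tableau n lam T (j, i) < scanning_tableau n lam T (j, k)"
    using ik(2)
  proof (induction k rule: dec_induct)
    case base
    then show ?case using ik round_val_Suc_less[of "len j - Suc i"]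
      by (simp add: scanning_tableau_eq Suc_diff_Suc)
  next
    case (step l)
    then show ?case using ik round_val_Suc_less[of "len j - Suc l"]
      by (simp add: scanning_tableau_eq Suc_diff_Suc)
  qed
qed

lemma scanning_tableau_le_flag:
  assumes f: "mono_on {1..n} f" and T: "T \<in> row_bound_set n lam f" and i: "1 \<le> i" "i \<le> len j"
  shows "scanning_tableau n lam T (j, i) \<le> f i"
proof -
  let ?m = "len j - i"
  obtain k where k: "j \<le> k" "k \<le> lam 1" "1 \<le> ht ?m k" "round_val ?m = T (k, ht ?m k)"
    using round_val_obtain[of ?m] i by auto
  have "ht ?m k \<le> i" using ht_antimono[of j k ?m] ht_j[of ?m] k i by simp
  then have "f (ht ?m k) \<le> f i" using k i len_le_n[of j] by (intro mono_onD[OF f]) auto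
  moreover have "T (k, ht ?m k) \<le> f (ht ?m k)"
    using T k ht_le[of ?m k] j_ge by (auto simp: row_bound_set_def shape_iff)
  ultimately show ?thesis using k i by (simp add: scanning_tableau_eq)
qed

section \<open>Scans over a tail of nested columns\<close>

context
  fixes a :: nat
  assumes a: "a = j \<or> a = j + 1" "a \<le> lam 1"
    and nested: "\<And>k i. a \<le> k \<Longrightarrow> k \<le> lam 1 \<Longrightarrow> 1 \<le> i \<Longrightarrow> i \<le> len k \<Longrightarrow>
      \<exists>i'. 1 \<le> i' \<and> i' \<le> len a \<and> T (k, i) = T (a, i')"
begin

text \<open>The lowest free box of column \<open>a\<close> holds the maximum of the free entries
  from column \<open>a\<close> on. The case \<open>a = j\<close> shows that scanning fixes a key;
  \<open>a = j + 1\<close> traces the entries of the tableau built from a 312-pattern.\<close>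

definition dominated :: "nat \<Rightarrow> bool" where
  "dominated m \<longleftrightarrow> (\<forall>k i. a \<le> k \<and> k \<le> lam 1 \<and> 1 \<le> i \<and> i \<le> ht m k \<longrightarrow> T (k, i) \<le> T (a, ht m a))"

lemma round_val_tail:
  assumes dom: "dominated m" and mem: "(a, ht m a) \<in> set (path m)"
  shows "round_val m = T (a, ht m a)"
proof -
  have low: "a \<le> lam 1" "1 \<le> ht m a"
    using mem path_subset[of m] set_lowest[OF regular, of a "ht m a" m] by auto
  then have "1 \<le> ht m j" using ht_antimono[of j a m] a by auto
  then have m: "m < len j" using ht_j[of m] by simp
  obtain xs where xs: "lowest m = (j, len j - m) # xs" using lowest_eq_Cons[OF m] .
  obtain k where k: "j \<le> k" "k \<le> lam 1" "1 \<le> ht m k" "round_val m = T (k, ht m k)"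
    using round_val_obtain[OF m] .
  have "T (k, ht m k) \<le> T (a, ht m a)"
  proof (cases "a \<le> k")
    case True
    then show ?thesis using dom k unfolding dominated_def by blast
  next
    case False
    \<comment> \<open>Here \<open>a = j + 1\<close>. The subsequence starts with column
      \<open>j\<close>, so its member in column \<open>a\<close> is at least as large.\<close>
    then have "k = j" using a k by auto
    then show ?thesis
      using ewis_hd_le[of "(a, ht m a)" T "lowest m"] mem xs
      unfolding scan_path_def by (simp add: ht_j)
  qed
  then show ?thesis using k round_val_ge(1)[of a m] low a by auto
qed

text \<open>When column \<open>a\<close> loses its lowest box, that entry is the value of the round,
  and every remaining tail entry is strictly smaller. By nesting the latter occurs in column
  \<open>a\<close>, hence above the lost box, and is at most the new lowest entry.\<close>

lemma dominated: "dominated m"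
proof (induction m)
  case 0
  show ?case unfolding dominated_def
  proof (intro allI impI)
    fix k i assume k: "a \<le> k \<and> k \<le> lam 1 \<and> 1 \<le> i \<and> i \<le> ht 0 k"
    then obtain i' where i': "1 \<le> i'" "i' \<le> len a" "T (k, i) = T (a, i')" using nested[of k i] by auto
    then show "T (k, i) \<le> T (a, ht 0 a)"
      using tableau_col_less[OF tab, of a i' "len a"] a j_ge by (cases "i' = len a") auto
  qed
next
  case (Suc m)
  show ?case
  proof (cases "(a, ht m a) \<in> set (path m)")
    case False
    then have "ht (Suc m) a = ht m a" by simp
    moreover have "ht (Suc m) k \<le> ht m k" for k by simp
    ultimately show ?thesis
      using Suc unfolding dominated_def by (metis order_trans)
  next
    case True
    note val = round_val_tail[OF Suc True]
    show ?thesis unfolding dominated_def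
    proof (intro allI impI)
      fix k i assume k: "a \<le> k \<and> k \<le> lam 1 \<and> 1 \<le> i \<and> i \<le> ht (Suc m) k"
      have ik: "i \<le> ht m k" using k by (auto split: if_splits)
      then have ilen: "i \<le> len k" using ht_le[of m k] by simp
      have jk: "j \<le> k" using a k by auto
      have "T (k, i) < T (a, ht m a)"
      proof (cases "i = ht m k")
        case True
        then have "(k, ht m k) \<notin> set (path m)" using k by auto
        then show ?thesis using round_val_ge(2)[of k m] k jk True val by auto
      next
        case False
        then have "T (k, i) < T (k, ht m k)"
          using tableau_col_less[OF tab, of k i "ht m k"] k jk j_ge ik ht_le[of m k] by auto
        moreover have "T (k, ht m k) \<le> T (a, ht m a)"
          using Suc k ik unfolding dominated_def by (meson order_trans order_refl)
        ultimately show ?thesis by simp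
      qed
      moreover obtain i' where i': "1 \<le> i'" "i' \<le> len a" "T (k, i) = T (a, i')"
        using nested[of k i] k ilen by auto
      ultimately have lt: "T (a, i') < T (a, ht m a)" by simp
      have "T (a, ht m a) \<le> T (a, i')" if "ht m a \<le> i'"
        using tableau_col_less[OF tab, of a "ht m a" i'] that i' a j_ge True path_subset[of m]
          set_lowest[OF regular, of a "ht m a" m] by (cases "ht m a = i'") auto
      then have "i' < ht m a" using lt by (cases "i' < ht m a") auto
      then have "i' \<le> ht (Suc m) a" using True by simp
      then show "T (k, i) \<le> T (a, ht (Suc m) a)"
        using i' tableau_col_less[OF tab, of a i' "ht (Suc m) a"] ht_le[of "Suc m" a] a j_ge
        by (cases "i' = ht (Suc m) a") auto
    qed
  qed
qed

text \<open>Column \<open>a\<close> is empty after \<open>len j\<close> rounds and loses at most one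
  box in each, so every box of it is marked in some round; its entry is then the value of that
  round.\<close>

lemma tail_entry_in_scanned_column:
  assumes i: "1 \<le> i" "i \<le> len a"
  obtains k where "1 \<le> k" "k \<le> len j" "scanning_tableau n lam T (j, k) = T (a, i)"
proof -
  have ja: "j \<le> a" using a by auto
  have 0: "ht (len j) a = 0" using ht_antimono[of j a "len j"] ht_j[of "len j"] a ja by simp
  have "\<exists>m<len j. ht m a = i \<and> ht (Suc m) a \<noteq> ht m a"
  proof (rule ccontr)
    assume none: "\<not> ?thesis"
    have "i \<le> ht m a" if "m \<le> len j" for m
      using that
    proof (induction m)
      case (Suc m)
      then have *: "i \<le> ht m a" "ht (Suc m) a = ht m a \<or> ht m a \<noteq> i" using none by auto
      have "ht m a - 1 \<le> ht (Suc m) a" by simp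
      then show ?case using * by linarith
    qed (use i in simp)
    then show False using 0 i by force
  qed
  then obtain m where m: "m < len j" "ht m a = i" "ht (Suc m) a \<noteq> ht m a" by blast
  then have "(a, ht m a) \<in> set (path m)" by (auto split: if_splits)
  then have "round_val m = T (a, i)" using round_val_tail[OF dominated] m by simp
  then show thesis using m by (intro that[of "len j - m"]) (auto simp: scanning_tableau_eq)
qed

end

lemma scanning_tableau_nested_column:
  assumes nested: "\<And>k i. j \<le> k \<Longrightarrow> k \<le> lam 1 \<Longrightarrow> 1 \<le> i \<Longrightarrow> i \<le> len k \<Longrightarrow>
      \<exists>i'. 1 \<le> i' \<and> i' \<le> len j \<and> T (k, i) = T (j, i')"
    and i: "1 \<le> i" "i \<le> len j"
  shows "scanning_tableau n lam T (j, i) = T (j, i)"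
proof -
  let ?m = "len j - i"
  have ht: "ht ?m j = i" "ht (Suc ?m) j = i - 1" using i by (auto simp: ht_j simp del: height.simps)
  then have "(j, ht ?m j) \<in> set (path ?m)" using i by (auto split: if_splits)
  then have "round_val ?m = T (j, ht ?m j)"
    using dominated[of j ?m] round_val_tail[of j ?m] nested j_le by blast
  then show ?thesis using ht i by (simp add: scanning_tableau_eq)
qed

end

section \<open>Row bound sets\<close>

context partition
begin

abbreviation R :: "nat set" where "R \<equiv> short_col_lens n lam"

end

sublocale partition \<subseteq> carrels n "short_col_lens n lam"
proof
  show "1 \<le> n" by (rule n_ge_1)
  show "short_col_lens n lam \<subseteq> {1..<n}" using len_pos by (auto simp: short_col_lens_def)
qed

context partition
begin

lemma len_obtain_q:
  assumes "1 \<le> j" "j \<le> lam 1"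
  obtains h where "1 \<le> h" "h \<le> Suc r" "len j = q h"
proof (cases "len j = n")
  case True
  then show thesis using that[of "Suc r"] by simp
next
  case False
  then have "len j \<in> R" using assms len_le_n[of j] by (auto simp: short_col_lens_def)
  then show thesis using that R_obtain_q by (metis le_SucI)
qed

lemma q_obtain_len:
  assumes "1 \<le> h" "h \<le> r"
  obtains j where "1 \<le> j" "j \<le> lam 1" "len j = q h"
  using q_in_R[OF assms] that by (auto simp: short_col_lens_def)

text \<open>Column lengths are carrel ends, so each column is a union of whole carrels and sees
  every bound that enters the core there.\<close>

lemma carrel_le_len:
  assumes "1 \<le> j" "j \<le> lam 1" "h \<le> r" "q h < i" "i \<le> len j"
  shows "q (Suc h) \<le> len j"
proof -
  obtain k where k: "1 \<le> k" "k \<le> Suc r" "len j = q k" using len_obtain_q[OF assms(1,2)] .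
  then have "Suc h \<le> k" using q_le[of k h] assms by (cases "k \<le> h") auto
  then show ?thesis using q_le[of "Suc h" k] k by simp
qed

text \<open>Stated for one increasing column because it is also applied to columns of scanning
  tableaux, for which no row condition is established.\<close>

lemma column_le_core:
  assumes b: "\<beta> \<in> upper_tuples n" and j: "1 \<le> j" "j \<le> lam 1"
    and c: "strict_mono_on {1..len j} c" "\<And>i. 1 \<le> i \<Longrightarrow> i \<le> len j \<Longrightarrow> c i \<le> \<beta> i"
    and i: "1 \<le> i" "i \<le> len j"
  shows "c i \<le> core n R \<beta> i"
proof -
  obtain h where h: "h \<le> r" "q h < i" "i \<le> q (Suc h)"
    using carrel_obtain[of i] i len_le_n[of j] by auto
  have le: "q (Suc h) \<le> len j" using carrel_le_len[OF j h(1,2) i(2)] .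
  show ?thesis
  proof (rule le_coreI[OF b h])
    fix z assume z: "i \<le> z" "z \<le> q (Suc h)"
    have "c i + (z - i) \<le> c z" by (rule strict_mono_on_gap[OF c(1)]) (use z le i in auto)
    then show "c i + (z - i) \<le> \<beta> z" using c(2)[of z] z le i by simp
  qed
qed

lemma row_bound_set_iff:
  "T \<in> row_bound_set n lam \<beta> \<longleftrightarrow>
     T \<in> tableaux n lam \<and> (\<forall>j i. 1 \<le> j \<and> j \<le> lam 1 \<and> 1 \<le> i \<and> i \<le> len j \<longrightarrow> T (j, i) \<le> \<beta> i)"
  by (auto simp: row_bound_set_def shape_iff)

lemma row_bound_set_core:
  assumes b: "\<beta> \<in> upper_tuples n"
  shows "row_bound_set n lam (core n R \<beta>) = row_bound_set n lam \<beta>"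
proof (intro equalityI subsetI)
  fix T assume T: "T \<in> row_bound_set n lam (core n R \<beta>)"
  have "core n R \<beta> i \<le> \<beta> i" if "1 \<le> i" "i \<le> len j" for i j
    using core_le[OF b, of i] that len_le_n[of j] by simp
  then show "T \<in> row_bound_set n lam \<beta>" using T unfolding row_bound_set_iff by (meson order_trans)
next
  fix T assume T: "T \<in> row_bound_set n lam \<beta>"
  then have tab: "T \<in> tableaux n lam" unfolding row_bound_set_iff by blast
  show "T \<in> row_bound_set n lam (core n R \<beta>)"
    unfolding row_bound_set_iff
  proof (intro conjI allI impI tab)
    fix j i assume *: "1 \<le> j \<and> j \<le> lam 1 \<and> 1 \<le> i \<and> i \<le> len j"
    then have "strict_mono_on {1..len j} (\<lambda>i. T (j, i))" using tableau_col_strict_mono[OF tab] by blast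
    then show "T (j, i) \<le> core n R \<beta> i"
      using column_le_core[OF b, of j "\<lambda>i. T (j, i)" i] T * unfolding row_bound_set_iff by blast
  qed
qed

text \<open>Each entry is the largest that the bounds from its row to the foot of the column allow
  under strict increase. Unlike in a core, the minimum crosses carrel boundaries.\<close>

definition top_tableau :: "tuple \<Rightarrow> tableau" where
  "top_tableau g = restrict (\<lambda>(j, i). Min ((\<lambda>z. g z - (z - i)) ` {i..len j})) (shape n lam)"

lemma top_tableau_eq:
  "1 \<le> j \<Longrightarrow> j \<le> lam 1 \<Longrightarrow> 1 \<le> i \<Longrightarrow> i \<le> len j \<Longrightarrow>
     top_tableau g (j, i) = Min ((\<lambda>z. g z - (z - i)) ` {i..len j})"
  by (simp add: top_tableau_def shape_iff)

lemma top_tableau_in_row_bound_set: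
  assumes g: "g \<in> upper_tuples n"
  shows "top_tableau g \<in> row_bound_set n lam g"
proof -
  have up: "z \<le> g z" "g z \<le> n" if "1 \<le> z" "z \<le> len j" for z j
    using g that len_le_n[of j] by (auto simp: upper_tuples_def)
  have le: "top_tableau g (j, i) \<le> g z - (z - i)"
    if "1 \<le> j" "j \<le> lam 1" "1 \<le> i" "i \<le> z" "z \<le> len j" for j i z
    using that by (subst top_tableau_eq) (auto intro!: Min_le)
  have att: "\<exists>z. i \<le> z \<and> z \<le> len j \<and> top_tableau g (j, i) = g z - (z - i)"
    if "1 \<le> j" "j \<le> lam 1" "1 \<le> i" "i \<le> len j" for j i
  proof -
    have "Min ((\<lambda>z. g z - (z - i)) ` {i..len j}) \<in> (\<lambda>z. g z - (z - i)) ` {i..len j}"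
      using that by (intro Min_in) auto
    then obtain z where "z \<in> {i..len j}" "Min ((\<lambda>z. g z - (z - i)) ` {i..len j}) = g z - (z - i)"
      by blast
    then show ?thesis unfolding top_tableau_eq[OF that] by (intro exI[of _ z]) simp
  qed
  have range: "1 \<le> top_tableau g (j, i) \<and> top_tableau g (j, i) \<le> n"
    if ji: "1 \<le> j" "j \<le> lam 1" "1 \<le> i" "i \<le> len j" for j i
  proof -
    obtain z where z: "i \<le> z" "z \<le> len j" "top_tableau g (j, i) = g z - (z - i)"
      using att[OF ji] by blast
    then have "z \<le> g z" "g z \<le> n" using up[of z j] ji by auto
    then show ?thesis using z ji by auto
  qed
  have col: "top_tableau g (j, i) < top_tableau g (j, i + 1)"
    if j: "1 \<le> j" "j \<le> lam 1" and i: "1 \<le> i" "i + 1 \<le> len j" for j i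
  proof -
    obtain z where z: "i + 1 \<le> z" "z \<le> len j" "top_tableau g (j, i + 1) = g z - (z - (i + 1))"
      using att[OF j, of "i + 1"] i by auto
    then have "top_tableau g (j, i) \<le> g z - (z - i)" using le[OF j i(1), of z] by simp
    moreover have "z \<le> g z" using up[of z j] z by simp
    ultimately show ?thesis using z i by linarith
  qed
  have row: "top_tableau g (j, i) \<le> top_tableau g (j + 1, i)"
    if j: "1 \<le> j" "j + 1 \<le> lam 1" and i: "1 \<le> i" "i \<le> len (j + 1)" for j i
  proof -
    obtain z where z: "i \<le> z" "z \<le> len (j + 1)" "top_tableau g (j + 1, i) = g z - (z - i)"
      using att[of "j + 1" i] i j by auto
    then show ?thesis using le[of j i z] j i len_antimono[of j "j + 1"] by auto
  qed
  have "top_tableau g \<in> tableaux n lam"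
    unfolding tableaux_def
  proof (intro CollectI conjI allI impI)
    show "top_tableau g \<in> shape n lam \<rightarrow>\<^sub>E {1..n}"
      using range by (auto simp: shape_iff PiE_iff extensional_def top_tableau_def)
  qed (use col row in \<open>auto simp: shape_iff\<close>)
  then show ?thesis unfolding row_bound_set_iff using le[of _ _ i for i] by fastforce
qed

text \<open>In a column ending with the carrel the minimum runs over this carrel alone and returns
  the tuple itself. This is how a row bound set determines its core.\<close>

lemma top_tableau_carrel:
  assumes g: "g \<in> upper_increasing n R" and j: "1 \<le> j" "j \<le> lam 1" "len j = q (Suc h)"
    and h: "h \<le> r" "q h < i" "i \<le> q (Suc h)"
  shows "top_tableau g (j, i) = g i"
proof -
  have "Min ((\<lambda>z. g z - (z - i)) ` {i..len j}) = g i"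
  proof (rule Min_eqI)
    fix y assume "y \<in> (\<lambda>z. g z - (z - i)) ` {i..len j}"
    then obtain z where "i \<le> z" "z \<le> q (Suc h)" "y = g z - (z - i)" using j by auto
    then show "g i \<le> y" using upper_increasing_gap[OF g h(1,2), of z] by simp
  qed (use h j in \<open>auto simp: image_iff intro!: bexI[of _ i]\<close>)
  then show ?thesis using j h by (subst top_tableau_eq) auto
qed

text \<open>No column need reach the last carrel, so tableaux cannot determine the core there.
  Instead it is forced: the line of slope one down from \<open>\<beta> n \<le> n\<close> meets the
  lower bound given by upperness.\<close>

lemma core_last_carrel:
  assumes b: "\<beta> \<in> upper_tuples n" and i: "q r < i" "i \<le> n"
  shows "core n R \<beta> i = i"
proof (rule antisym)
  have "\<beta> n \<le> n" using b n_ge_1 by (auto simp: upper_tuples_def)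
  then show "core n R \<beta> i \<le> i" using core_gap[OF b, of r i n] i by simp
  show "i \<le> core n R \<beta> i" using core_upper[OF b] i by (auto simp: upper_tuples_def)
qed

lemma core_le_of_row_bound_subset:
  assumes b: "\<beta> \<in> upper_tuples n" and b': "\<beta>' \<in> upper_tuples n"
    and sub: "row_bound_set n lam \<beta> \<subseteq> row_bound_set n lam \<beta>'" and i: "1 \<le> i" "i \<le> n"
  shows "core n R \<beta> i \<le> core n R \<beta>' i"
proof -
  obtain h where h: "h \<le> r" "q h < i" "i \<le> q (Suc h)" using carrel_obtain[OF i] .
  show ?thesis
  proof (cases "h = r")
    case True
    then show ?thesis using core_last_carrel[OF b, of i] core_last_carrel[OF b', of i] h i by simp
  next
    case False
    then obtain j where j: "1 \<le> j" "j \<le> lam 1" "len j = q (Suc h)"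
      using q_obtain_len[of "Suc h"] h(1) by auto
    have "top_tableau (core n R \<beta>) \<in> row_bound_set n lam (core n R \<beta>')"
      using top_tableau_in_row_bound_set[OF core_upper[OF b]] sub
      unfolding row_bound_set_core[OF b] row_bound_set_core[OF b'] by blast
    moreover have "i \<le> len j" using j h by simp
    ultimately have "top_tableau (core n R \<beta>) (j, i) \<le> core n R \<beta>' i"
      using j i unfolding row_bound_set_iff by blast
    then show ?thesis using top_tableau_carrel[OF core_upper_increasing[OF b] j h] by simp
  qed
qed

lemma row_bound_set_eq_imp_core_eq:
  assumes "\<beta> \<in> upper_tuples n" "\<beta>' \<in> upper_tuples n" "row_bound_set n lam \<beta> = row_bound_set n lam \<beta>'"
  shows "core n R \<beta> = core n R \<beta>'"
  using assms by (intro upper_tuples_eqI core_upper antisym core_le_of_row_bound_subset) auto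

lemma row_bound_set_floor_map:
  assumes g: "g \<in> gapless_tuples n R"
  shows "row_bound_set n lam (floor_map n R g) = row_bound_set n lam g"
  using row_bound_set_core[OF floor_map_upper[OF g]] core_floor_map[OF g] by simp


section \<open>Keys and Demazure sets\<close>

definition column_tableau :: "(nat \<Rightarrow> nat set) \<Rightarrow> tableau" where
  "column_tableau D = restrict (\<lambda>(j, i). nth_least (D j) i) (shape n lam)"

lemma column_tableau_eq:
  "1 \<le> j \<Longrightarrow> j \<le> lam 1 \<Longrightarrow> 1 \<le> i \<Longrightarrow> i \<le> len j \<Longrightarrow> column_tableau D (j, i) = nth_least (D j) i"
  by (simp add: column_tableau_def shape_iff)

lemma column_tableau_in_tableaux:
  assumes D: "\<And>j. 1 \<le> j \<Longrightarrow> j \<le> lam 1 \<Longrightarrow> D j \<subseteq> {1..n} \<and> card (D j) = len j"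
    and row: "\<And>j i. 1 \<le> j \<Longrightarrow> j + 1 \<le> lam 1 \<Longrightarrow> 1 \<le> i \<Longrightarrow> i \<le> len (j + 1) \<Longrightarrow>
                nth_least (D j) i \<le> nth_least (D (j + 1)) i"
  shows "column_tableau D \<in> tableaux n lam"
proof -
  have mem: "nth_least (D j) i \<in> {1..n}" if "1 \<le> j" "j \<le> lam 1" "1 \<le> i" "i \<le> len j" for j i
    using D[OF that(1,2)] nth_least_mem[of "D j" i] that finite_subset[of "D j" "{1..n}"] by auto
  show ?thesis
    unfolding tableaux_def
  proof (intro CollectI conjI allI impI)
    show "column_tableau D \<in> shape n lam \<rightarrow>\<^sub>E {1..n}"
      using mem by (auto simp: shape_iff PiE_iff extensional_def column_tableau_def)
  next
    fix j i assume "(j, i) \<in> shape n lam \<and> (j, i + 1) \<in> shape n lam"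
    then show "column_tableau D (j, i) < column_tableau D (j, i + 1)"
      using D[of j] by (auto simp: shape_iff column_tableau_eq intro!: nth_least_less)
  next
    fix j i assume "(j, i) \<in> shape n lam \<and> (j + 1, i) \<in> shape n lam"
    then show "column_tableau D (j, i) \<le> column_tableau D (j + 1, i)"
      using row[of j i] by (auto simp: shape_iff column_tableau_eq)
  qed
qed

lemma column_tableau_nested:
  assumes D: "\<And>k. a \<le> k \<Longrightarrow> k \<le> lam 1 \<Longrightarrow> D k \<subseteq> {1..n} \<and> card (D k) = len k \<and> D k \<subseteq> D a"
    and k: "1 \<le> a" "a \<le> k" "k \<le> lam 1" and i: "1 \<le> i" "i \<le> len k"
  shows "\<exists>i'. 1 \<le> i' \<and> i' \<le> len a \<and> column_tableau D (k, i) = column_tableau D (a, i')"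
proof -
  have fin: "finite (D k)" "finite (D a)"
    using D[of k] D[of a] k finite_subset[of _ "{1..n}"] by auto
  have "nth_least (D k) i \<in> D k" using D[of k] k i fin by (intro nth_least_mem) auto
  then have "nth_least (D k) i \<in> D a" using D[of k] k by auto
  then obtain i' where "1 \<le> i'" "i' \<le> card (D a)" "nth_least (D k) i = nth_least (D a) i'"
    using nth_least_obtain[OF fin(2)] by blast
  then show ?thesis using D[of a] k i by (intro exI[of _ i']) (auto simp: column_tableau_eq)
qed

lemma key_columns_nth:
  assumes p: "p permutes {1..n}" and j: "1 \<le> j" "j \<le> lam 1"
  shows "key_columns n lam p ! (j - 1) = p ` {1..len j}"
proof -
  define f where "f h = replicate (lam (q h) - lam (q (h + 1))) (init p h)" for h
  \<comment> \<open>\<open>L m\<close> is made of the full columns and the blocks beyond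
    \<open>m\<close>; it covers the columns of length at least \<open>q (m + 1)\<close>, which are
    the first \<open>lam (q (m + 1))\<close> ones. Long columns come first, so the induction runs
    down from \<open>r\<close>.\<close>
  define L where "L m = replicate (lam n) {1..n} @ concat (map f (rev [m + 1..<r + 1]))" for m
  have "length (L m) = lam (q (m + 1)) \<and>
      (\<forall>j. 1 \<le> j \<and> j \<le> lam (q (m + 1)) \<longrightarrow> L m ! (j - 1) = p ` {1..len j})" if "m \<le> r" for m
    using that
  proof (induction m rule: inc_induct)
    case base
    have "L r = replicate (lam n) {1..n}" by (simp add: L_def)
    moreover have "len j = n" if "j \<le> lam n" for j
      using that le_len_iff[of n j] n_ge_1 len_le_n[of j] by auto
    ultimately show ?case using permutes_image[OF p] by auto
  next
    case (step m)
    have L: "L m = L (Suc m) @ f (Suc m)"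
      using step.hyps by (simp add: L_def upt_conv_Cons del: upt_Suc)
    have q: "1 \<le> q (Suc m)" "q (Suc m) \<le> q (Suc (Suc m))" "q (Suc (Suc m)) \<le> n"
      using q_less[of 0 "Suc m"] q_le[of "Suc m" "Suc (Suc m)"] q_le_n[of "Suc (Suc m)"] step.hyps by auto
    have anti: "lam (q (Suc (Suc m))) \<le> lam (q (Suc m))" "lam (q (Suc m)) \<le> lam 1"
      using lam_antimono[of "q (Suc m)" "q (Suc (Suc m))"] lam_antimono[of 1 "q (Suc m)"] q by auto
    have len_f: "len j = q (Suc m)"
      if j: "1 \<le> j" "lam (q (Suc (Suc m))) < j" "j \<le> lam (q (Suc m))" for j
    proof -
      obtain h where h: "1 \<le> h" "h \<le> Suc r" "len j = q h" using len_obtain_q[of j] j anti by auto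
      have "q (Suc m) \<le> len j" using le_len_iff[of "q (Suc m)" j] q j by auto
      moreover have "len j < q (Suc (Suc m))" using le_len_iff[of "q (Suc (Suc m))" j] q j by auto
      ultimately have "\<not> h < Suc m" "\<not> Suc (Suc m) \<le> h"
        using q_less[of h "Suc m"] q_le[of "Suc (Suc m)" h] h step.hyps by auto
      then have "h = Suc m" by simp
      then show ?thesis using h by simp
    qed
    have IH: "length (L (Suc m)) = lam (q (Suc (Suc m)))"
      "\<And>j. 1 \<le> j \<Longrightarrow> j \<le> lam (q (Suc (Suc m))) \<Longrightarrow> L (Suc m) ! (j - 1) = p ` {1..len j}"
      using step.IH by auto
    have "L m ! (j - 1) = p ` {1..len j}" if j: "1 \<le> j" "j \<le> lam (q (Suc m))" for j
    proof (cases "j \<le> lam (q (Suc (Suc m)))")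
      case True
      then have "j - 1 < length (L (Suc m))" using IH(1) j by simp
      then show ?thesis using IH(2)[OF j(1) True] by (simp only: L nth_append if_True)
    next
      case False
      then have "\<not> j - 1 < length (L (Suc m))"
        "j - 1 - length (L (Suc m)) < lam (q (Suc m)) - lam (q (Suc m + 1))" using IH(1) j by auto
      then have "L m ! (j - 1) = init p (Suc m)"
        by (simp only: L nth_append if_False f_def nth_replicate)
      then show ?thesis using len_f[of j] j False by (simp add: init_set_def)
    qed
    moreover have "length (L m) = lam (q (Suc m))" using IH(1) anti by (simp add: L f_def)
    ultimately show ?case by simp
  qed
  from this[of 0] have L0: "\<And>j. 1 \<le> j \<Longrightarrow> j \<le> lam (q 1) \<Longrightarrow> L 0 ! (j - 1) = p ` {1..len j}" by simp
  obtain h where h: "1 \<le> h" "h \<le> Suc r" "len j = q h" using len_obtain_q[OF j] .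
  have "q 1 \<le> len j" "1 \<le> q 1" "q 1 \<le> n" using q_le[of 1 h] q_less[of 0 1] q_le_n[of 1] h by auto
  then have "j \<le> lam (q 1)" using le_len_iff[of "q 1" j] by simp
  moreover have "key_columns n lam p = L 0"
    by (simp add: key_columns_def L_def f_def[abs_def] Let_def del: upt_Suc)
  ultimately show ?thesis using L0 j by simp
qed

lemma key_tableau_eq:
  assumes "p permutes {1..n}"
  shows "key_tableau n lam p = column_tableau (\<lambda>j. p ` {1..len j})"
proof
  fix b :: box
  obtain j i where "b = (j, i)" by fastforce
  then show "key_tableau n lam p b = column_tableau (\<lambda>j. p ` {1..len j}) b"
    using key_columns_nth[OF assms, of j]
    by (auto simp: key_tableau_def column_tableau_def shape_iff restrict_def nth_least_def)
qed

lemma key_tableau_entry: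
  assumes "p permutes {1..n}" "1 \<le> j" "j \<le> lam 1" "1 \<le> i" "i \<le> len j"
  shows "key_tableau n lam p (j, i) = nth_least (p ` {1..len j}) i"
  using assms by (simp add: key_tableau_eq column_tableau_eq)

lemma key_column_facts:
  assumes p: "p permutes {1..n}"
  shows "p ` {1..len j} \<subseteq> {1..n} \<and> card (p ` {1..len j}) = len j"
    and "j \<le> k \<Longrightarrow> p ` {1..len k} \<subseteq> p ` {1..len j}"
proof -
  have "p ` {1..len j} \<subseteq> p ` {1..n}" using len_le_n[of j] by (intro image_mono) auto
  then show "p ` {1..len j} \<subseteq> {1..n} \<and> card (p ` {1..len j}) = len j"
    using permutes_image[OF p] card_image_permutes[OF p] by simp
  show "j \<le> k \<Longrightarrow> p ` {1..len k} \<subseteq> p ` {1..len j}" using len_antimono[of j k] by (intro image_mono) auto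
qed

lemma key_tableau_in_tableaux:
  assumes p: "p permutes {1..n}"
  shows "key_tableau n lam p \<in> tableaux n lam"
  unfolding key_tableau_eq[OF p]
proof (rule column_tableau_in_tableaux)
  fix j i assume "1 \<le> j" "j + 1 \<le> lam 1" "1 \<le> i" "i \<le> len (j + 1)"
  then show "nth_least (p ` {1..len j}) i \<le> nth_least (p ` {1..len (j + 1)}) i"
    using key_column_facts[OF p, of "j + 1"] key_column_facts(2)[OF p, of j "j + 1"]
    by (intro nth_least_subset) auto
qed (rule key_column_facts[OF p])

lemma tab_le_iff:
  "tab_le n lam T T' \<longleftrightarrow>
     (\<forall>j i. 1 \<le> j \<and> j \<le> lam 1 \<and> 1 \<le> i \<and> i \<le> len j \<longrightarrow> T (j, i) \<le> T' (j, i))"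
  by (auto simp: tab_le_def shape_iff)

lemma scanI:
  assumes "T \<in> tableaux n lam" "1 \<le> j" "j \<le> lam 1" shows "scan n lam T j"
  by unfold_locales (use assms in auto)

lemma demazure_set_le_key:
  assumes "T \<in> demazure_set n lam p"
  shows "tab_le n lam T (key_tableau n lam p)"
  unfolding tab_le_iff
proof (intro allI impI)
  fix j i assume *: "1 \<le> j \<and> j \<le> lam 1 \<and> 1 \<le> i \<and> i \<le> len j"
  have "T \<in> tableaux n lam" using assms by (simp add: demazure_set_def)
  then have "T (j, i) \<le> scanning_tableau n lam T (j, i)"
    using scan.scanning_tableau_ge[OF scanI, of T j i] * by blast
  also have "\<dots> \<le> key_tableau n lam p (j, i)"
    using assms * unfolding demazure_set_def tab_le_iff by blast
  finally show "T (j, i) \<le> key_tableau n lam p (j, i)" .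
qed

text \<open>The columns of a key are nested, so scanning does not raise it. Together with
  \<open>demazure_set_le_key\<close> this makes the key the maximum of its Demazure set, from which
  it can be recovered.\<close>

lemma key_in_demazure_set:
  assumes p: "p permutes {1..n}"
  shows "key_tableau n lam p \<in> demazure_set n lam p"
proof -
  let ?Y = "key_tableau n lam p"
  note tab = key_tableau_in_tableaux[OF p]
  have "scanning_tableau n lam ?Y (j, i) \<le> ?Y (j, i)"
    if j: "1 \<le> j" "j \<le> lam 1" and i: "1 \<le> i" "i \<le> len j" for j i
  proof -
    have "\<exists>i'. 1 \<le> i' \<and> i' \<le> len j \<and> ?Y (k, i) = ?Y (j, i')"
      if "j \<le> k" "k \<le> lam 1" "1 \<le> i" "i \<le> len k" for k i
      unfolding key_tableau_eq[OF p]
      by (rule column_tableau_nested) (use key_column_facts[OF p] that j in auto)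
    then show ?thesis
      using scan.scanning_tableau_nested_column[OF scanI[OF tab j] _ i] by simp
  qed
  then show ?thesis using tab by (simp add: demazure_set_def tab_le_iff)
qed

lemma tableaux_eqI:
  assumes "T \<in> tableaux n lam" "T' \<in> tableaux n lam" "tab_le n lam T T'" "tab_le n lam T' T"
  shows "T = T'"
  using assms unfolding tableaux_def tab_le_def
  by (intro PiE_ext[of T "shape n lam" _ T']) (auto intro: antisym)

lemma demazure_set_inj:
  assumes p: "p \<in> R_perms n R" and p': "p' \<in> R_perms n R"
    and eq: "demazure_set n lam p = demazure_set n lam p'"
  shows "p = p'"
proof (rule R_perms_eqI[OF p p'])
  have perm: "p permutes {1..n}" "p' permutes {1..n}" using p p' by (auto simp: R_perms_def)
  have Y: "key_tableau n lam p = key_tableau n lam p'"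
    using demazure_set_le_key key_in_demazure_set perm eq
    by (intro tableaux_eqI key_tableau_in_tableaux) auto
  fix h assume h: "1 \<le> h" "h \<le> r"
  obtain j where j: "1 \<le> j" "j \<le> lam 1" "len j = q h" using q_obtain_len[OF h] .
  have "init p h = nth_least (init p h) ` {1..q h}"
    using nth_least_image[of "init p h"] card_init[OF perm(1)] by simp
  also have "\<dots> = nth_least (init p' h) ` {1..q h}"
  proof (rule image_cong[OF refl])
    fix i assume "i \<in> {1..q h}"
    then show "nth_least (init p h) i = nth_least (init p' h) i"
      using key_tableau_entry[OF perm(1), of j i] key_tableau_entry[OF perm(2), of j i] Y j
      by (simp add: init_set_def)
  qed
  also have "\<dots> = init p' h"
    using nth_least_image[of "init p' h"] card_init[OF perm(2)] by simp
  finally show "init p h = init p' h" .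
qed

text \<open>The inclusion of the row bound set is the hard one. The bounds pass to the floor flag,
  survive the scan, and return to \<open>?g\<close> because a strictly increasing column below the
  flag lies below its core; \<open>rank_tuple_attains_init\<close> then lowers them to the
  key.\<close>

lemma demazure_set_avoiding:
  assumes p: "p \<in> R_312_avoiding n R"
  shows "demazure_set n lam p = row_bound_set n lam (rank_tuple n R p)"
proof -
  let ?g = "rank_tuple n R p"
  let ?f = "floor_map n R ?g"
  note perm = avoiding_permutes[OF p] and gap = rank_tuple_gapless[OF p]
  have col: "\<exists>h. 1 \<le> h \<and> h \<le> Suc r \<and> len j = q h \<and> p ` {1..len j} = init p h"
    if "1 \<le> j" "j \<le> lam 1" for j
    using len_obtain_q[OF that] by (metis init_set_def)
  show ?thesis
  proof (intro equalityI subsetI)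
    fix T assume T: "T \<in> demazure_set n lam p"
    then have tab: "T \<in> tableaux n lam" by (simp add: demazure_set_def)
    have "T (j, i) \<le> ?g i" if ji: "1 \<le> j" "j \<le> lam 1" "1 \<le> i" "i \<le> len j" for j i
    proof -
      obtain h where h: "h \<le> Suc r" "len j = q h" "p ` {1..len j} = init p h" using col ji by blast
      have "T (j, i) \<le> nth_least (init p h) i"
        using demazure_set_le_key[OF T] key_tableau_entry[OF perm ji] h(3) ji unfolding tab_le_iff by metis
      also have "\<dots> \<le> ?g i" using nth_least_init_le_rank_tuple[OF perm h(1)] ji h(2) by simp
      finally show ?thesis .
    qed
    then show "T \<in> row_bound_set n lam ?g" using tab unfolding row_bound_set_iff by blast
  next
    fix T assume T: "T \<in> row_bound_set n lam ?g"
    then have tab: "T \<in> tableaux n lam" and Tf: "T \<in> row_bound_set n lam ?f"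
      using row_bound_set_floor_map[OF gap] by (auto simp: row_bound_set_iff)
    have mono: "mono_on {1..n} ?f" using floor_map_flag[OF gap] by (simp add: upper_flags_def)
    let ?S = "scanning_tableau n lam T"
    have "?S (j, i) \<le> key_tableau n lam p (j, i)" if ji: "1 \<le> j" "j \<le> lam 1" "1 \<le> i" "i \<le> len j" for j i
    proof -
      note sc = scanI[OF tab ji(1,2)]
      have strict: "strict_mono_on {1..len j} (\<lambda>i. ?S (j, i))"
        by (rule scan.scanning_tableau_strict_mono[OF sc])
      have le_f: "?S (j, i) \<le> ?f i" if "1 \<le> i" "i \<le> len j" for i
        by (rule scan.scanning_tableau_le_flag[OF sc mono Tf that])
      have le_g: "?S (j, i) \<le> ?g i" if "1 \<le> i" "i \<le> len j" for i
        using column_le_core[OF floor_map_upper[OF gap] ji(1,2) strict le_f that] core_floor_map[OF gap]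
        by simp
      obtain h where h: "h \<le> Suc r" "len j = q h" "p ` {1..len j} = init p h" using col ji by blast
      obtain z where z: "i \<le> z" "z \<le> q h" "?g z \<le> nth_least (init p h) i + (z - i)"
        using rank_tuple_attains_init[OF p h(1) ji(3)] ji(4)[unfolded h(2)] by blast
      have "?S (j, i) + (z - i) \<le> ?S (j, z)"
        by (rule strict_mono_on_gap[OF strict]) (use z ji h(2) in auto)
      also have "\<dots> \<le> ?g z" using le_g[of z] z ji h(2) by simp
      finally have "?S (j, i) \<le> nth_least (init p h) i" using z(3) by simp
      then show ?thesis using key_tableau_entry[OF perm ji] h(3) by simp
    qed
    then show "T \<in> demazure_set n lam p" using tab by (simp add: demazure_set_def tab_le_iff)
  qed
qed

text \<open>In a key whose columns follow a 312-pattern \<open>a, b, c\<close>, replacing the value at \<open>a\<close> by the one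
  at \<open>c\<close> in the short columns lowers the key, but scanning then carries the value at \<open>c\<close> into a
  column of the key that does not contain it.\<close>

lemma containing_witness:
  assumes p: "p \<in> R_perms n R" and not_avoiding: "p \<notin> R_312_avoiding n R"
  obtains T where "T \<in> tableaux n lam" "tab_le n lam T (key_tableau n lam p)" "T \<notin> demazure_set n lam p"
proof -
  have perm: "p permutes {1..n}" using p by (simp add: R_perms_def)
  obtain h a b c where h: "1 \<le> h" "h \<le> r" and a: "a \<in> init p h" and b: "b \<in> init p (Suc h)" "b \<notin> init p h"
    and bc: "b < c" and ca: "c < a" and c: "c \<notin> init p (Suc h)"
    using p not_avoiding unfolding avoiding_iff fills_gaps_def by blast
  have cn: "c \<in> {1..n}" using a init_subset[OF perm, of h] h bc ca by auto
  have "h \<noteq> r" using c cn init_last[OF perm] by auto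
  then have h': "Suc h \<le> r" using h by simp
  have q: "1 \<le> q h" "q h < q (Suc h)" "q (Suc h) \<le> n"
    using q_less[of 0 h] q_less[of h "Suc h"] q_le_n[of "Suc h"] h by auto
  \<comment> \<open>The last column of length at least \<open>q (Suc h)\<close>: between columns
    \<open>j\<close> and \<open>j + 1\<close> the key passes from \<open>init p (Suc h)\<close> to
    \<open>init p h\<close>. Both lengths occur because \<open>Suc h \<le> r\<close>.\<close>
  define j where "j = lam (q (Suc h))"
  have lenj: "k \<le> j \<longleftrightarrow> q (Suc h) \<le> len k" for k
    using le_len_iff[of "q (Suc h)" k] q unfolding j_def by auto
  obtain j1 where j1: "1 \<le> j1" "j1 \<le> lam 1" "len j1 = q (Suc h)" using q_obtain_len[of "Suc h"] h' by auto
  obtain j2 where j2: "1 \<le> j2" "j2 \<le> lam 1" "len j2 = q h" using q_obtain_len[of h] h by auto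
  have j: "1 \<le> j" "len j = q (Suc h)"
    using lenj[of j1] lenj[of j] j1 len_antimono[of j1 j] by auto
  have jj2: "j + 1 \<le> j2" using lenj[of j2] j2 q by auto
  then have jl: "j + 1 \<le> lam 1" using j2 by simp
  have short: "len k \<le> q h" if k: "1 \<le> k" "k \<le> lam 1" "j < k" for k
  proof -
    obtain m where m: "m \<le> Suc r" "len k = q m" using len_obtain_q[OF k(1,2)] by blast
    have "len k < q (Suc h)" using lenj[of k] k by auto
    then show ?thesis using q_le[of "Suc h" m] q_le[of m h] m h by (cases "m \<le> h") auto
  qed
  have lenj1: "len (j + 1) = q h" using short[of "j + 1"] jl len_antimono[OF jj2] j2 by auto
  define P where "P k = p ` {1..len k}" for k
  have P: "P k \<subseteq> {1..n}" "card (P k) = len k" "finite (P k)" for k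
    using key_column_facts(1)[OF perm, of k] finite_subset[of "P k" "{1..n}"] unfolding P_def by auto
  have P_mono: "P k \<subseteq> P l" if "l \<le> k" for k l using key_column_facts(2)[OF perm that] unfolding P_def .
  have Pj: "P j = init p (Suc h)" "P (j + 1) = init p h"
    using j lenj1 by (simp_all add: P_def init_set_def)
  have c_short: "c \<notin> P k" if "j \<le> k" for k using P_mono[OF that] Pj c by auto
  define D where "D k = (if j < k \<and> a \<in> P k then insert c (P k - {a}) else P k)" for k
  have D_sub: "D k \<subseteq> {1..n}" for k using P(1)[of k] cn unfolding D_def by auto
  have finD: "finite (D k)" for k using D_sub finite_subset by blast
  have D_card: "card (D k) = len k" for k
  proof (cases "j < k \<and> a \<in> P k")
    case True
    then have "card (D k) = Suc (card (P k - {a}))"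
      using c_short[of k] P(3)[of k] unfolding D_def by simp
    also have "\<dots> = card (P k)" using True P(3)[of k] by (intro card.remove[symmetric]) auto
    finally show ?thesis using P(2) by simp
  qed (use P(2)[of k] D_def in auto)
  have D_nested: "D k \<subseteq> D l" if "j < l" "l \<le> k" for k l
    using P_mono[OF that(2)] that unfolding D_def by auto
  have count_swap: "count_le (P k) x = count_le (P k - {a}) x + (if a \<le> x then 1 else 0)"
    "count_le (D k) x = count_le (P k - {a}) x + (if c \<le> x then 1 else 0)"
    if "j < k" "a \<in> P k" for k x
    using count_le_insert[of "P k - {a}" a x] count_le_insert[of "P k - {a}" c x]
      c_short[of k] P(3)[of k] that by (auto simp: D_def insert_absorb)
  have ajP: "a \<in> P (j + 1)" using a Pj by simp
  \<comment> \<open>This is where \<open>b\<close> enters. For \<open>c \<le> x < a\<close> the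
    exchange adds a value up to \<open>x\<close> in column \<open>j + 1\<close>; column
    \<open>j\<close> makes up for it with \<open>b\<close>, which column \<open>j + 1\<close>
    lacks.\<close>
  have count_j: "count_le (D (j + 1)) x \<le> count_le (P j) x" for x
  proof -
    have sub: "count_le (P (j + 1)) x \<le> count_le (P j) x"
      using P_mono[of j "j + 1"] P(3) by (intro count_le_subset) auto
    show ?thesis
    proof (cases "c \<le> x \<and> x < a")
      case True
      have "Suc (count_le (P (j + 1)) x) = count_le (insert b (P (j + 1))) x"
        using count_le_insert[of "P (j + 1)" b x] b Pj P(3) True bc by simp
      also have "\<dots> \<le> count_le (P j) x"
        using P_mono[of j "j + 1"] b Pj P(3) by (intro count_le_subset) auto
      finally show ?thesis using count_swap[of "j + 1" x] ajP True by auto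
    next
      case False
      then have "(if c \<le> x then 1 else 0) = (if a \<le> x then 1 else 0 :: nat)" using ca by auto
      then have "count_le (D (j + 1)) x = count_le (P (j + 1)) x"
        using count_swap[of "j + 1" x] ajP by simp
      then show ?thesis using sub by simp
    qed
  qed
  define T where "T = column_tableau D"
  have tab: "T \<in> tableaux n lam"
    unfolding T_def
  proof (rule column_tableau_in_tableaux)
    fix k i assume k: "1 \<le> k" "k + 1 \<le> lam 1" and i: "1 \<le> i" "i \<le> len (k + 1)"
    have ik: "i \<le> len k" using i len_antimono[of k "k + 1"] by simp
    consider "k < j" | "k = j" | "j < k" by linarith
    then show "nth_least (D k) i \<le> nth_least (D (k + 1)) i"
    proof cases
      case 1
      then have "D (k + 1) \<subseteq> D k" using P_mono[of k "k + 1"] by (simp add: D_def)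
      then show ?thesis using finD D_card i by (intro nth_least_subset) auto
    next
      case 2
      then have "D k = P j" by (simp add: D_def)
      then show ?thesis
        using 2 count_j finD[of k] finD[of "k + 1"] D_card[of k] D_card[of "k + 1"] i ik
        by (intro nth_least_mono_count) auto
    next
      case 3
      then show ?thesis using D_nested[of k "k + 1"] finD D_card i by (intro nth_least_subset) auto
    qed
  qed (use D_sub D_card in auto)
  have le: "tab_le n lam T (key_tableau n lam p)"
    unfolding tab_le_iff
  proof (intro allI impI)
    fix k i assume ki: "1 \<le> k \<and> k \<le> lam 1 \<and> 1 \<le> i \<and> i \<le> len k"
    have "nth_least (D k) i \<le> nth_least (P k) i"
    proof (cases "j < k \<and> a \<in> P k")
      case True
      then show ?thesis using count_swap[of k] ca finD P D_card ki
        by (intro nth_least_mono_count) auto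
    qed (auto simp: D_def)
    then show "T (k, i) \<le> key_tableau n lam p (k, i)"
      using ki by (simp add: T_def column_tableau_eq key_tableau_entry[OF perm] P_def)
  qed
  have "T \<notin> demazure_set n lam p"
  proof
    assume T: "T \<in> demazure_set n lam p"
    have "c \<in> D (j + 1)" using ajP by (simp add: D_def)
    then obtain i where i: "1 \<le> i" "i \<le> card (D (j + 1))" "c = nth_least (D (j + 1)) i"
      using nth_least_obtain[OF finD] by blast
    have ci: "T (j + 1, i) = c" using i D_card jl by (simp add: T_def column_tableau_eq)
    have jl': "j \<le> lam 1" using jl by simp
    have "\<exists>i'. 1 \<le> i' \<and> i' \<le> len (j + 1) \<and> T (k, i) = T (j + 1, i')"
      if "j + 1 \<le> k" "k \<le> lam 1" "1 \<le> i" "i \<le> len k" for k i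
      unfolding T_def by (rule column_tableau_nested) (use D_sub D_card D_nested that in auto)
    then obtain k where k: "1 \<le> k" "k \<le> len j" "scanning_tableau n lam T (j, k) = T (j + 1, i)"
      using scan.tail_entry_in_scanned_column[OF scanI[OF tab j(1) jl'], of "j + 1" i] i(1)
        i(2)[unfolded D_card] jl by blast
    \<comment> \<open>Column \<open>j\<close> was not altered, so \<open>T\<close> agrees with the
      key there, and the scanned entry is squeezed between two equal values.\<close>
    have "T (j, k) = nth_least (P j) k" using j jl' k by (simp add: T_def column_tableau_eq D_def)
    moreover have "key_tableau n lam p (j, k) = nth_least (P j) k"
      using key_tableau_entry[OF perm j(1) jl' k(1,2)] by (simp add: P_def)
    moreover have "T (j, k) \<le> scanning_tableau n lam T (j, k)"
      by (rule scan.scanning_tableau_ge[OF scanI[OF tab j(1) jl'] k(1,2)])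
    moreover have "scanning_tableau n lam T (j, k) \<le> key_tableau n lam p (j, k)"
      using T j jl' k unfolding demazure_set_def tab_le_iff by blast
    ultimately have "c = nth_least (P j) k" using k ci by simp
    then have "c \<in> P j" using nth_least_mem[OF P(3), of k j] P(2) k by simp
    then show False using c_short by simp
  qed
  then show thesis using that tab le by blast
qed


section \<open>Row bound sets that are Demazure sets\<close>

lemma row_bound_set_down:
  assumes "T \<in> tableaux n lam" "tab_le n lam T T'" "T' \<in> row_bound_set n lam \<beta>"
  shows "T \<in> row_bound_set n lam \<beta>"
  using assms unfolding row_bound_set_iff tab_le_iff by (meson order_trans)

text \<open>Equality puts the key into a set closed downwards, so every tableau below the key lies
  in the Demazure set and a pattern is impossible. After that \<open>\<beta>\<close> and the rank
  tuple have the same row bound set, hence the same core.\<close>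

lemma row_bound_eq_demazure:
  assumes b: "\<beta> \<in> upper_tuples n" and p: "p \<in> R_perms n R"
    and eq: "row_bound_set n lam \<beta> = demazure_set n lam p"
  shows "row_bound_max n lam \<beta> = key_tableau n lam p" "p \<in> R_312_avoiding n R"
    "core n R \<beta> = rank_tuple n R p" "core n R \<beta> \<in> gapless_tuples n R"
proof -
  have perm: "p permutes {1..n}" using p by (simp add: R_perms_def)
  let ?Y = "key_tableau n lam p"
  have Y: "?Y \<in> row_bound_set n lam \<beta>" using key_in_demazure_set[OF perm] eq by simp
  have le: "tab_le n lam T ?Y" if "T \<in> row_bound_set n lam \<beta>" for T
    using demazure_set_le_key that eq by simp
  show "row_bound_max n lam \<beta> = ?Y"
  proof
    fix x
    have "Max ((\<lambda>T. T x) ` row_bound_set n lam \<beta>) = ?Y x" if "x \<in> shape n lam"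
    proof (rule Max_eqI)
      have "(\<lambda>T. T x) ` row_bound_set n lam \<beta> \<subseteq> {..?Y x}"
        using le that by (auto simp: tab_le_def)
      then show "finite ((\<lambda>T. T x) ` row_bound_set n lam \<beta>)" using finite_subset by blast
    qed (use le Y that in \<open>auto simp: tab_le_def\<close>)
    then show "row_bound_max n lam \<beta> x = ?Y x"
      by (auto simp: row_bound_max_def key_tableau_def restrict_def)
  qed
  show avoiding: "p \<in> R_312_avoiding n R"
  proof (rule ccontr)
    assume "p \<notin> R_312_avoiding n R"
    then obtain T where "T \<in> tableaux n lam" "tab_le n lam T ?Y" "T \<notin> demazure_set n lam p"
      using containing_witness[OF p] by blast
    then show False using row_bound_set_down[OF _ _ Y] eq by blast
  qed
  have "core n R \<beta> = core n R (rank_tuple n R p)"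
    using eq demazure_set_avoiding[OF avoiding] rank_tuple_upper_increasing[OF perm] b
    by (intro row_bound_set_eq_imp_core_eq) (auto simp: upper_increasing_iff)
  then show "core n R \<beta> = rank_tuple n R p"
    using core_upper_increasing_id[OF rank_tuple_upper_increasing[OF perm]] by simp
  then show "core n R \<beta> \<in> gapless_tuples n R" using rank_tuple_gapless[OF avoiding] by simp
qed

lemma demazure_set_gapless_perm:
  assumes g: "g \<in> gapless_tuples n R"
  shows "demazure_set n lam (gapless_perm n R g) = row_bound_set n lam g"
  using demazure_set_avoiding gapless_perm_avoiding[OF g] by simp

lemma gapless_core_demazure:
  assumes "\<beta> \<in> upper_tuples n" "core n R \<beta> \<in> gapless_tuples n R"
  shows "row_bound_set n lam \<beta> = demazure_set n lam (gapless_perm n R (core n R \<beta>))"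
  using demazure_set_gapless_perm[OF assms(2)] row_bound_set_core[OF assms(1)] by simp

lemma avoiding_R_perms: "p \<in> R_312_avoiding n R \<Longrightarrow> p \<in> R_perms n R"
  by (simp add: R_312_avoiding_def)

section \<open>Equivalences and the two indexings\<close>

lemma ex_demazure_iff_gapless_core:
  assumes "\<beta> \<in> upper_tuples n"
  shows "(\<exists>\<pi>\<in>R_perms n R. row_bound_set n lam \<beta> = demazure_set n lam \<pi>) \<longleftrightarrow>
    core n R \<beta> \<in> gapless_tuples n R"
  using row_bound_eq_demazure(4)[OF assms] gapless_core_demazure[OF assms]
    gapless_perm_avoiding(1) avoiding_R_perms by blast

lemma row_bound_flag_eq:
  assumes "\<beta> \<in> upper_tuples n" "core n R \<beta> \<in> gapless_tuples n R"
  shows "row_bound_set n lam (floor_map n R (core n R \<beta>)) = row_bound_set n lam \<beta>"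
  using row_bound_set_floor_map[OF assms(2)] row_bound_set_core[OF assms(1)] by simp

lemma flag_upper: "f \<in> upper_flags n \<Longrightarrow> f \<in> upper_tuples n"
  by (simp add: upper_flags_def)

lemma bij_betw_floor_map:
  "bij_betw (\<lambda>\<gamma>. row_bound_set n lam (floor_map n R \<gamma>)) (gapless_tuples n R)
     (row_bound_set n lam ` upper_flags n)"
proof (rule bij_betw_imageI)
  show "inj_on (\<lambda>\<gamma>. row_bound_set n lam (floor_map n R \<gamma>)) (gapless_tuples n R)"
  proof (rule inj_onI)
    fix g g' assume g: "g \<in> gapless_tuples n R" and g': "g' \<in> gapless_tuples n R"
      and "row_bound_set n lam (floor_map n R g) = row_bound_set n lam (floor_map n R g')"
    then show "g = g'"
      using row_bound_set_eq_imp_core_eq[OF floor_map_upper[OF g] floor_map_upper[OF g']]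
        core_floor_map[OF g] core_floor_map[OF g'] by simp
  qed
  show "(\<lambda>\<gamma>. row_bound_set n lam (floor_map n R \<gamma>)) ` gapless_tuples n R =
      row_bound_set n lam ` upper_flags n"
  proof (intro equalityI subsetI)
    fix X assume "X \<in> row_bound_set n lam ` upper_flags n"
    then obtain f where f: "f \<in> upper_flags n" "X = row_bound_set n lam f" by blast
    then show "X \<in> (\<lambda>\<gamma>. row_bound_set n lam (floor_map n R \<gamma>)) ` gapless_tuples n R"
      using row_bound_flag_eq[OF flag_upper core_flag_gapless] core_flag_gapless by blast
  qed (use floor_map_flag in auto)
qed

lemma flag_sets_eq_avoiding_sets:
  "row_bound_set n lam ` upper_flags n = demazure_set n lam ` R_312_avoiding n R"
proof (intro equalityI subsetI)
  fix X assume "X \<in> row_bound_set n lam ` upper_flags n"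
  then obtain f where f: "f \<in> upper_flags n" "X = row_bound_set n lam f" by blast
  then show "X \<in> demazure_set n lam ` R_312_avoiding n R"
    using gapless_core_demazure[OF flag_upper core_flag_gapless] core_flag_gapless
      gapless_perm_avoiding(1) by blast
next
  fix X assume "X \<in> demazure_set n lam ` R_312_avoiding n R"
  then obtain p where p: "p \<in> R_312_avoiding n R" "X = demazure_set n lam p" by blast
  then have "X = row_bound_set n lam (floor_map n R (rank_tuple n R p))"
    using demazure_set_avoiding row_bound_set_floor_map rank_tuple_gapless by simp
  then show "X \<in> row_bound_set n lam ` upper_flags n"
    using floor_map_flag[OF rank_tuple_gapless[OF p(1)]] by blast
qed

end

theorem theorem13p1:
  fixes n :: nat and lam :: "nat \<Rightarrow> nat" and R :: "nat set"
  assumes "n \<ge> 1" and "is_partition n lam" and "R = short_col_lens n lam"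
  shows
    "((\<forall>\<beta>\<in>upper_tuples n.
        (\<exists>\<pi>\<in>R_perms n R. row_bound_set n lam \<beta> = demazure_set n lam \<pi>)
          \<longleftrightarrow> core n R \<beta> \<in> gapless_tuples n R)
     \<and> (\<forall>\<phi>\<in>upper_flags n. \<exists>\<pi>\<in>R_perms n R. row_bound_set n lam \<phi> = demazure_set n lam \<pi>)
     \<and> (\<forall>\<beta>\<in>upper_tuples n.
        (\<exists>\<pi>\<in>R_perms n R. row_bound_set n lam \<beta> = demazure_set n lam \<pi>)
          \<longleftrightarrow> (\<exists>\<phi>\<in>upper_flags n. row_bound_set n lam \<beta> = row_bound_set n lam \<phi>))
     \<and> (\<forall>\<pi>\<in>R_perms n R.
        (\<exists>\<beta>\<in>upper_tuples n. demazure_set n lam \<pi> = row_bound_set n lam \<beta>)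
          \<longleftrightarrow> \<pi> \<in> R_312_avoiding n R))
     \<and> (\<forall>\<beta>\<in>gapless_core_tuples n R. let \<pi> = gapless_perm n R (core n R \<beta>) in
       \<pi> \<in> R_perms n R
       \<and> row_bound_set n lam \<beta> = demazure_set n lam \<pi>
       \<and> (\<forall>\<sigma>\<in>R_perms n R. row_bound_set n lam \<beta> = demazure_set n lam \<sigma> \<longrightarrow> \<sigma> = \<pi>)
       \<and> \<pi> \<in> R_312_avoiding n R)
     \<and> (\<forall>\<pi>\<in>R_312_avoiding n R. let \<gamma> = rank_tuple n R \<pi> in
       demazure_set n lam \<pi> = row_bound_set n lam \<gamma>
       \<and> \<gamma> \<in> gapless_tuples n R
       \<and> (\<forall>\<beta>\<in>upper_tuples n. demazure_set n lam \<pi> = row_bound_set n lam \<beta>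
            \<longrightarrow> core n R \<beta> = \<gamma> \<and> \<beta> \<in> gapless_core_tuples n R))
     \<and> (\<forall>\<beta>\<in>upper_tuples n. \<forall>\<pi>\<in>R_perms n R.
       row_bound_set n lam \<beta> = demazure_set n lam \<pi> \<longrightarrow>
         row_bound_max n lam \<beta> = key_tableau n lam \<pi>
         \<and> core n R \<beta> = rank_tuple n R \<pi>
         \<and> \<beta> \<in> gapless_core_tuples n R
         \<and> \<pi> \<in> R_312_avoiding n R)
     \<and> (row_bound_set n lam ` upper_flags n = demazure_set n lam ` R_312_avoiding n R
     \<and> bij_betw (\<lambda>\<gamma>. row_bound_set n lam (floor_map n R \<gamma>)) (gapless_tuples n R)
                (row_bound_set n lam ` upper_flags n)
     \<and> bij_betw (\<lambda>\<gamma>. demazure_set n lam (gapless_perm n R \<gamma>)) (gapless_tuples n R)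
                (demazure_set n lam ` R_312_avoiding n R)
     \<and> (\<forall>\<gamma>\<in>gapless_tuples n R.
          row_bound_set n lam (floor_map n R \<gamma>) = demazure_set n lam (gapless_perm n R \<gamma>)
          \<and> floor_map n R \<gamma> \<in> floor_flags n R
          \<and> gapless_perm n R \<gamma> \<in> R_312_avoiding n R))"
proof -
  interpret partition n lam by unfold_locales (use assms in auto)
  let ?R = "short_col_lens n lam"
  let ?S = "row_bound_set n lam" and ?D = "demazure_set n lam"
  show ?thesis
    unfolding assms(3) Let_def
  proof (intro conjI ballI impI)
    fix \<beta> assume b: "\<beta> \<in> upper_tuples n"
    show "(\<exists>\<pi>\<in>R_perms n ?R. ?S \<beta> = ?D \<pi>) \<longleftrightarrow> core n ?R \<beta> \<in> gapless_tuples n ?R"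
      by (rule ex_demazure_iff_gapless_core[OF b])
  next
    fix \<phi> assume f: "\<phi> \<in> upper_flags n"
    show "\<exists>\<pi>\<in>R_perms n ?R. ?S \<phi> = ?D \<pi>"
      using ex_demazure_iff_gapless_core[OF flag_upper[OF f]] core_flag_gapless[OF f] by blast
  next
    fix \<beta> assume b: "\<beta> \<in> upper_tuples n"
    show "(\<exists>\<pi>\<in>R_perms n ?R. ?S \<beta> = ?D \<pi>) \<longleftrightarrow> (\<exists>\<phi>\<in>upper_flags n. ?S \<beta> = ?S \<phi>)"
    proof
      assume "\<exists>\<pi>\<in>R_perms n ?R. ?S \<beta> = ?D \<pi>"
      then have "core n ?R \<beta> \<in> gapless_tuples n ?R" using ex_demazure_iff_gapless_core[OF b] by blast
      then show "\<exists>\<phi>\<in>upper_flags n. ?S \<beta> = ?S \<phi>"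
        using row_bound_flag_eq[OF b] floor_map_flag by blast
    next
      assume "\<exists>\<phi>\<in>upper_flags n. ?S \<beta> = ?S \<phi>"
      then show "\<exists>\<pi>\<in>R_perms n ?R. ?S \<beta> = ?D \<pi>"
        using ex_demazure_iff_gapless_core[OF flag_upper] core_flag_gapless by metis
    qed
  next
    fix \<pi> assume p: "\<pi> \<in> R_perms n ?R"
    show "(\<exists>\<beta>\<in>upper_tuples n. ?D \<pi> = ?S \<beta>) \<longleftrightarrow> \<pi> \<in> R_312_avoiding n ?R"
      using row_bound_eq_demazure(2)[OF _ p] demazure_set_avoiding[of \<pi>]
        gapless_upper[OF rank_tuple_gapless[of \<pi>]] by metis
  next
    fix \<beta> assume "\<beta> \<in> gapless_core_tuples n ?R"
    then have b: "\<beta> \<in> upper_tuples n" and g: "core n ?R \<beta> \<in> gapless_tuples n ?R"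
      by (auto simp: gapless_core_tuples_def)
    let ?p = "gapless_perm n ?R (core n ?R \<beta>)"
    show av: "?p \<in> R_312_avoiding n ?R" by (rule gapless_perm_avoiding(1)[OF g])
    then show p: "?p \<in> R_perms n ?R" by (rule avoiding_R_perms)
    show eq: "?S \<beta> = ?D ?p" by (rule gapless_core_demazure[OF b g])
    fix \<sigma> assume "\<sigma> \<in> R_perms n ?R" "?S \<beta> = ?D \<sigma>"
    then show "\<sigma> = ?p" using demazure_set_inj[OF _ p] eq by simp
  next
    fix \<pi> assume p: "\<pi> \<in> R_312_avoiding n ?R"
    show "?D \<pi> = ?S (rank_tuple n ?R \<pi>)" by (rule demazure_set_avoiding[OF p])
    show "rank_tuple n ?R \<pi> \<in> gapless_tuples n ?R" by (rule rank_tuple_gapless[OF p])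
    fix \<beta> assume b: "\<beta> \<in> upper_tuples n" and "?D \<pi> = ?S \<beta>"
    then have eq: "?S \<beta> = ?D \<pi>" by simp
    show "core n ?R \<beta> = rank_tuple n ?R \<pi>" "\<beta> \<in> gapless_core_tuples n ?R"
      using row_bound_eq_demazure(3,4)[OF b avoiding_R_perms[OF p] eq] b
      by (auto simp: gapless_core_tuples_def)
  next
    fix \<beta> \<pi> assume b: "\<beta> \<in> upper_tuples n" and p: "\<pi> \<in> R_perms n ?R" and eq: "?S \<beta> = ?D \<pi>"
    note facts = row_bound_eq_demazure[OF b p eq]
    show "row_bound_max n lam \<beta> = key_tableau n lam \<pi>" "core n ?R \<beta> = rank_tuple n ?R \<pi>"
      "\<pi> \<in> R_312_avoiding n ?R" by (fact facts)+
    show "\<beta> \<in> gapless_core_tuples n ?R" using facts(4) b by (simp add: gapless_core_tuples_def)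
  next
    show sets: "?S ` upper_flags n = ?D ` R_312_avoiding n ?R" by (rule flag_sets_eq_avoiding_sets)
    show bij: "bij_betw (\<lambda>\<gamma>. ?S (floor_map n ?R \<gamma>)) (gapless_tuples n ?R) (?S ` upper_flags n)"
      by (rule bij_betw_floor_map)
    have agree: "?S (floor_map n ?R \<gamma>) = ?D (gapless_perm n ?R \<gamma>)" if "\<gamma> \<in> gapless_tuples n ?R" for \<gamma>
      using row_bound_set_floor_map[OF that] demazure_set_gapless_perm[OF that] by simp
    \<comment> \<open>The two indexing maps agree on gapless tuples and have the same target, so
      bijectivity of the first gives that of the second.\<close>
    show "bij_betw (\<lambda>\<gamma>. ?D (gapless_perm n ?R \<gamma>)) (gapless_tuples n ?R) (?D ` R_312_avoiding n ?R)"
      using bij bij_betw_cong[of "gapless_tuples n ?R", OF agree] unfolding sets by simp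
    fix \<gamma> assume g: "\<gamma> \<in> gapless_tuples n ?R"
    show "?S (floor_map n ?R \<gamma>) = ?D (gapless_perm n ?R \<gamma>)" by (rule agree[OF g])
    show "floor_map n ?R \<gamma> \<in> floor_flags n ?R" by (rule floor_map_floor_flag[OF g])
    show "gapless_perm n ?R \<gamma> \<in> R_312_avoiding n ?R" by (rule gapless_perm_avoiding(1)[OF g])
  qed
qed

end
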